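(* Suppose that $(u,h)$ is a weak solution (in the sense defined in the context) of the linearized free surface problem with $\Sigma=\mathbb{T}^{N-1}$. Then there is a constant $\delta>0$ such that, for all $t\ge 0$, $$\mathcal{E}_0(t)\le\mathcal{E}_0(0)\exp(-\delta t),$$ where $\mathcal{E}_0$ is the energy $\mathcal{E}_\xi$ at frequency $\xi=0$.
   Context: Fix an integer $N\ge 2$ and $\ell>0$. Let $\Sigma=\mathbb{T}^{N-1}=\mathbb{R}^{N-1}/\mathbb{Z}^{N-1}$, with dual group $\hat\Sigma=\mathbb{Z}^{N-1}$. Set $\Omega=\Sigma\times(0,\ell)$, with points $(x,y)$, $x\in\Sigma$, $y\in(0,\ell)$. The Fourier transform is always in the horizontal variable $x$ only: $\hat f(\xi)=\mathcal{F}f(\xi)=\int_\Sigma f(x)e^{-2\pi i\xi\cdot x}\,dx$, $\xi\in\hat\Sigma$. Boundary operator: $\mu:\hat\Sigma\to\mathbb{R}$ satisfies, for some $\theta>0$, $\theta\le\mu(\xi)\le\frac1\theta(1+|\xi|)^3$ for all $\xi\in\hat\Sigma$, and $M$ is defined by $\mathcal{F}M(h)(\xi)=\mu(\xi)\mathcal{F}h(\xi)$. Let $(\mathbb{D}u)_{ij}=\partial_iu_j+\partial_ju_i$, let $(\cdot,\cdot)$ be the $L^2(\Omega)$ inner product, and let ${}_0H^1_{\mathrm{sol}}=\{u\in H^1(\Omega;\mathbb{R}^N): u=0\text{ on }\{y=0\},\ \operatorname{div}u=0\}$ with inner product $(\nabla u,\nabla v)$; it is embedded in its dual $({}_0H^1_{\mathrm{sol}})^*$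 via the $L^2$ inner product, and $[\cdot,\cdot]$ denotes the duality pairing (dual element first). Weak solution: $(u,h)$ is a weak solution with initial data $(u_0,h_0)$ if $u\in L^2_{\mathrm{loc}}([0,\infty);{}_0H^1_{\mathrm{sol}})$, $\partial_tu\in L^2_{\mathrm{loc}}([0,\infty);({}_0H^1_{\mathrm{sol}})^* )$, $h\in L^2_{\mathrm{loc}}([0,\infty);L^2(\Sigma))$, $M(h)\in L^2_{\mathrm{loc}}([0,\infty);L^2(\Sigma))$, $\partial_th\in L^2_{\mathrm{loc}}([0,\infty);H^{1/2}(\Sigma))$, and (i) $[\partial_tu,v]+\frac12(\mathbb{D}u,\mathbb{D}v)+\int_{\{y=\ell\}}M(h)v_N=0$ for all $v\in L^2([0,T];{}_0H^1_{\mathrm{sol}})$ (all $T>0$), for a.e. $t$; (ii) $\operatorname{div}u=0$; (iii) $\partial_th=u_N$ on $\{y=\ell\}$; (iv) $u=u_0$ and $h=h_0$ at $t=0$; (v) $\int_{\mathbb{T}^{N-1}}h(x,t)\,dx=0$ for all $t\ge0$. Energy at frequency $\xi$: $$\mathcal{E}_\xi(t)=\frac12\int_0^\ell|\hat u(\xi,y,t)|^2\,dy+\frac{\mu(\xi)}2|\hat h(\xi,t)|^2 .$$ *)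

theory Defs
  imports "HOL-Analysis.Analysis"
begin

text \<open>
  The horizontal torus has dimension \<open>CARD('n)\<close>, so the space dimension is \<open>N = CARD('n) + 1\<close>.
  A point of \<open>\<Omega>\<close> is a pair \<open>(x, y)\<close>, and so is a velocity, whose last component \<open>u_N\<close> is
  its \<open>snd\<close>. Cartesian components and directions are indexed by \<open>Basis\<close>. Functions on the torus
  are periodic functions on \<open>real ^ 'n\<close>, integrated over the unit cube; the dual group is
  \<open>int ^ 'n\<close>.
\<close>

type_synonym 'n pt = "(real ^ 'n) \<times> real"
type_synonym 'n field = "'n pt \<Rightarrow> 'n pt"

section \<open>The torus, the slab, and square integrable functions\<close>

definition lattice_vec :: "int ^ 'n \<Rightarrow> real ^ 'n" where
  "lattice_vec k = (\<chi> i. real_of_int (k $ i))"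

definition periodic :: "(real ^ 'n \<Rightarrow> 'b) \<Rightarrow> bool" where
  "periodic f \<longleftrightarrow> (\<forall>k x. f (x + lattice_vec k) = f x)"

definition hperiodic :: "(('n::finite) pt \<Rightarrow> 'b) \<Rightarrow> bool" where
  "hperiodic f \<longleftrightarrow> (\<forall>y. periodic (\<lambda>x. f (x, y)))"

definition torus :: "(real ^ 'n) measure" where
  "torus = restrict_space lborel (cbox 0 1)"

definition slab :: "real \<Rightarrow> ('n::finite) pt measure" where
  "slab ell = restrict_space lborel (cbox 0 1 \<times> {0<..<ell})"

definition sq_integrable :: "'a measure \<Rightarrow> ('a \<Rightarrow> 'b::euclidean_space) \<Rightarrow> bool" where
  "sq_integrable M f \<longleftrightarrow> f \<in> borel_measurable M \<and> integrable M (\<lambda>x. (norm (f x))\<^sup>2)"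

definition L2_inner :: "'a measure \<Rightarrow> ('a \<Rightarrow> 'b::euclidean_space) \<Rightarrow> ('a \<Rightarrow> 'b) \<Rightarrow> real" where
  "L2_inner M f g = (LINT x|M. f x \<bullet> g x)"

definition L2_norm :: "'a measure \<Rightarrow> ('a \<Rightarrow> 'b::euclidean_space) \<Rightarrow> real" where
  "L2_norm M f = sqrt (LINT x|M. (norm (f x))\<^sup>2)"

text \<open>Every class of almost everywhere equal functions in \<open>L\<^sup>2\<close> has a periodic Borel representative.\<close>

definition L2_torus :: "(real ^ 'n \<Rightarrow> 'b::euclidean_space) set" where
  "L2_torus = {f. periodic f \<and> sq_integrable torus f}"

definition L2_slab :: "real \<Rightarrow> (('n::finite) pt \<Rightarrow> 'b::euclidean_space) set" where
  "L2_slab ell = {f. hperiodic f \<and> sq_integrable (slab ell) f}"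

section \<open>Fourier transform in the horizontal variable\<close>

definition fourier :: "(real ^ 'n \<Rightarrow> complex) \<Rightarrow> int ^ 'n \<Rightarrow> complex" where
  "fourier f \<xi> =
    (LINT x|torus. f x * exp (- 2 * of_real pi * \<i> * of_real (lattice_vec \<xi> \<bullet> x)))"

abbreviation rfourier :: "(real ^ 'n \<Rightarrow> real) \<Rightarrow> int ^ 'n \<Rightarrow> complex" where
  "rfourier f \<equiv> fourier (\<lambda>x. complex_of_real (f x))"

text \<open>
  \<open>has_multiplier \<mu> h g\<close> says \<open>M(h) = g \<in> L\<^sup>2\<close>. As \<open>\<mu>\<close> is not assumed to be even, \<open>M(h)\<close> may be
  complex-valued even for real \<open>h\<close>.
\<close>

definition has_multiplier ::
    "(int ^ 'n \<Rightarrow> real) \<Rightarrow> (real ^ 'n \<Rightarrow> real) \<Rightarrow> (real ^ 'n \<Rightarrow> complex) \<Rightarrow> bool" where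
  "has_multiplier \<mu> h g \<longleftrightarrow>
    g \<in> L2_torus \<and> (\<forall>\<xi>. fourier g \<xi> = of_real (\<mu> \<xi>) * rfourier h \<xi>)"

definition Hhalf_norm :: "(real ^ 'n \<Rightarrow> real) \<Rightarrow> real" where
  "Hhalf_norm f =
    sqrt (\<Sum>\<^sub>\<infinity>\<xi>. sqrt (1 + (norm (lattice_vec \<xi>))\<^sup>2) * (cmod (rfourier f \<xi>))\<^sup>2)"

definition Hhalf :: "(real ^ 'n \<Rightarrow> real) set" where
  "Hhalf = {f \<in> L2_torus.
    (\<lambda>\<xi>. sqrt (1 + (norm (lattice_vec \<xi>))\<^sup>2) * (cmod (rfourier f \<xi>))\<^sup>2) summable_on UNIV}"

section \<open>Sobolev spaces on the slab\<close>

primrec Ck :: "nat \<Rightarrow> ('a::euclidean_space \<Rightarrow> real) \<Rightarrow> bool" where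
  "Ck 0 f \<longleftrightarrow> continuous_on UNIV f"
| "Ck (Suc k) f \<longleftrightarrow>
    (\<exists>f'. (\<forall>x. (f has_derivative f' x) (at x)) \<and> (\<forall>b\<in>Basis. Ck k (\<lambda>x. f' x b)))"

definition smooth :: "('a::euclidean_space \<Rightarrow> real) \<Rightarrow> bool" where
  "smooth f \<longleftrightarrow> (\<forall>k. Ck k f)"

definition pderivative :: "'a::euclidean_space \<Rightarrow> ('a \<Rightarrow> real) \<Rightarrow> 'a \<Rightarrow> real" where
  "pderivative b f x = frechet_derivative f (at x) b"

text \<open>Smooth functions on the slab (periodic in \<open>x\<close>) with compact support in \<open>\<Omega>\<close>.\<close>

definition slab_test :: "real \<Rightarrow> (('n::finite) pt \<Rightarrow> real) \<Rightarrow> bool" where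
  "slab_test ell \<phi> \<longleftrightarrow> smooth \<phi> \<and> hperiodic \<phi> \<and>
    (\<exists>a c. 0 < a \<and> c < ell \<and> (\<forall>x y. y \<notin> {a..c} \<longrightarrow> \<phi> (x, y) = 0))"

definition has_weak_partial ::
    "real \<Rightarrow> ('n::finite) pt \<Rightarrow> ('n pt \<Rightarrow> real) \<Rightarrow> ('n pt \<Rightarrow> real) \<Rightarrow> bool" where
  "has_weak_partial ell b f g \<longleftrightarrow> g \<in> L2_slab ell \<and>
    (\<forall>\<phi>. slab_test ell \<phi> \<longrightarrow>
      L2_inner (slab ell) f (pderivative b \<phi>) = - L2_inner (slab ell) g \<phi>)"

definition H1 :: "real \<Rightarrow> (('n::finite) pt \<Rightarrow> real) set" where
  "H1 ell = {f \<in> L2_slab ell. \<forall>b\<in>Basis. \<exists>g. has_weak_partial ell b f g}"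

definition wpartial :: "real \<Rightarrow> ('n::finite) pt \<Rightarrow> ('n pt \<Rightarrow> real) \<Rightarrow> 'n pt \<Rightarrow> real" where
  "wpartial ell b f = (SOME g. has_weak_partial ell b f g)"

text \<open>
  The trace at height \<open>s \<in> {0, ell}\<close> is the continuous extension to \<open>H\<^sup>1\<close> of the restriction of
  smooth functions to \<open>{y = s}\<close>.
\<close>

definition has_trace ::
    "real \<Rightarrow> real \<Rightarrow> (('n::finite) pt \<Rightarrow> real) \<Rightarrow> (real ^ 'n \<Rightarrow> real) \<Rightarrow> bool" where
  "has_trace ell s f g \<longleftrightarrow> f \<in> H1 ell \<and> g \<in> L2_torus \<and>
    (\<exists>\<phi>. (\<forall>k. smooth (\<phi> k) \<and> hperiodic (\<phi> k)) \<and>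
      (\<lambda>k::nat. L2_norm (slab ell) (\<lambda>z. \<phi> k z - f z)) \<longlonglongrightarrow> 0 \<and>
      (\<forall>b\<in>Basis.
        (\<lambda>k. L2_norm (slab ell) (\<lambda>z. pderivative b (\<phi> k) z - wpartial ell b f z)) \<longlonglongrightarrow> 0) \<and>
      (\<lambda>k. L2_norm torus (\<lambda>x. \<phi> k (x, s) - g x)) \<longlonglongrightarrow> 0)"

definition trace :: "real \<Rightarrow> real \<Rightarrow> (('n::finite) pt \<Rightarrow> real) \<Rightarrow> real ^ 'n \<Rightarrow> real" where
  "trace ell s f = (SOME g. has_trace ell s f g)"

section \<open>The solenoidal space and its dual\<close>

definition divergence :: "real \<Rightarrow> ('n::finite) field \<Rightarrow> 'n pt \<Rightarrow> real" where
  "divergence ell u z = (\<Sum>b\<in>Basis. wpartial ell b (\<lambda>z. u z \<bullet> b) z)"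

definition H1sol :: "real \<Rightarrow> ('n::finite) field set" where
  "H1sol ell = {u.
    (\<forall>j\<in>Basis. (\<lambda>z. u z \<bullet> j) \<in> H1 ell \<and> has_trace ell 0 (\<lambda>z. u z \<bullet> j) (\<lambda>_. 0)) \<and>
    (AE z in slab ell. divergence ell u z = 0)}"

definition grad_inner :: "real \<Rightarrow> ('n::finite) field \<Rightarrow> 'n field \<Rightarrow> real" where
  "grad_inner ell u v = (\<Sum>i\<in>Basis. \<Sum>j\<in>Basis.
    L2_inner (slab ell) (wpartial ell i (\<lambda>z. u z \<bullet> j)) (wpartial ell i (\<lambda>z. v z \<bullet> j)))"

definition H1sol_norm :: "real \<Rightarrow> ('n::finite) field \<Rightarrow> real" where
  "H1sol_norm ell u = sqrt (grad_inner ell u u)"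

definition sym_grad :: "real \<Rightarrow> ('n::finite) field \<Rightarrow> 'n pt \<Rightarrow> 'n pt \<Rightarrow> 'n pt \<Rightarrow> real" where
  "sym_grad ell u i j z = wpartial ell i (\<lambda>z. u z \<bullet> j) z + wpartial ell j (\<lambda>z. u z \<bullet> i) z"

definition sym_grad_inner :: "real \<Rightarrow> ('n::finite) field \<Rightarrow> 'n field \<Rightarrow> real" where
  "sym_grad_inner ell u v =
    (\<Sum>i\<in>Basis. \<Sum>j\<in>Basis. L2_inner (slab ell) (sym_grad ell u i j) (sym_grad ell v i j))"

text \<open>
  Function spaces are sets \<open>V\<close> of functions with a (semi)norm \<open>p\<close>; almost everywhere equal functions
  have distance 0. Accordingly boundedness is part of being a dual element and forces it
  to respect almost everywhere equality.
\<close>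

definition dual_space :: "('x \<Rightarrow> 'b::real_vector) set \<Rightarrow> (('x \<Rightarrow> 'b) \<Rightarrow> real) \<Rightarrow> (('x \<Rightarrow> 'b) \<Rightarrow> real) set"
  where
  "dual_space V p = {F.
    (\<forall>v\<in>V. \<forall>w\<in>V. \<forall>a c. F (\<lambda>x. a *\<^sub>R v x + c *\<^sub>R w x) = a * F v + c * F w) \<and>
    (\<exists>C. \<forall>v\<in>V. \<bar>F v\<bar> \<le> C * p v)}"

definition dual_norm :: "('x \<Rightarrow> 'b::real_vector) set \<Rightarrow> (('x \<Rightarrow> 'b) \<Rightarrow> real) \<Rightarrow> (('x \<Rightarrow> 'b) \<Rightarrow> real) \<Rightarrow> real"
  where
  "dual_norm V p F = Sup {\<bar>F v\<bar> | v. v \<in> V \<and> p v \<le> 1}"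

section \<open>Bochner spaces in time\<close>

definition simple_on :: "real set \<Rightarrow> ('x \<Rightarrow> 'b) set \<Rightarrow> (real \<Rightarrow> 'x \<Rightarrow> 'b) \<Rightarrow> bool" where
  "simple_on I V s \<longleftrightarrow> finite (s ` I) \<and> s ` I \<subseteq> V \<and> (\<forall>w. {t\<in>I. s t = w} \<in> sets lebesgue)"

definition strongly_measurable_on ::
    "real set \<Rightarrow> ('x \<Rightarrow> 'b::real_vector) set \<Rightarrow> (('x \<Rightarrow> 'b) \<Rightarrow> real) \<Rightarrow> (real \<Rightarrow> 'x \<Rightarrow> 'b) \<Rightarrow> bool" where
  "strongly_measurable_on I V p f \<longleftrightarrow>
    (\<exists>s. (\<forall>k. simple_on I V (s k)) \<and>
      (AE t in lebesgue_on I. (\<lambda>k::nat. p (\<lambda>x. f t x - s k t x)) \<longlonglongrightarrow> 0))"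

definition L2_time ::
    "real set \<Rightarrow> ('x \<Rightarrow> 'b::real_vector) set \<Rightarrow> (('x \<Rightarrow> 'b) \<Rightarrow> real) \<Rightarrow> (real \<Rightarrow> 'x \<Rightarrow> 'b) \<Rightarrow> bool" where
  "L2_time I V p f \<longleftrightarrow> (AE t in lebesgue_on I. f t \<in> V) \<and>
    strongly_measurable_on I V p f \<and> integrable (lebesgue_on I) (\<lambda>t. (p (f t))\<^sup>2)"

definition L2loc_time ::
    "('x \<Rightarrow> 'b::real_vector) set \<Rightarrow> (('x \<Rightarrow> 'b) \<Rightarrow> real) \<Rightarrow> (real \<Rightarrow> 'x \<Rightarrow> 'b) \<Rightarrow> bool" where
  "L2loc_time V p f \<longleftrightarrow> (\<forall>T>0. L2_time {0..T} V p f)"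

definition time_test :: "(real \<Rightarrow> real) \<Rightarrow> bool" where
  "time_test \<phi> \<longleftrightarrow> smooth \<phi> \<and> (\<exists>a b. 0 < a \<and> (\<forall>t. t \<notin> {a..b} \<longrightarrow> \<phi> t = 0))"

text \<open>
  \<open>g = \<partial>\<^sub>t f\<close> as distributions on \<open>(0,\<infinity>)\<close>, for \<open>f\<close> and \<open>g\<close> with values in the functionals on \<open>D\<close>;
  \<open>L\<^sup>2\<close> functions are viewed as functionals through the \<open>L\<^sup>2\<close> inner product.
\<close>

definition has_time_derivative_on ::
    "'v set \<Rightarrow> (real \<Rightarrow> 'v \<Rightarrow> real) \<Rightarrow> (real \<Rightarrow> 'v \<Rightarrow> real) \<Rightarrow> bool" where
  "has_time_derivative_on D f g \<longleftrightarrow> (\<forall>v\<in>D. \<forall>\<phi>. time_test \<phi> \<longrightarrow>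
    (LINT t|lebesgue_on {0<..}. f t v * deriv \<phi> t) = - (LINT t|lebesgue_on {0<..}. g t v * \<phi> t))"

definition L2_continuous ::
    "'a measure \<Rightarrow> ('a \<Rightarrow> 'b::euclidean_space) set \<Rightarrow> (real \<Rightarrow> 'a \<Rightarrow> 'b) \<Rightarrow> bool" where
  "L2_continuous M V f \<longleftrightarrow> (\<forall>t\<ge>0. f t \<in> V \<and>
    ((\<lambda>s. L2_norm M (\<lambda>x. f s x - f t x)) \<longlongrightarrow> 0) (at t within {0..}))"

section \<open>Weak solutions and energy\<close>

text \<open>
  \<open>du\<close>, \<open>dh\<close>, \<open>m\<close> are \<open>\<partial>\<^sub>t u\<close>, \<open>\<partial>\<^sub>t h\<close>, \<open>M(h)\<close>, which are determined by \<open>u\<close> and \<open>h\<close> up to null sets.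
  The regularity of \<open>u\<close>, \<open>\<partial>\<^sub>t u\<close>, \<open>h\<close>, \<open>\<partial>\<^sub>t h\<close> implies that \<open>u\<close> and \<open>h\<close> have representatives continuous
  in time with values in \<open>L\<^sup>2\<close>. As usual \<open>u\<close> and \<open>h\<close> denote these representatives, which is
  what gives a meaning to the initial conditions and to statements for all \<open>t\<close>.
\<close>

definition weak_solution ::
    "real \<Rightarrow> (int ^ 'n \<Rightarrow> real) \<Rightarrow> (real \<Rightarrow> ('n::finite) field) \<Rightarrow> (real \<Rightarrow> real ^ 'n \<Rightarrow> real) \<Rightarrow>
      'n field \<Rightarrow> (real ^ 'n \<Rightarrow> real) \<Rightarrow> bool" where
  "weak_solution ell \<mu> u h u0 h0 \<longleftrightarrow>
    L2_continuous (slab ell) (L2_slab ell) u \<and>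
    L2_continuous torus L2_torus h \<and>
    L2loc_time (H1sol ell) (H1sol_norm ell) u \<and>
    L2loc_time L2_torus (L2_norm torus) h \<and>
    (\<exists>du dh m.
      L2loc_time (dual_space (H1sol ell) (H1sol_norm ell)) (dual_norm (H1sol ell) (H1sol_norm ell)) du \<and>
      has_time_derivative_on (H1sol ell) (\<lambda>t. L2_inner (slab ell) (u t)) du \<and>
      L2loc_time Hhalf Hhalf_norm dh \<and>
      has_time_derivative_on L2_torus (\<lambda>t. L2_inner torus (h t)) (\<lambda>t. L2_inner torus (dh t)) \<and>
      L2loc_time L2_torus (L2_norm torus) m \<and>
      (AE t in lebesgue_on {0..}. has_multiplier \<mu> (h t) (m t)) \<and>
      (\<forall>T>0. \<forall>v. L2_time {0..T} (H1sol ell) (H1sol_norm ell) v \<longrightarrow>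
        (AE t in lebesgue_on {0..T}.
          complex_of_real (du t (v t) + 1 / 2 * sym_grad_inner ell (u t) (v t)) +
          (LINT x|torus. m t x * complex_of_real (trace ell ell (\<lambda>z. snd (v t z)) x)) = 0)) \<and>
      (AE t in lebesgue_on {0..}. AE x in torus. dh t x = trace ell ell (\<lambda>z. snd (u t z)) x)) \<and>
    (AE t in lebesgue_on {0..}. AE z in slab ell. divergence ell (u t) z = 0) \<and>
    (AE z in slab ell. u 0 z = u0 z) \<and>
    (AE x in torus. h 0 x = h0 x) \<and>
    (\<forall>t\<ge>0. (LINT x|torus. h t x) = 0)"

definition energy ::
    "real \<Rightarrow> (int ^ 'n \<Rightarrow> real) \<Rightarrow> (real \<Rightarrow> ('n::finite) field) \<Rightarrow> (real \<Rightarrow> real ^ 'n \<Rightarrow> real) \<Rightarrow>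
      int ^ 'n \<Rightarrow> real \<Rightarrow> real" where
  "energy ell \<mu> u h \<xi> t =
    1 / 2 * (LBINT y:{0<..<ell}. \<Sum>b\<in>Basis. (cmod (rfourier (\<lambda>x. u t (x, y) \<bullet> b) \<xi>))\<^sup>2) +
    \<mu> \<xi> / 2 * (cmod (rfourier (h t) \<xi>))\<^sup>2"

end

(*
The frequency zero part of u is its horizontal mean. Its vertical component vanishes, since u is
divergence free with zero trace at y = 0, and its horizontal components solve the heat equation on
(0, ell) with a Dirichlet condition at 0 and a Neumann condition at ell; the surface drops out of
the energy because h has mean zero, and out of the equation because test fields depending on y only
are horizontal. Testing the weak formulation with sin ((k + 1/2) pi y / ell) e_j,
which is independent of time, shows that each sine coefficient decays exactly exponentially, and
density of the finite sine sums in L^2 yields the decay of the energy at twice the lowest eigenvalue.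
*)
theory Submission
  imports Defs "HOL-Real_Asymp.Real_Asymp"
begin

section \<open>Smooth functions\<close>

text \<open>Weak derivatives and traces enter as arbitrary choices, pinned down only up to null
  sets, and \<open>u t\<close> is known to lie in \<open>H1sol\<close> only for almost every
  \<open>t\<close>. Two facts tame the choices: weak partial derivatives are unique almost
  everywhere, and every trace of the zero function at the surface vanishes. A general velocity field
  is handled through the smooth approximations that its trace at \<open>y = 0\<close> carries by
  definition, so that integration by parts is done on smooth functions only. The frequencies are
  half-integral because the derivative of the profile then vanishes at \<open>ell\<close>, and no
  trace of the velocity at the surface is left over. Since each test field is constant in time, the
  equation becomes a scalar one, c' = - \<kappa> c in the sense of distributions, for a coefficient
  that is continuous; no chain rule for the energy in the dual space is involved. The way back from
  coefficients to norms is by duality with finite sine sums, so no infinite series is summed. The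
  resulting rate is \<delta> = 2 (pi / (2 ell))^2 = pi^2 / (2 ell^2).\<close>

lemma Ck_SucI:
  assumes "\<And>x. (f has_derivative f' x) (at x)" "\<And>b. b \<in> Basis \<Longrightarrow> Ck k (\<lambda>x. f' x b)"
  shows "Ck (Suc k) f"
  using assms by auto

lemma Ck_SucE:
  assumes "Ck (Suc k) f"
  obtains f' where "\<And>x. (f has_derivative f' x) (at x)" "\<And>b. b \<in> Basis \<Longrightarrow> Ck k (\<lambda>x. f' x b)"
  using assms unfolding Ck.simps(2)[of k] by blast

lemma Ck_real_SucI:
  assumes "\<And>x. (f has_real_derivative f' x) (at x)" "Ck k f'"
  shows "Ck (Suc k) f"
  by (rule Ck_SucI[where f' = "\<lambda>x h. f' x * h"])
    (use assms in \<open>auto simp: has_field_derivative_def\<close>)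

text \<open>\<open>Ck (Suc k)\<close> does not mention continuity of \<open>f\<close> itself, so
  monotonicity in \<open>k\<close> has to be proved: differentiability gives the base case, and the
  induction runs through the partial derivatives.\<close>

lemma Ck_Suc_imp: "Ck (Suc k) f \<Longrightarrow> Ck k f"
proof (induction k arbitrary: f)
  case 0
  then show ?case
    by (auto elim!: Ck_SucE[of 0 f] intro!: continuous_at_imp_continuous_on intro: has_derivative_continuous)
next
  case (Suc k)
  from Suc.prems obtain f' where "\<And>x. (f has_derivative f' x) (at x)"
    "\<And>b. b \<in> Basis \<Longrightarrow> Ck (Suc k) (\<lambda>x. f' x b)"
    by (rule Ck_SucE) blast
  then show ?case by (intro Ck_SucI) (auto intro: Suc.IH)
qed

lemma Ck_const: "Ck k (\<lambda>_. c)"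
proof (induction k arbitrary: c)
  case (Suc k)
  show ?case by (rule Ck_SucI[where f' = "\<lambda>_ _. 0"]) (auto intro: Suc)
qed simp

lemma Ck_inner: "Ck k (\<lambda>x. x \<bullet> c)"
proof (cases k)
  case (Suc m)
  show ?thesis unfolding Suc
    by (rule Ck_SucI[where f' = "\<lambda>_ h. h \<bullet> c"]) (auto intro!: Ck_const derivative_eq_intros)
qed (auto intro!: continuous_intros)

lemma Ck_add: "Ck k f \<Longrightarrow> Ck k g \<Longrightarrow> Ck k (\<lambda>x. f x + g x)"
proof (induction k arbitrary: f g)
  case 0
  then show ?case by (auto intro!: continuous_intros)
next
  case (Suc k)
  from Suc.prems obtain f' g' where
    "\<And>x. (f has_derivative f' x) (at x)" "\<And>b. b \<in> Basis \<Longrightarrow> Ck k (\<lambda>x. f' x b)"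
    "\<And>x. (g has_derivative g' x) (at x)" "\<And>b. b \<in> Basis \<Longrightarrow> Ck k (\<lambda>x. g' x b)"
    by (elim Ck_SucE) (rule that, auto)
  then show ?case
    by (intro Ck_SucI[where f' = "\<lambda>x h. f' x h + g' x h"])
      (auto intro!: Suc.IH has_derivative_add)
qed

lemma Ck_mult: "Ck k f \<Longrightarrow> Ck k g \<Longrightarrow> Ck k (\<lambda>x. f x * g x)"
proof (induction k arbitrary: f g)
  case 0
  then show ?case by (auto intro!: continuous_intros)
next
  case (Suc k)
  from Suc.prems obtain f' g' where
    "\<And>x. (f has_derivative f' x) (at x)" "\<And>b. b \<in> Basis \<Longrightarrow> Ck k (\<lambda>x. f' x b)"
    "\<And>x. (g has_derivative g' x) (at x)" "\<And>b. b \<in> Basis \<Longrightarrow> Ck k (\<lambda>x. g' x b)"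
    by (elim Ck_SucE) (rule that, auto)
  moreover have "Ck k f" "Ck k g" using Suc.prems by (simp_all only: Ck_Suc_imp)
  ultimately show ?case
    by (intro Ck_SucI[where f' = "\<lambda>x h. f x * g' x h + f' x h * g x"])
      (auto intro!: Suc.IH has_derivative_mult Ck_add)
qed

text \<open>A real outer function suffices because the test functions below are built from scalar
  profiles of coordinates. The chain rule then has the product form
  \<open>f' (g x) 1 * g' x h\<close>, to which the induction hypothesis and \<open>Ck_mult\<close>
  apply.\<close>

lemma Ck_compose:
  fixes f :: "real \<Rightarrow> real"
  shows "Ck k f \<Longrightarrow> Ck k g \<Longrightarrow> Ck k (\<lambda>x. f (g x))"
proof (induction k arbitrary: f g)
  case 0
  then show ?case by (auto intro: continuous_on_compose2)
next
  case (Suc k)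
  from Suc.prems obtain f' g' where
    f': "\<And>x. (f has_derivative f' x) (at x)" "Ck k (\<lambda>x. f' x 1)" and
    g': "\<And>x. (g has_derivative g' x) (at x)" "\<And>b. b \<in> Basis \<Longrightarrow> Ck k (\<lambda>x. g' x b)"
    by (elim Ck_SucE) (rule that, auto)
  have Ck_g: "Ck k g" using Suc.prems(2) by (simp only: Ck_Suc_imp)
  have lin: "f' x h = f' x 1 * h" for x h
    using linear_scale[OF has_derivative_linear[OF f'(1)], of x h 1] by simp
  have "((\<lambda>x. f (g x)) has_derivative (\<lambda>h. f' (g x) 1 * g' x h)) (at x)" for x
    using has_derivative_compose[OF g'(1) f'(1), of x] by (subst (asm) lin)
  then show ?case
    by (rule Ck_SucI) (auto intro!: Ck_mult g' Suc.IH[OF f'(2) Ck_g])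
qed

lemma smooth_const: "smooth (\<lambda>_. c)"
  by (simp add: smooth_def Ck_const)

lemma smooth_inner: "smooth (\<lambda>x. x \<bullet> c)"
  by (simp add: smooth_def Ck_inner)

lemma smooth_ident: "smooth (\<lambda>x::real. x)"
  using smooth_inner[of "1::real"] by simp

lemma smooth_snd: "smooth (snd :: 'a::euclidean_space \<times> real \<Rightarrow> real)"
  using smooth_inner[of "(0::'a, 1::real)"] by (simp add: inner_prod_def case_prod_unfold)

lemma smooth_fst_nth: "smooth (\<lambda>z::('n::finite) pt. fst z $ i)"
  using smooth_inner[of "(axis i 1::real^'n, 0::real)"]
  by (simp add: inner_prod_def inner_axis)

lemma smooth_add: "smooth f \<Longrightarrow> smooth g \<Longrightarrow> smooth (\<lambda>x. f x + g x)"
  by (simp add: smooth_def Ck_add)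

lemma smooth_mult: "smooth f \<Longrightarrow> smooth g \<Longrightarrow> smooth (\<lambda>x. f x * g x)"
  by (simp add: smooth_def Ck_mult)

lemma smooth_diff: "smooth f \<Longrightarrow> smooth g \<Longrightarrow> smooth (\<lambda>x. f x - g x)"
  using smooth_add[OF _ smooth_mult[OF smooth_const[of "- 1"]], of f g] by simp

lemma smooth_compose:
  fixes f :: "real \<Rightarrow> real"
  shows "smooth f \<Longrightarrow> smooth g \<Longrightarrow> smooth (\<lambda>x. f (g x))"
  by (simp add: smooth_def Ck_compose)

lemma smooth_prod: "(\<And>i. i \<in> A \<Longrightarrow> smooth (f i)) \<Longrightarrow> smooth (\<lambda>x. \<Prod>i\<in>A. f i x)"
  by (induction A rule: infinite_finite_induct) (auto intro: smooth_const smooth_mult)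

text \<open>Meant for \<open>smooth_step\<close>, where the antiderivative is only known to exist,
  without a formula.\<close>

lemma smooth_antiderivative:
  assumes "\<And>x. (f has_real_derivative f' x) (at x)" "smooth f'"
  shows "smooth f"
  unfolding smooth_def
proof
  fix k
  show "Ck k f"
    by (rule Ck_Suc_imp, rule Ck_real_SucI[OF assms(1)]) (use assms(2) in \<open>simp add: smooth_def\<close>)
qed

text \<open>Proved jointly, since each of the two functions is, up to sign, the derivative of the
  other.\<close>

lemma Ck_sin_cos: "Ck k (sin :: real \<Rightarrow> real) \<and> Ck k (cos :: real \<Rightarrow> real)"
proof (induction k)
  case (Suc k)
  have "Ck k (\<lambda>x::real. - 1 * sin x)" using Suc by (intro Ck_mult Ck_const) auto
  then have "Ck (Suc k) (cos :: real \<Rightarrow> real)"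
    by (intro Ck_real_SucI[where f' = "\<lambda>x. - sin x"]) (auto intro!: derivative_eq_intros)
  moreover have "Ck (Suc k) (sin :: real \<Rightarrow> real)"
    by (intro Ck_real_SucI[where f' = cos]) (use Suc in \<open>auto intro!: derivative_eq_intros\<close>)
  ultimately show ?case by blast
qed (auto intro!: continuous_intros)

lemma smooth_sin: "smooth (sin :: real \<Rightarrow> real)"
  using Ck_sin_cos by (auto simp: smooth_def)

lemma Ck_exp: "Ck k (exp :: real \<Rightarrow> real)"
proof (induction k)
  case (Suc k)
  then show ?case
    by (intro Ck_real_SucI[where f' = exp]) (auto intro!: derivative_eq_intros)
qed (auto intro!: continuous_intros)

lemma smooth_exp: "smooth (exp :: real \<Rightarrow> real)"
  by (simp add: smooth_def Ck_exp)

lemma smooth_has_derivative: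
  assumes "smooth f"
  shows "(f has_derivative frechet_derivative f (at x)) (at x)"
proof -
  have "Ck 1 f" using assms by (simp add: smooth_def)
  then show ?thesis by (auto simp: frechet_derivative_works[symmetric] differentiable_def)
qed

lemma pderivative_eq: "(f has_derivative f') (at x) \<Longrightarrow> pderivative b f x = f' b"
  unfolding pderivative_def by (metis frechet_derivative_at)

lemma smooth_continuous_on: "smooth f \<Longrightarrow> continuous_on S f"
  by (metis Ck.simps(1) smooth_def continuous_on_subset subset_UNIV)

lemma continuous_on_pderivative:
  assumes "smooth f" "b \<in> Basis"
  shows "continuous_on S (pderivative b f)"
proof -
  have "Ck (Suc 0) f" using assms(1) unfolding smooth_def by blast
  then obtain f' where f': "\<And>x. (f has_derivative f' x) (at x)"
    "continuous_on UNIV (\<lambda>x. f' x b)"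
    using assms(2) by auto
  have "pderivative b f = (\<lambda>x. f' x b)"
    using pderivative_eq[OF f'(1)] by auto
  then show ?thesis using f'(2) continuous_on_subset by auto
qed

section \<open>A flat bump\<close>

text \<open>The powers of \<open>1 / s\<close> make the span of the family closed under differentiation.\<close>

definition flat_exp :: "nat \<Rightarrow> real \<Rightarrow> real" where
  "flat_exp k s = (if s > 0 then exp (- 1 / s) / s ^ k else 0)"

text \<open>The substitution s = 1 / x turns the limit from the right into that of x^k / exp x at
  infinity; on the left the function is 0.\<close>

lemma flat_exp_tendsto_0: "(flat_exp k \<longlongrightarrow> 0) (at 0)"
proof -
  have "((\<lambda>x. x ^ k / exp x) \<longlongrightarrow> (0::real)) at_top"
    by (rule tendsto_power_div_exp_0)
  moreover have "\<forall>\<^sub>F x in at_top. x ^ k / exp x = flat_exp k (inverse x)"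
    using eventually_gt_at_top[of "0::real"]
    by eventually_elim (auto simp: flat_exp_def exp_minus field_simps)
  ultimately have "((\<lambda>x. flat_exp k (inverse x)) \<longlongrightarrow> 0) at_top"
    by (rule Lim_transform_eventually)
  then have "(flat_exp k \<longlongrightarrow> 0) (at_right 0)"
    by (simp add: filterlim_at_right_to_top)
  moreover have "(flat_exp k \<longlongrightarrow> 0) (at_left 0)"
    by (rule tendsto_eventually) (use lt_ex in \<open>auto simp: flat_exp_def eventually_at_left_field\<close>)
  ultimately show ?thesis by (simp add: filterlim_split_at)
qed

lemma flat_exp_has_derivative:
  "(flat_exp k has_real_derivative flat_exp (k + 2) s - real k * flat_exp (k + 1) s) (at s)"
proof -
  consider "s < 0" | "s = 0" | "s > 0" by linarith
  then show ?thesis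
  proof cases
    case 1
    have "((\<lambda>_. 0) has_real_derivative 0) (at s)" by simp
    then have "(flat_exp k has_real_derivative 0) (at s)"
      by (rule has_field_derivative_transform_within_open[of _ _ _ "{..<0}"])
        (use 1 in \<open>auto simp: flat_exp_def\<close>)
    then show ?thesis using 1 by (simp add: flat_exp_def)
  next
    \<comment> \<open>The difference quotient at 0 is again a member of the family, with one more
      power of \<open>1 / s\<close>, so its limit is already known.\<close>
    case 2
    have "\<forall>\<^sub>F h in at 0. flat_exp (k + 1) h = (flat_exp k (0 + h) - flat_exp k 0) / h"
      by (auto simp: flat_exp_def eventually_at_filter field_simps)
    then have "((\<lambda>h. (flat_exp k (0 + h) - flat_exp k 0) / h) \<longlongrightarrow> 0) (at 0)"
      by (rule Lim_transform_eventually[OF flat_exp_tendsto_0])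
    then show ?thesis using 2 by (simp add: DERIV_def flat_exp_def)
  next
    case 3
    have "((\<lambda>s. exp (- 1 / s) * inverse (s ^ k)) has_real_derivative
        exp (- 1 / s) / s ^ 2 * inverse (s ^ k) - exp (- 1 / s) * (real k * s ^ (k - 1) * inverse ((s ^ k) ^ 2)))
        (at s)"
      using 3 by (auto intro!: derivative_eq_intros simp: power2_eq_square field_simps)
    also have "real k * s ^ (k - 1) * inverse ((s ^ k) ^ 2) = real k / s ^ (k + 1)"
      using 3 by (cases k) (auto simp: field_simps power2_eq_square)
    finally have "((\<lambda>s. exp (- 1 / s) * inverse (s ^ k)) has_real_derivative
        flat_exp (k + 2) s - real k * flat_exp (k + 1) s) (at s)"
      using 3 by (simp add: flat_exp_def field_simps power2_eq_square)
    then show ?thesis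
      by (rule has_field_derivative_transform_within_open[of _ _ _ "{0<..}"])
        (use 3 in \<open>auto simp: flat_exp_def field_simps\<close>)
  qed
qed

lemma Ck_flat_exp: "Ck n (flat_exp k)"
proof (induction n arbitrary: k)
  case 0
  show ?case using flat_exp_has_derivative[of k]
    by (auto intro!: continuous_at_imp_continuous_on DERIV_isCont)
next
  case (Suc n)
  have "Ck n (\<lambda>s. flat_exp (k + 2) s + (- real k) * flat_exp (k + 1) s)"
    by (intro Ck_add Ck_mult Ck_const Suc)
  then show ?case by (intro Ck_real_SucI[OF flat_exp_has_derivative]) simp
qed

lemma smooth_flat_exp: "smooth (flat_exp k)"
  by (simp add: smooth_def Ck_flat_exp)

lemma flat_exp_nonneg: "0 \<le> flat_exp 0 s" and flat_exp_le_1: "flat_exp 0 s \<le> 1"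
  by (auto simp: flat_exp_def)

lemma flat_exp_pos: "0 < s \<Longrightarrow> 0 < flat_exp k s" and flat_exp_zero: "s \<le> 0 \<Longrightarrow> flat_exp k s = 0"
  by (auto simp: flat_exp_def)

text \<open>Functions of this form are smooth approximations to the indicator of positivity: the
  factor \<open>n\<close> drives a positive argument to infinity, where \<open>flat_exp 0\<close>
  tends to 1. Letting \<open>a\<close> vary with \<open>n\<close> makes room for the shrinking
  margins in \<open>box_test\<close>.\<close>

lemma flat_exp_scaled_tendsto:
  assumes "a \<longlonglongrightarrow> l" "l > 0"
  shows "(\<lambda>n. flat_exp 0 (real n * a n)) \<longlonglongrightarrow> 1"
proof -
  have "filterlim (\<lambda>n. a n * real n) at_top sequentially"
    by (rule filterlim_tendsto_pos_mult_at_top[OF assms filterlim_real_sequentially])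
  then have "filterlim (\<lambda>n. real n * a n) at_top sequentially" by (simp add: mult.commute)
  moreover have "((\<lambda>s. exp (- 1 / s)) \<longlongrightarrow> (1::real)) at_top" by real_asymp
  then have "(flat_exp 0 \<longlongrightarrow> 1) at_top"
    by (rule Lim_transform_eventually)
      (use eventually_gt_at_top[of "0::real"] in \<open>eventually_elim, auto simp: flat_exp_def\<close>)
  ultimately show ?thesis by (rule filterlim_compose[rotated])
qed

text \<open>\<open>S\<close> is an unnormalised step: \<open>\<beta>\<close> is a bump supported
  between 0 and \<open>e\<close>, and \<open>c\<close> is its total mass. The time test functions
  for the weak differential equation are built from \<open>S\<close>, and \<open>\<beta>\<close>
  then acts as a one-sided mollifier.\<close>

lemma smooth_step:
  assumes "e > 0"
  obtains S \<beta> :: "real \<Rightarrow> real" and c where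
    "smooth S" "\<And>x. (S has_real_derivative \<beta> x) (at x)" "smooth \<beta>" "\<And>x. \<beta> x \<ge> 0"
    "\<And>x. x \<notin> {0<..<e} \<Longrightarrow> \<beta> x = 0" "\<And>x. x \<le> 0 \<Longrightarrow> S x = 0" "\<And>x. x \<ge> e \<Longrightarrow> S x = c" "c > 0"
proof -
  define \<beta> where "\<beta> x = flat_exp 0 x * flat_exp 0 (e - x)" for x
  have sm: "smooth \<beta>"
    unfolding \<beta>_def
    by (intro smooth_mult smooth_flat_exp smooth_compose[of "flat_exp 0"] smooth_diff smooth_const smooth_ident)
  then have cont: "isCont \<beta> x" for x
    using smooth_continuous_on continuous_on_eq_continuous_at by blast
  obtain F where "\<forall>x. -\<infinity> < ereal x \<longrightarrow> ereal x < \<infinity> \<longrightarrow> (F has_vector_derivative \<beta> x) (at x)"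
    using einterval_antiderivative[of "-\<infinity>" "\<infinity>" \<beta>] cont by auto
  then have F: "(F has_real_derivative \<beta> x) (at x)" for x
    by (simp add: has_real_derivative_iff_has_vector_derivative)
  have nonneg: "\<beta> x \<ge> 0" for x by (simp add: \<beta>_def flat_exp_nonneg)
  have zero: "\<beta> x = 0" if "x \<notin> {0<..<e}" for x
    using that by (auto simp: \<beta>_def flat_exp_zero)
  have pos: "\<beta> x > 0" if "x \<in> {0<..<e}" for x
    using that by (auto simp: \<beta>_def flat_exp_pos)
  define S where "S x = F x - F 0" for x
  have S: "(S has_real_derivative \<beta> x) (at x)" for x
    unfolding S_def using F[of x] by (auto intro!: derivative_eq_intros)
  have const: "S x = S y" if "convex A" "\<And>x. x \<in> A \<Longrightarrow> x \<notin> {0<..<e}" "x \<in> A" "y \<in> A" for A x y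
  proof -
    have "\<exists>c. \<forall>x\<in>A. S x = c"
      using that(1,2) S zero
      by (intro has_field_derivative_zero_constant) (metis has_field_derivative_at_within)+
    then show ?thesis using that(3,4) by metis
  qed
  have left: "S x = 0" if "x \<le> 0" for x
    using const[of "{..0}" x 0] that by (auto simp: S_def)
  have right: "S x = S e" if "x \<ge> e" for x
    using const[of "{e..}" x e] that by auto
  have "S 0 < S e"
    by (rule DERIV_pos_imp_increasing_open[OF assms])
      (use S pos in \<open>auto intro!: continuous_at_imp_continuous_on intro: DERIV_isCont exI\<close>)
  then have "S e > 0" using left by simp
  show ?thesis
    by (rule that[OF smooth_antiderivative[OF S sm] S sm nonneg zero left right \<open>S e > 0\<close>])
qed

section \<open>Square integrable functions\<close>

lemma sq_integrable_diff:
  assumes "sq_integrable M f" "sq_integrable M g"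
  shows "sq_integrable M (\<lambda>x. f x - g x)"
proof -
  have [measurable]: "f \<in> borel_measurable M" "g \<in> borel_measurable M"
    using assms by (auto simp: sq_integrable_def)
  have "integrable M (\<lambda>x. (norm (f x - g x))\<^sup>2)"
  proof (rule Bochner_Integration.integrable_bound)
    show "integrable M (\<lambda>x. 2 * (norm (f x))\<^sup>2 + 2 * (norm (g x))\<^sup>2)"
      using assms by (auto simp: sq_integrable_def)
    have "(norm (f x - g x))\<^sup>2 \<le> 2 * (norm (f x))\<^sup>2 + 2 * (norm (g x))\<^sup>2" for x
    proof -
      have "(norm (f x - g x))\<^sup>2 \<le> (norm (f x) + norm (g x))\<^sup>2"
        by (intro power_mono norm_triangle_ineq4) auto
      also have "\<dots> \<le> 2 * (norm (f x))\<^sup>2 + 2 * (norm (g x))\<^sup>2"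
        using sum_squares_bound[of "norm (f x)" "norm (g x)"] by (simp add: power2_sum)
      finally show ?thesis .
    qed
    then show "AE x in M. norm ((norm (f x - g x))\<^sup>2) \<le> norm (2 * (norm (f x))\<^sup>2 + 2 * (norm (g x))\<^sup>2)"
      by (auto simp: abs_of_nonneg)
  qed simp
  then show ?thesis by (simp add: sq_integrable_def)
qed

lemma sq_integrable_inner_integrable:
  assumes "sq_integrable M f" "sq_integrable M g"
  shows "integrable M (\<lambda>x. f x \<bullet> g x)"
proof -
  have [measurable]: "f \<in> borel_measurable M" "g \<in> borel_measurable M"
    using assms by (auto simp: sq_integrable_def)
  show ?thesis
  proof (rule Bochner_Integration.integrable_bound)
    show "integrable M (\<lambda>x. (norm (f x))\<^sup>2 + (norm (g x))\<^sup>2)"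
      using assms by (auto simp: sq_integrable_def)
    have "\<bar>f x \<bullet> g x\<bar> \<le> (norm (f x))\<^sup>2 + (norm (g x))\<^sup>2" for x
    proof -
      have "\<bar>f x \<bullet> g x\<bar> \<le> norm (f x) * norm (g x)" by (rule Cauchy_Schwarz_ineq2)
      moreover have "0 \<le> norm (f x) * norm (g x)" by simp
      ultimately show ?thesis using sum_squares_bound[of "norm (f x)" "norm (g x)"] by linarith
    qed
    then show "AE x in M. norm (f x \<bullet> g x) \<le> norm ((norm (f x))\<^sup>2 + (norm (g x))\<^sup>2)"
      by (auto simp: abs_of_nonneg)
  qed simp
qed

lemma sq_integrable_integrable:
  assumes "finite_measure M" "sq_integrable M (f :: _ \<Rightarrow> real)"
  shows "integrable M f"
proof -
  have "sq_integrable M (\<lambda>_. 1 :: real)"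
    using assms(1) by (simp add: sq_integrable_def finite_measure.integrable_const)
  from sq_integrable_inner_integrable[OF assms(2) this] show ?thesis by simp
qed

lemma L2_norm_sq: "(L2_norm M f)\<^sup>2 = (LINT x|M. (norm (f x))\<^sup>2)"
  unfolding L2_norm_def by simp

lemma L2_norm_nonneg: "0 \<le> L2_norm M f"
  by (simp add: L2_norm_def)

text \<open>The quadratic t \<mapsto> ||f + t g||^2 is nonnegative, so its discriminant is not
  positive. The form is only semidefinite on bare functions, which makes \<open>c = 0\<close> a case
  of its own.\<close>

lemma L2_Cauchy_Schwarz:
  assumes f: "sq_integrable M f" and g: "sq_integrable M g"
  shows "\<bar>L2_inner M f g\<bar> \<le> L2_norm M f * L2_norm M g"
proof -
  define a b c where "a = (LINT x|M. (norm (f x))\<^sup>2)" and "b = L2_inner M f g"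
    and "c = (LINT x|M. (norm (g x))\<^sup>2)"
  have ints: "integrable M (\<lambda>x. f x \<bullet> g x)" "integrable M (\<lambda>x. (norm (f x))\<^sup>2)"
    "integrable M (\<lambda>x. (norm (g x))\<^sup>2)"
    using sq_integrable_inner_integrable[OF f g] f g by (auto simp: sq_integrable_def)
  have c0: "c \<ge> 0" "a \<ge> 0" by (auto simp: c_def a_def)
  have q: "0 \<le> a + 2 * t * b + t\<^sup>2 * c" for t
  proof -
    have "0 \<le> (LINT x|M. (norm (f x + t *\<^sub>R g x))\<^sup>2)" by simp
    also have "(\<lambda>x. (norm (f x + t *\<^sub>R g x))\<^sup>2) =
        (\<lambda>x. (norm (f x))\<^sup>2 + 2 * t * (f x \<bullet> g x) + t\<^sup>2 * (norm (g x))\<^sup>2)"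
    proof
      fix x
      show "(norm (f x + t *\<^sub>R g x))\<^sup>2 = (norm (f x))\<^sup>2 + 2 * t * (f x \<bullet> g x) + t\<^sup>2 * (norm (g x))\<^sup>2"
        unfolding power2_norm_eq_inner
        by (simp add: inner_add_left inner_add_right inner_commute[of "g x" "f x"] power2_eq_square distrib_left)
    qed
    also have "(LINT x|M. (norm (f x))\<^sup>2 + 2 * t * (f x \<bullet> g x) + t\<^sup>2 * (norm (g x))\<^sup>2) = a + 2 * t * b + t\<^sup>2 * c"
      using ints by (simp add: a_def b_def c_def L2_inner_def)
    finally show ?thesis .
  qed
  have "b\<^sup>2 \<le> a * c"
  proof (cases "c = 0")
    case True
    have "b = 0"
    proof (rule ccontr)
      assume "b \<noteq> 0"
      \<comment> \<open>With \<open>c = 0\<close> the quadratic is linear in t, and this t makes it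
        equal to -1.\<close>
      then show False using q[of "- (a + 1) / (2 * b)"] True by (simp add: field_simps)
    qed
    then show ?thesis using c0 by simp
  next
    case False
    then have "c > 0" using c0 by simp
    \<comment> \<open>The minimiser is t = - b / c; the outer factor \<open>c\<close> clears the
      denominator.\<close>
    have "0 \<le> (a + 2 * (- b / c) * b + (- b / c)\<^sup>2 * c) * c"
      using q[of "- b / c"] c0 by (intro mult_nonneg_nonneg)
    then show ?thesis using \<open>c > 0\<close> by (simp add: field_simps power2_eq_square)
  qed
  then have "sqrt (b\<^sup>2) \<le> sqrt (a * c)" by (rule real_sqrt_le_mono)
  then show ?thesis by (simp add: real_sqrt_mult a_def b_def c_def L2_norm_def)
qed

text \<open>Square integrability of \<open>f k\<close> is asked only eventually: for continuity in
  time the filter is \<open>at t within {0..}\<close>, and \<open>u s\<close> is controlled for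
  nonnegative \<open>s\<close> only.\<close>

lemma L2_inner_tendsto:
  assumes conv: "((\<lambda>k. L2_norm M (\<lambda>x. f k x - g x)) \<longlongrightarrow> 0) F"
    and f: "\<forall>\<^sub>F k in F. sq_integrable M (f k)" and g: "sq_integrable M g" and h: "sq_integrable M h"
  shows "((\<lambda>k. L2_inner M (f k) h) \<longlongrightarrow> L2_inner M g h) F"
proof -
  have le: "\<forall>\<^sub>F k in F. norm (L2_inner M (f k) h - L2_inner M g h) \<le> L2_norm M (\<lambda>x. f k x - g x) * L2_norm M h"
    using f
  proof eventually_elim
    case (elim k)
    have "L2_inner M (f k) h - L2_inner M g h = L2_inner M (\<lambda>x. f k x - g x) h"
      unfolding L2_inner_def inner_diff_left
      using sq_integrable_inner_integrable[OF elim h] sq_integrable_inner_integrable[OF g h] by simp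
    then show ?case using L2_Cauchy_Schwarz[OF sq_integrable_diff[OF elim g] h] by simp
  qed
  have "((\<lambda>k. L2_norm M (\<lambda>x. f k x - g x) * L2_norm M h) \<longlongrightarrow> 0) F"
    using tendsto_mult_left_zero[OF conv] .
  from Lim_null_comparison[OF le this] show ?thesis by (rule LIM_zero_cancel)
qed

section \<open>The slab as a product\<close>

abbreviation height_interval :: "real \<Rightarrow> real measure" where
  "height_interval ell \<equiv> restrict_space lborel {0<..<ell}"

lemma sets_restrict_space_pair:
  assumes "A \<in> sets M" "B \<in> sets N"
  shows "sets (restrict_space M A \<Otimes>\<^sub>M restrict_space N B) = sets (restrict_space (M \<Otimes>\<^sub>M N) (A \<times> B))"
    (is "sets ?P = sets ?R")
proof
  have space: "space ?P = A \<times> B"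
    using assms by (simp add: space_pair_measure)
  have id: "(\<lambda>z. z) \<in> ?P \<rightarrow>\<^sub>M M \<Otimes>\<^sub>M N"
  proof (rule measurable_pair)
    show "fst \<circ> (\<lambda>z. z) \<in> ?P \<rightarrow>\<^sub>M M" "snd \<circ> (\<lambda>z. z) \<in> ?P \<rightarrow>\<^sub>M N"
      using measurable_fst[of "restrict_space M A" "restrict_space N B"]
        measurable_snd[of "restrict_space M A" "restrict_space N B"] assms
      by (auto simp: o_def measurable_restrict_space2_iff)
  qed
  show "sets ?R \<subseteq> sets ?P"
    using measurable_sets[OF id] space by (auto simp: sets_restrict_space Int_commute)
  show "sets ?P \<subseteq> sets ?R"
  proof (rule sets_pair_in_sets)
    fix a b assume "a \<in> sets (restrict_space M A)" "b \<in> sets (restrict_space N B)"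
    then have "a \<subseteq> A" "a \<in> sets M" "b \<subseteq> B" "b \<in> sets N"
      using assms by (auto simp: sets_restrict_space_iff)
    then show "a \<times> b \<in> sets ?R"
      using assms by (subst sets_restrict_space_iff) auto
  qed
qed

lemma finite_measure_torus: "finite_measure (torus :: (real ^ 'n) measure)"
  unfolding torus_def by (rule finite_measureI) (auto simp: emeasure_restrict_space emeasure_lborel_cbox_eq)

lemma finite_measure_height_interval: "finite_measure (height_interval ell)"
  by (rule finite_measureI) (cases "0 \<le> ell", auto simp: emeasure_restrict_space)

text \<open>The two measures agree on measurable rectangles, and the factors are finite. This is
  what allows Fubini on the slab.\<close>

lemma slab_eq_pair: "slab ell = (torus :: (real ^ 'n) measure) \<Otimes>\<^sub>M height_interval ell"
proof -
  have "(torus :: (real ^ 'n) measure) \<Otimes>\<^sub>M height_interval ell = slab ell"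
  proof (rule pair_measure_eqI)
    show "sigma_finite_measure (torus :: (real ^ 'n) measure)" "sigma_finite_measure (height_interval ell)"
      using finite_measure_torus finite_measure_height_interval by (auto simp: finite_measure_def)
    show "sets ((torus :: (real ^ 'n) measure) \<Otimes>\<^sub>M height_interval ell) = sets (slab ell)"
      unfolding torus_def slab_def by (subst sets_restrict_space_pair) (auto simp: lborel_prod)
    fix a :: "(real ^ 'n) set" and b assume "a \<in> sets torus" "b \<in> sets (height_interval ell)"
    then have ab: "a \<subseteq> cbox 0 1" "a \<in> sets borel" "b \<subseteq> {0<..<ell}" "b \<in> sets borel"
      by (auto simp: torus_def sets_restrict_space_iff)
    then have "emeasure (slab ell) (a \<times> b) = emeasure (lborel \<Otimes>\<^sub>M lborel) (a \<times> b)"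
      unfolding slab_def lborel_prod
      by (intro emeasure_restrict_space) (auto simp: pred_def intro!: borel_Times)
    also have "\<dots> = emeasure lborel a * emeasure lborel b"
      using ab by (intro lborel.emeasure_pair_measure_Times) auto
    finally show "emeasure torus a * emeasure (height_interval ell) b = emeasure (slab ell) (a \<times> b)"
      using ab by (simp add: torus_def emeasure_restrict_space)
  qed
  then show ?thesis by simp
qed

interpretation torus: finite_measure "torus :: (real ^ 'n) measure"
  by (rule finite_measure_torus)

interpretation height: finite_measure "height_interval ell"
  by (rule finite_measure_height_interval)

interpretation slab: pair_sigma_finite "torus :: (real ^ 'n) measure" "height_interval ell" ..

lemma finite_measure_slab: "finite_measure (slab ell :: ('n::finite) pt measure)"
  unfolding slab_eq_pair by (rule finite_measure_pair_measure) unfold_locales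

lemma space_torus: "space (torus :: (real ^ 'n) measure) = cbox 0 1"
  by (simp add: torus_def)

lemma space_slab: "space (slab ell :: ('n::finite) pt measure) = cbox 0 1 \<times> {0<..<ell}"
  by (simp add: slab_def space_restrict_space)

lemma slab_Fubini:
  fixes f :: "('n::finite) pt \<Rightarrow> real"
  assumes "integrable (slab ell) f"
  shows "(LINT z|slab ell. f z) = (LINT y|height_interval ell. LINT x|torus. f (x, y))"
    and "(LINT z|slab ell. f z) = (LINT x|torus. LINT y|height_interval ell. f (x, y))"
  using slab.integral_snd[of ell "curry f"] slab.integral_fst[of ell "curry f"] assms
  by (simp_all add: slab_eq_pair)

lemma continuous_sq_integrable_slab:
  fixes f :: "('n::finite) pt \<Rightarrow> 'b::euclidean_space"
  assumes "continuous_on UNIV f"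
  shows "sq_integrable (slab ell) f"
proof -
  interpret finite_measure "slab ell :: 'n pt measure" by (rule finite_measure_slab)
  have "compact (f ` (cbox 0 1 \<times> {0..ell}))"
    using assms by (intro compact_continuous_image compact_Times) (auto intro: continuous_on_subset)
  then obtain C where C: "\<And>z. z \<in> cbox 0 1 \<times> {0..ell} \<Longrightarrow> norm (f z) \<le> C"
    using compact_imp_bounded bounded_iff by (metis imageI)
  have m[measurable]: "f \<in> borel_measurable (slab ell)"
    unfolding slab_def using assms
    by (intro measurable_restrict_space1) (simp add: borel_measurable_continuous_onI)
  have "(norm (f z))\<^sup>2 \<le> C\<^sup>2" if "z \<in> space (slab ell)" for z
    using that by (intro power_mono C) (auto simp: space_slab)
  then have "integrable (slab ell) (\<lambda>z. (norm (f z))\<^sup>2)"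
    by (intro integrable_const_bound[of _ "C\<^sup>2"]) (auto intro!: AE_I2)
  then show ?thesis by (simp add: sq_integrable_def)
qed

lemma continuous_sq_integrable_torus:
  fixes f :: "real ^ 'n \<Rightarrow> 'b::euclidean_space"
  assumes "continuous_on UNIV f"
  shows "sq_integrable torus f"
proof -
  have "compact (f ` cbox 0 1)"
    using assms by (intro compact_continuous_image) (auto intro: continuous_on_subset)
  then obtain C where C: "\<And>z. z \<in> cbox 0 1 \<Longrightarrow> norm (f z) \<le> C"
    using compact_imp_bounded bounded_iff by (metis imageI)
  have m[measurable]: "f \<in> borel_measurable torus"
    unfolding torus_def using assms
    by (intro measurable_restrict_space1) (simp add: borel_measurable_continuous_onI)
  have "(norm (f z))\<^sup>2 \<le> C\<^sup>2" if "z \<in> space torus" for z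
    using that by (intro power_mono C) (auto simp: space_torus)
  then have "integrable torus (\<lambda>z. (norm (f z))\<^sup>2)"
    by (intro torus.integrable_const_bound[of _ "C\<^sup>2"]) (auto intro!: AE_I2)
  then show ?thesis by (simp add: sq_integrable_def)
qed

lemma continuous_integrable_slab:
  "continuous_on UNIV f \<Longrightarrow> integrable (slab ell) (f :: ('n::finite) pt \<Rightarrow> real)"
  by (rule sq_integrable_integrable[OF finite_measure_slab continuous_sq_integrable_slab])

lemma integral_height_interval:
  fixes F :: "real \<Rightarrow> real"
  assumes "ell > 0" "\<And>y. (F has_real_derivative f y) (at y)" "continuous_on UNIV f"
  shows "(LINT y|height_interval ell. f y) = F ell - F 0"
proof -
  have "(LINT y|height_interval ell. f y) = (LBINT y:{0<..<ell}. f y)"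
    by (subst integral_restrict_space) (auto simp: set_lebesgue_integral_def)
  also have "\<dots> = (LINT y|lborel. f y * indicator {0..ell} y)"
    unfolding set_lebesgue_integral_def
  proof (rule integral_cong_AE)
    show "AE y in lborel. indicator {0<..<ell} y *\<^sub>R f y = f y * indicator {0..ell} y"
      using AE_lborel_singleton[of 0] AE_lborel_singleton[of ell]
      by eventually_elim (auto simp: indicator_def)
  next
    have [measurable]: "f \<in> borel_measurable borel"
      using assms(3) by (rule borel_measurable_continuous_onI)
    show "(\<lambda>y. indicator {0<..<ell} y *\<^sub>R f y) \<in> borel_measurable lborel"
      "(\<lambda>y. f y * indicator {0..ell} y) \<in> borel_measurable lborel" by measurable
  qed
  also have "\<dots> = F ell - F 0"
    using assms continuous_on_eq_continuous_at[of UNIV f]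
    by (intro integral_FTC_Icc_real) auto
  finally show ?thesis .
qed

lemma slab_integral_vertical_derivative:
  fixes F F' :: "('n::finite) pt \<Rightarrow> real"
  assumes "ell > 0" "continuous_on UNIV F'"
    and F: "\<And>x y. ((\<lambda>y. F (x, y)) has_real_derivative F' (x, y)) (at y)"
  shows "(LINT z|slab ell. F' z) = (LINT x|torus. F (x, ell) - F (x, 0))"
proof -
  have "(LINT y|height_interval ell. F' (x, y)) = F (x, ell) - F (x, 0)" for x
    using assms(2) by (intro integral_height_interval[OF \<open>ell > 0\<close> F])
      (auto intro!: continuous_on_compose2[OF assms(2)] continuous_intros)
  then show ?thesis
    using slab_Fubini(2)[OF continuous_integrable_slab[OF assms(2)], of ell] by simp
qed

section \<open>Periodic functions: translation and derivatives\<close>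

lemma lattice_vec_axis: "lattice_vec (axis i 1 :: int ^ 'n) = axis i 1"
  by (auto simp: lattice_vec_def vec_eq_iff axis_def)

lemma lattice_vec_0 [simp]: "lattice_vec (0 :: int ^ 'n) = 0"
  by (auto simp: lattice_vec_def vec_eq_iff)

lemma periodic_add_Basis: "periodic f \<Longrightarrow> b \<in> Basis \<Longrightarrow> f (x + b) = f x"
  by (auto simp: Basis_vec_def periodic_def) (metis lattice_vec_axis)

lemma integral_torus_eq:
  fixes f :: "real ^ 'n \<Rightarrow> real"
  assumes "continuous_on UNIV f"
  shows "(LINT x|torus. f x) = integral (cbox 0 1) f"
proof -
  have "integrable lborel (\<lambda>x. indicator (cbox 0 1) x *\<^sub>R f x)"
    by (intro borel_integrable_compact) (auto intro: continuous_on_subset[OF assms])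
  then have "set_integrable lborel (cbox 0 1) f"
    by (simp add: set_integrable_def)
  from set_borel_integral_eq_integral(2)[OF this] show ?thesis
    unfolding torus_def by (subst integral_restrict_space) (auto simp: set_lebesgue_integral_def)
qed

lemma measure_torus_space: "measure (torus :: (real ^ 'n) measure) (space torus) = 1"
proof -
  have "(\<Prod>b\<in>Basis. (1 :: real ^ 'n) \<bullet> b) = 1"
    by (rule prod.neutral) (auto simp: Basis_vec_def inner_axis)
  then have "measure lborel (cbox 0 (1 :: real ^ 'n)) = 1"
    by (subst measure_lborel_cbox_eq) (auto simp: Basis_vec_def inner_axis)
  then show ?thesis
    by (simp add: torus_def measure_restrict_space)
qed

text \<open>Isolating coordinate \<open>i\<close> reduces the cutting and shifting of cubes along
  \<open>axis i 1\<close> to inequalities for one real number.\<close>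

lemma mem_cbox_shift_axis:
  fixes x :: "real ^ 'n"
  shows "x \<in> cbox (p + s *\<^sub>R axis i 1) (q + t *\<^sub>R axis i 1) \<longleftrightarrow>
    (p $ i + s \<le> x $ i \<and> x $ i \<le> q $ i + t) \<and> (\<forall>j. j \<noteq> i \<longrightarrow> p $ j \<le> x $ j \<and> x $ j \<le> q $ j)"
proof -
  have "(\<forall>j. P j) \<longleftrightarrow> P i \<and> (\<forall>j. j \<noteq> i \<longrightarrow> P j)" for P :: "'n \<Rightarrow> bool" by metis
  from this[of "\<lambda>j. (p + s *\<^sub>R axis i 1) $ j \<le> x $ j \<and> x $ j \<le> (q + t *\<^sub>R axis i 1) $ j"] show ?thesis
    by (simp add: mem_box_cart axis_def)
qed

text \<open>The unit cube translated by \<tau> along \<open>b\<close> sticks out beyond coordinate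
  1. Cut there and move the overhang back by one period: the two pieces fill the unit cube
  again.\<close>

lemma torus_integral_translate:
  fixes g :: "real ^ 'n \<Rightarrow> real"
  assumes cont: "continuous_on UNIV g" and per: "periodic g" and b: "b \<in> Basis"
    and \<tau>: "0 \<le> \<tau>" "\<tau> \<le> 1"
  shows "(LINT x|torus. g (x + \<tau> *\<^sub>R b)) = (LINT x|torus. g x)"
proof -
  obtain i where i: "b = axis i 1" using b by (auto simp: Basis_vec_def)
  have xb: "x \<bullet> b = x $ i" for x by (simp add: i inner_axis)
  note mem = mem_cbox_shift_axis[of _ 0 _ i 1, folded i]
  have b01: "x \<in> cbox 0 1 \<longleftrightarrow> (0 \<le> x $ i \<and> x $ i \<le> 1) \<and> (\<forall>j. j \<noteq> i \<longrightarrow> 0 \<le> x $ j \<and> x $ j \<le> 1)" for x :: "real ^ 'n"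
    using mem[of x 0 0] by simp
  have b1: "x \<in> cbox (\<tau> *\<^sub>R b) (1 + \<tau> *\<^sub>R b) \<longleftrightarrow>
      (\<tau> \<le> x $ i \<and> x $ i \<le> 1 + \<tau>) \<and> (\<forall>j. j \<noteq> i \<longrightarrow> 0 \<le> x $ j \<and> x $ j \<le> 1)" for x
    using mem[of x \<tau> \<tau>] by simp
  have b2: "x \<in> cbox (0 + b) ((1 + (\<tau> - 1) *\<^sub>R b) + b) \<longleftrightarrow>
      (1 \<le> x $ i \<and> x $ i \<le> 1 + \<tau>) \<and> (\<forall>j. j \<noteq> i \<longrightarrow> 0 \<le> x $ j \<and> x $ j \<le> 1)" for x
  proof -
    have "(1 + (\<tau> - 1) *\<^sub>R b) + b = 1 + \<tau> *\<^sub>R b" by (simp add: algebra_simps)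
    then show ?thesis using mem[of x 1 \<tau>] by (simp only:) simp
  qed
  have b3: "x \<in> cbox 0 (1 + (\<tau> - 1) *\<^sub>R b) \<longleftrightarrow>
      (0 \<le> x $ i \<and> x $ i \<le> \<tau>) \<and> (\<forall>j. j \<noteq> i \<longrightarrow> 0 \<le> x $ j \<and> x $ j \<le> 1)" for x
    using mem[of x 0 "\<tau> - 1"] by simp
  have int: "g integrable_on cbox p q" for p q
    by (intro integrable_continuous continuous_on_subset[OF cont]) auto
  have "(LINT x|torus. g (x + \<tau> *\<^sub>R b)) = integral (cbox 0 1) (g \<circ> (+) (\<tau> *\<^sub>R b))"
    by (subst integral_torus_eq)
      (auto simp: o_def add.commute intro!: continuous_on_compose2[OF cont] continuous_intros)
  also have "\<dots> = integral (cbox (\<tau> *\<^sub>R b) (1 + \<tau> *\<^sub>R b)) g"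
    by (simp add: integral_shift_cbox_plus)
  also have "\<dots> = integral (cbox (\<tau> *\<^sub>R b) (1 + \<tau> *\<^sub>R b) \<inter> {x. x \<bullet> b \<le> 1}) g +
      integral (cbox (\<tau> *\<^sub>R b) (1 + \<tau> *\<^sub>R b) \<inter> {x. x \<bullet> b \<ge> 1}) g"
    by (rule integral_split[OF int b])
  also have "cbox (\<tau> *\<^sub>R b) (1 + \<tau> *\<^sub>R b) \<inter> {x. x \<bullet> b \<ge> 1} =
      cbox (0 + b) ((1 + (\<tau> - 1) *\<^sub>R b) + b)"
    unfolding set_eq_iff Int_iff b1 b2 mem_Collect_eq xb using \<tau> by auto
  \<comment> \<open>The overhang is the translate by \<open>b\<close> of that part of the unit cube
    whose coordinate along \<open>b\<close> is at most \<tau>.\<close>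
  also have "integral \<dots> g = integral (cbox 0 (1 + (\<tau> - 1) *\<^sub>R b)) (g \<circ> (+) b)"
    by (rule integral_shift_cbox_plus[symmetric])
  also have "g \<circ> (+) b = g"
    using periodic_add_Basis[OF per b] by (auto simp: o_def add.commute)
  also have "cbox 0 (1 + (\<tau> - 1) *\<^sub>R b) = cbox 0 1 \<inter> {x. x \<bullet> b \<le> \<tau>}"
    using \<tau> by (auto simp: b01 b1 b2 b3 xb)
  also have "cbox (\<tau> *\<^sub>R b) (1 + \<tau> *\<^sub>R b) \<inter> {x. x \<bullet> b \<le> 1} = cbox 0 1 \<inter> {x. x \<bullet> b \<ge> \<tau>}"
    using \<tau> by (auto simp: b01 b1 b2 b3 xb)
  also have "integral (cbox 0 1 \<inter> {x. \<tau> \<le> x \<bullet> b}) g + integral (cbox 0 1 \<inter> {x. x \<bullet> b \<le> \<tau>}) g =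
      integral (cbox 0 1) g"
    using integral_split[OF int b, of 0 1 \<tau>] by simp
  finally show ?thesis by (simp add: integral_torus_eq[OF cont])
qed

text \<open>
  The integral of \<open>\<partial>\<^sub>b f\<close> over \<open>torus \<times> (0, 1)\<close> along the shifts \<open>x + \<tau> b\<close> is computed in both orders.
\<close>

lemma torus_integral_derivative:
  fixes f :: "real ^ 'n \<Rightarrow> real"
  assumes f': "\<And>x. (f has_derivative f' x) (at x)" and cont: "continuous_on UNIV (\<lambda>x. f' x b)"
    and per: "periodic f" and b: "b \<in> Basis"
  shows "(LINT x|torus. f' x b) = 0"
proof -
  let ?F = "\<lambda>z. f (fst z + snd z *\<^sub>R b)" and ?F' = "\<lambda>z. f' (fst z + snd z *\<^sub>R b) b"
  have per': "periodic (\<lambda>x. f' x b)"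
    unfolding periodic_def
  proof (intro allI)
    fix k x
    have "((\<lambda>x. f (x + lattice_vec k)) has_derivative f' (x + lattice_vec k)) (at x)"
      by (rule has_derivative_compose[OF _ f', of _ "\<lambda>h. h", simplified])
        (auto intro!: derivative_eq_intros)
    moreover have "(\<lambda>x. f (x + lattice_vec k)) = f" using per by (auto simp: periodic_def)
    ultimately have "f' (x + lattice_vec k) = f' x"
      using f'[of x] has_derivative_unique by metis
    then show "f' (x + lattice_vec k) b = f' x b" by simp
  qed
  have c': "continuous_on UNIV ?F'"
    by (intro continuous_on_compose2[OF cont] continuous_intros) auto
  have "(LINT z|slab 1. ?F' z) = (LINT x|torus. ?F (x, 1) - ?F (x, 0))"
  proof (rule slab_integral_vertical_derivative[OF _ c'])
    fix x y
    have "((\<lambda>y. f (x + y *\<^sub>R b)) has_derivative (\<lambda>h. f' (x + y *\<^sub>R b) (h *\<^sub>R b))) (at y)"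
      by (rule has_derivative_compose[OF _ f']) (auto intro!: derivative_eq_intros)
    moreover have "(\<lambda>h. f' (x + y *\<^sub>R b) (h *\<^sub>R b)) = (\<lambda>h. f' (x + y *\<^sub>R b) b * h)"
      using linear_scale[OF has_derivative_linear[OF f']] by (auto simp: mult.commute)
    ultimately show "((\<lambda>y. ?F (x, y)) has_real_derivative ?F' (x, y)) (at y)"
      by (simp add: has_field_derivative_def)
  qed simp
  also have "\<dots> = 0" using periodic_add_Basis[OF per b] by simp
  finally have "(LINT y|height_interval 1. LINT x|torus. f' (x + y *\<^sub>R b) b) = 0"
    using slab_Fubini(1)[OF continuous_integrable_slab[OF c'], of 1] by simp
  \<comment> \<open>By translation invariance the inner integral does not depend on
    \<open>y\<close>, and the interval has length 1.\<close>
  also have "(LINT y|height_interval 1. LINT x|torus. f' (x + y *\<^sub>R b) b) =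
      (LINT y|height_interval 1. LINT x|torus. f' x b)"
    by (intro Bochner_Integration.integral_cong torus_integral_translate[OF cont per' b])
      (auto simp: space_restrict_space)
  also have "\<dots> = (LINT x|torus. f' x b)"
    by (simp add: measure_restrict_space)
  finally show ?thesis .
qed

section \<open>Integration by parts on the slab\<close>

lemma smooth_has_derivative_y:
  fixes F :: "('n::finite) pt \<Rightarrow> real"
  assumes "smooth F"
  shows "((\<lambda>y. F (x, y)) has_real_derivative pderivative (0, 1) F (x, y)) (at y)"
proof -
  let ?D = "frechet_derivative F (at (x, y))"
  have "((\<lambda>y. F (x, y)) has_derivative (\<lambda>h. ?D (0, h))) (at y)"
    by (rule has_derivative_compose[OF _ smooth_has_derivative[OF assms]])
      (auto intro!: derivative_eq_intros)
  moreover have "(\<lambda>h. ?D (0, h)) = (\<lambda>h. ?D (0, 1) * h)"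
  proof
    fix h
    have "?D (h *\<^sub>R (0, 1)) = h *\<^sub>R ?D (0, 1)"
      by (rule linear_scale[OF has_derivative_linear[OF smooth_has_derivative[OF assms]]])
    then show "?D (0, h) = ?D (0, 1) * h" by (simp add: mult.commute)
  qed
  ultimately show ?thesis by (simp add: has_field_derivative_def pderivative_def)
qed

text \<open>The weight is constant on each horizontal slice, and there the derivative of a periodic
  function has integral 0. This is why horizontal derivatives disappear from every pairing with a
  function of the height.\<close>

lemma slab_integral_horizontal_derivative:
  fixes F :: "('n::finite) pt \<Rightarrow> real"
  assumes "smooth F" "hperiodic F" "b \<in> Basis" and s: "continuous_on UNIV s"
  shows "(LINT z|slab ell. pderivative (b, 0) F z * s (snd z)) = 0"
proof -
  have b': "(b, 0) \<in> Basis" using assms(3) by (simp add: Basis_prod_def)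
  have c: "continuous_on UNIV (\<lambda>z. pderivative (b, 0) F z * s (snd z))"
    by (intro continuous_intros continuous_on_pderivative[OF assms(1) b'] continuous_on_compose2[OF s])
      auto
  have "(LINT x|torus. pderivative (b, 0) F (x, y)) = 0" for y
  proof -
    let ?f' = "\<lambda>x h. frechet_derivative F (at (x, y)) (h, 0)"
    have "((\<lambda>x. F (x, y)) has_derivative ?f' x) (at x)" for x
      by (rule has_derivative_compose[OF _ smooth_has_derivative[OF assms(1)]])
        (auto intro!: derivative_eq_intros)
    moreover have "continuous_on UNIV (\<lambda>x. ?f' x b)"
      using continuous_on_compose2[OF continuous_on_pderivative[OF assms(1) b', of UNIV],
          of UNIV "\<lambda>x. (x, y)"] continuous_on_Pair[OF continuous_on_id continuous_on_const, of UNIV y]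
      by (auto simp: pderivative_def)
    ultimately have "(LINT x|torus. ?f' x b) = 0"
      using assms by (intro torus_integral_derivative) (auto simp: hperiodic_def)
    then show ?thesis by (simp add: pderivative_def)
  qed
  then show ?thesis
    using slab_Fubini(1)[OF continuous_integrable_slab[OF c], of ell] by simp
qed

text \<open>The fundamental theorem in the vertical direction, applied to the product
  \<open>F z * s (snd z)\<close>. Both boundary terms are kept, because the uses below dispose of
  them for different reasons, and one of them wants the term at the top.\<close>

lemma slab_integration_by_parts:
  fixes F :: "('n::finite) pt \<Rightarrow> real"
  assumes "ell > 0" "smooth F" and s: "\<And>y. (s has_real_derivative s' y) (at y)" "continuous_on UNIV s'"
  shows "(LINT z|slab ell. pderivative (0, 1) F z * s (snd z)) =
    (LINT x|torus. F (x, ell) * s ell - F (x, 0) * s 0) - (LINT z|slab ell. F z * s' (snd z))"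
proof -
  have e: "(0, 1) \<in> (Basis :: 'n pt set)" by (simp add: Basis_prod_def)
  have cs: "continuous_on UNIV s"
    using s(1) by (auto intro!: continuous_at_imp_continuous_on intro: DERIV_isCont)
  have c1: "continuous_on UNIV (\<lambda>z. pderivative (0, 1) F z * s (snd z))"
    by (intro continuous_intros continuous_on_pderivative[OF assms(2) e] continuous_on_compose2[OF cs])
      auto
  have c2: "continuous_on UNIV (\<lambda>z. F z * s' (snd z))"
    by (intro continuous_intros smooth_continuous_on[OF assms(2)] continuous_on_compose2[OF s(2)]) auto
  have "(LINT z|slab ell. pderivative (0, 1) F z * s (snd z) + F z * s' (snd z)) =
      (LINT x|torus. F (x, ell) * s (snd (x, ell)) - F (x, 0) * s (snd (x, 0 :: real)))"
    by (rule slab_integral_vertical_derivative[OF assms(1) continuous_on_add[OF c1 c2]])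
      (auto intro!: derivative_eq_intros smooth_has_derivative_y[OF assms(2)] s(1))
  then show ?thesis
    using continuous_integrable_slab[OF c1] continuous_integrable_slab[OF c2] by simp
qed

section \<open>Uniqueness of weak derivatives\<close>

text \<open>
  Each factor changes sign under \<open>x \<mapsto> x + 1\<close>, so the product has period 1, which lets it localise
  in an interval of the torus.
\<close>

definition sin_bump :: "real \<Rightarrow> real \<Rightarrow> real \<Rightarrow> real" where
  "sin_bump a b x = sin (pi * (x - a)) * sin (pi * (b - x))"

text \<open>The product formula leaves \<open>x\<close> only inside a cosine of 2 pi x, which has
  period 1.\<close>

lemma sin_bump_add_int: "sin_bump a b (x + of_int k) = sin_bump a b x"
proof -
  have eq: "sin_bump a b x = (cos (2 * pi * x - pi * (a + b)) - cos (pi * (b - a))) / 2" for x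
    unfolding sin_bump_def sin_times_sin by (simp add: algebra_simps)
  have "cos (2 * pi * (x + of_int k) - pi * (a + b)) = cos (2 * pi * x - pi * (a + b) + of_int k * (2 * pi))"
    by (simp add: algebra_simps)
  also have "\<dots> = cos (2 * pi * x - pi * (a + b))"
    using cos.plus_of_int[of "2 * pi * x - pi * (a + b)" k] by simp
  finally show ?thesis by (simp add: eq)
qed

lemma sin_bump_pos: "0 \<le> a \<Longrightarrow> b \<le> 1 \<Longrightarrow> a < x \<Longrightarrow> x < b \<Longrightarrow> 0 < sin_bump a b x"
  unfolding sin_bump_def by (intro mult_pos_pos sin_gt_zero) auto

text \<open>On the unit interval all arguments stay within a half period of the sine, so on either
  side of the interval one factor is nonpositive and the other nonnegative.\<close>

lemma sin_bump_nonpos: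
  assumes "0 \<le> a" "a < b" "b \<le> 1" "0 \<le> x" "x \<le> 1" "\<not> (a < x \<and> x < b)"
  shows "sin_bump a b x \<le> 0"
proof (cases "x \<le> a")
  case True
  have "0 \<le> sin (pi * (a - x))" "0 \<le> sin (pi * (b - x))"
    using True assms by (auto intro!: sin_ge_zero)
  moreover have "sin (pi * (x - a)) = - sin (pi * (a - x))"
    by (metis minus_diff_eq mult_minus_right sin_minus)
  ultimately show ?thesis by (simp add: sin_bump_def)
next
  case False
  then have "0 \<le> sin (pi * (x - a))" "0 \<le> sin (pi * (x - b))"
    using assms by (auto intro!: sin_ge_zero)
  moreover have "sin (pi * (b - x)) = - sin (pi * (x - b))"
    by (metis minus_diff_eq mult_minus_right sin_minus)
  ultimately show ?thesis by (simp add: sin_bump_def)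
qed

lemma smooth_sin_bump: "smooth f \<Longrightarrow> smooth (\<lambda>z. sin_bump a b (f z))"
  unfolding sin_bump_def
  by (intro smooth_mult smooth_compose[OF smooth_sin] smooth_diff smooth_const)

text \<open>A smooth periodic approximation, as \<open>n\<close> grows, to the indicator of the open
  box with horizontal corners \<open>a\<close>, \<open>b\<close> and heights between
  \<open>c\<close> and \<open>d\<close>. The margins \<open>1 / Suc n\<close> keep the support away
  from \<open>c\<close> and \<open>d\<close>, hence compact in the slab even when
  \<open>c = 0\<close> or \<open>d = ell\<close>.\<close>

definition box_test :: "(real ^ 'n) \<Rightarrow> (real ^ 'n) \<Rightarrow> real \<Rightarrow> real \<Rightarrow> nat \<Rightarrow> ('n::finite) pt \<Rightarrow> real" where
  "box_test a b c d n z =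
    (\<Prod>i\<in>UNIV. flat_exp 0 (real n * sin_bump (a $ i) (b $ i) (fst z $ i))) *
    (flat_exp 0 (real n * (snd z - (c + 1 / Suc n))) * flat_exp 0 (real n * ((d - 1 / Suc n) - snd z)))"

lemma slab_test_box_test:
  assumes "0 \<le> c" "d \<le> ell"
  shows "slab_test ell (box_test a b c d n)"
  unfolding slab_test_def
proof (intro conjI exI allI impI)
  have inv: "0 < 1 / real (Suc n)" for n by simp
  show "smooth (box_test a b c d n)"
    unfolding box_test_def
    by (intro smooth_mult smooth_prod smooth_compose[OF smooth_flat_exp] smooth_sin_bump smooth_const
      smooth_fst_nth smooth_snd smooth_diff)
  show "hperiodic (box_test a b c d n)"
    unfolding hperiodic_def periodic_def box_test_def
    by (simp add: lattice_vec_def sin_bump_add_int)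
  show "0 < c + 1 / Suc n" "d - 1 / Suc n < ell"
    using assms inv[of n] by linarith+
  fix x y assume "y \<notin> {c + 1 / Suc n..d - 1 / Suc n}"
  then have "y - (c + 1 / Suc n) < 0 \<or> (d - 1 / Suc n) - y < 0" by auto
  then have "real n * (y - (c + 1 / Suc n)) \<le> 0 \<or> real n * ((d - 1 / Suc n) - y) \<le> 0"
    by (metis less_imp_le mult_nonneg_nonpos of_nat_0_le_iff)
  then show "box_test a b c d n (x, y) = 0"
    unfolding box_test_def using flat_exp_zero by fastforce
qed

lemma box_test_bound: "norm (box_test a b c d n z) \<le> 1"
proof -
  have "norm (\<Prod>i\<in>UNIV. flat_exp 0 (real n * sin_bump (a $ i) (b $ i) (fst z $ i))) \<le> 1"
    unfolding prod_norm[symmetric] by (intro prod_le_1) (simp add: flat_exp_nonneg flat_exp_le_1)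
  then show ?thesis
    unfolding box_test_def norm_mult
    by (intro mult_le_one) (auto simp: flat_exp_nonneg flat_exp_le_1)
qed

lemma flat_exp_scaled_tendsto_0:
  assumes "\<And>n. a n \<le> 0"
  shows "(\<lambda>n. flat_exp 0 (real n * a n)) \<longlonglongrightarrow> 0"
  using assms by (simp add: flat_exp_zero mult_nonneg_nonpos)

lemma flat_exp_scaled_tendsto_of_bool:
  assumes "a \<longlonglongrightarrow> l" "P \<Longrightarrow> l > 0" "\<And>n. \<not> P \<Longrightarrow> a n \<le> 0"
  shows "(\<lambda>n. flat_exp 0 (real n * a n)) \<longlonglongrightarrow> of_bool P"
  using flat_exp_scaled_tendsto[OF assms(1)] flat_exp_scaled_tendsto_0[of a] assms(2,3)
  by (cases P) auto

text \<open>The point is confined to the unit cube because elsewhere the periodic copies of the box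
  show up in the limit.\<close>

lemma box_test_tendsto:
  assumes "\<And>i. 0 \<le> a $ i \<and> a $ i < b $ i \<and> b $ i \<le> 1"
    and z: "\<And>i. 0 \<le> fst z $ i \<and> fst z $ i \<le> 1"
  shows "(\<lambda>n. box_test a b c d n z) \<longlonglongrightarrow>
    of_bool ((\<forall>i. a $ i < fst z $ i \<and> fst z $ i < b $ i) \<and> c < snd z \<and> snd z < d)"
proof -
  have 1: "(\<lambda>n. flat_exp 0 (real n * sin_bump (a $ i) (b $ i) (fst z $ i))) \<longlonglongrightarrow>
      of_bool (a $ i < fst z $ i \<and> fst z $ i < b $ i)" for i
    by (rule flat_exp_scaled_tendsto_of_bool[OF tendsto_const])
      (use assms(1)[of i] z[of i] in \<open>auto intro: sin_bump_pos sin_bump_nonpos\<close>)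
  have inv: "0 < 1 / real (Suc n)" for n by simp
  have "(\<lambda>n. snd z - (c + 1 / Suc n)) \<longlonglongrightarrow> snd z - (c + 0)"
    by (intro tendsto_intros LIMSEQ_Suc[OF lim_1_over_n])
  then have 2: "(\<lambda>n. flat_exp 0 (real n * (snd z - (c + 1 / Suc n)))) \<longlonglongrightarrow> of_bool (c < snd z)"
  proof (rule flat_exp_scaled_tendsto_of_bool)
    show "snd z - (c + 1 / real (Suc n)) \<le> 0" if "\<not> c < snd z" for n
      using inv[of n] that by linarith
  qed simp
  have "(\<lambda>n. (d - 1 / Suc n) - snd z) \<longlonglongrightarrow> (d - 0) - snd z"
    by (intro tendsto_intros LIMSEQ_Suc[OF lim_1_over_n])
  then have 3: "(\<lambda>n. flat_exp 0 (real n * ((d - 1 / Suc n) - snd z))) \<longlonglongrightarrow> of_bool (snd z < d)"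
  proof (rule flat_exp_scaled_tendsto_of_bool)
    show "(d - 1 / real (Suc n)) - snd z \<le> 0" if "\<not> snd z < d" for n
      using inv[of n] that by linarith
  qed simp
  have "(\<lambda>n. box_test a b c d n z) \<longlonglongrightarrow>
      (\<Prod>i\<in>UNIV. of_bool (a $ i < fst z $ i \<and> fst z $ i < b $ i)) * (of_bool (c < snd z) * of_bool (snd z < d))"
    unfolding box_test_def by (intro tendsto_mult tendsto_prod 1 2 3)
  also have "(\<Prod>i\<in>UNIV. of_bool (a $ i < fst z $ i \<and> fst z $ i < b $ i)) =
      (of_bool (\<forall>i. a $ i < fst z $ i \<and> fst z $ i < b $ i) :: real)"
    by (auto simp: of_bool_def prod.neutral) 
  finally show ?thesis by (simp add: of_bool_conj)
qed

section \<open>The fundamental lemma of the calculus of variations\<close>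

text \<open>Boxes are an intersection-stable generator of the Borel sets, so by a Dynkin argument
  \<open>G\<close> has integral 0 over every Borel set; the total integral serves the step for
  complements. The sets where \<open>G\<close> is positive and where it is negative then give the
  claim.\<close>

lemma integral_boxes_zero_imp_AE_zero:
  fixes G :: "'a::euclidean_space \<Rightarrow> real"
  assumes G: "integrable lborel G" and UNIV: "(LINT z|lborel. G z) = 0"
    and box: "\<And>p q. (LINT z:box p q|lborel. G z) = 0"
  shows "AE z in lborel. G z = 0"
proof -
  have [measurable]: "G \<in> borel_measurable borel" using G by auto
  have sint: "set_integrable lborel A G" if "A \<in> sets borel" for A
    using that G unfolding set_integrable_def by (intro integrable_mult_indicator) auto
  have all: "(LINT z:A|lborel. G z) = 0" if A: "A \<in> sets borel" for A
  proof -
    have "Int_stable (range (\<lambda>(a, b). box a b :: 'a set))"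
      by (auto simp: Int_stable_def box_Int_box)
    moreover have "range (\<lambda>(a, b). box a b :: 'a set) \<subseteq> Pow UNIV" by auto
    moreover have "A \<in> sigma_sets UNIV (range (\<lambda>(a, b). box a b))"
      using A unfolding borel_eq_box by simp
    ultimately show ?thesis
    proof (induction rule: sigma_sets_induct_disjoint)
      case (basic A)
      then show ?case using box by auto
    next
      case empty
      show ?case by (simp add: set_lebesgue_integral_def)
    next
      case (compl A)
      then have A: "A \<in> sets borel" by (simp add: borel_eq_box)
      have "(LINT z:UNIV - A|lborel. G z) = (LINT z|lborel. G z - indicator A z *\<^sub>R G z)"
        unfolding set_lebesgue_integral_def
        by (intro Bochner_Integration.integral_cong) (auto simp: indicator_def)
      also have "\<dots> = 0"
        using compl G UNIV sint[OF A] by (simp add: set_lebesgue_integral_def set_integrable_def)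
      finally show ?case .
    next
      case (union F)
      then have F: "\<And>i. F i \<in> sets borel" by (simp add: borel_eq_box subset_eq)
      have "(LINT z:(\<Union>i. F i)|lborel. G z) = (\<Sum>i. LINT z:F i|lborel. G z)"
        using union(1) F sint
        by (intro lebesgue_integral_countable_add) (auto simp: disjoint_family_on_def)
      then show ?case using union by simp
    qed
  qed
  have "AE z in lborel. indicator {z. G z > 0} z *\<^sub>R G z = 0"
    using all[of "{z. G z > 0}"] sint[of "{z. G z > 0}"]
    by (subst integral_nonneg_eq_0_iff_AE[symmetric])
      (auto simp: set_lebesgue_integral_def set_integrable_def indicator_def)
  moreover have "AE z in lborel. - (indicator {z. G z < 0} z *\<^sub>R G z) = 0"
    using all[of "{z. G z < 0}"] sint[of "{z. G z < 0}"]
    by (subst integral_nonneg_eq_0_iff_AE[symmetric])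
      (auto simp: set_lebesgue_integral_def set_integrable_def indicator_def)
  ultimately show ?thesis
    by eventually_elim (auto simp: indicator_def split: if_splits)
qed

lemma box_Pair: "box (a, c) (b, d) = box a b \<times> box c d"
  by (auto simp: box_def Basis_prod_def ball_Un)

lemma box_slab: "box (0 :: ('n::finite) pt) (1, ell) = box 0 1 \<times> {0<..<ell}"
  by (metis box_Pair box_real(1) zero_prod_def)

text \<open>The slab is closed in the horizontal directions while the box tests single out open
  boxes; the difference lies in the frontier of a box, which is a null set.\<close>

lemma AE_slab_box:
  "AE z in lborel. z \<in> cbox (0 :: real ^ 'n) 1 \<times> {0<..<ell} \<longleftrightarrow> z \<in> box (0 :: ('n::finite) pt) (1, ell)"
proof -
  have "negligible (cbox (0 :: 'n pt) (1, ell) - box 0 (1, ell))"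
    by (rule negligible_frontier_interval)
  then have "cbox (0 :: 'n pt) (1, ell) - box 0 (1, ell) \<in> null_sets lborel"
    unfolding negligible_iff_null_sets by (subst (asm) null_sets_completion_iff) auto
  then have "AE z in lborel. z \<notin> cbox (0 :: 'n pt) (1, ell) - box 0 (1, ell)"
    by (rule AE_not_in)
  then show ?thesis
  proof eventually_elim
    case (elim z)
    have "cbox (0 :: 'n pt) (1, ell) = cbox 0 1 \<times> {0..ell}"
      by (metis cbox_Pair_eq box_real(2) zero_prod_def)
    moreover have "box 0 1 \<subseteq> cbox 0 (1 :: real ^ 'n)" by (rule box_subset_cbox)
    ultimately show ?case using elim unfolding box_slab by force
  qed
qed

text \<open>Integrals against \<open>box_test\<close> converge to integrals over boxes, so
  \<open>g\<close>, extended by 0, integrates to 0 over every box.\<close>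

lemma slab_test_fundamental_lemma:
  fixes g :: "('n::finite) pt \<Rightarrow> real"
  assumes ell: "ell > 0" and g: "integrable (slab ell) g"
    and test: "\<And>\<phi>. slab_test ell \<phi> \<Longrightarrow> (LINT z|slab ell. g z * \<phi> z) = 0"
  shows "AE z in slab ell. g z = 0"
proof -
  let ?S = "cbox (0 :: real ^ 'n) 1 \<times> {0<..<ell}" and ?Q = "box (0 :: 'n pt) (1, ell)"
  have S: "?S \<in> sets lborel" by (simp add: borel_Times)
  have gS: "integrable lborel (\<lambda>z. indicator ?S z *\<^sub>R g z)"
    using g S unfolding slab_def by (subst (asm) integrable_restrict_space) (auto simp: set_integrable_def)
  define G where "G z = indicator ?Q z * (indicator ?S z *\<^sub>R g z)" for z
  have G: "integrable lborel G"
    unfolding G_def using integrable_mult_indicator[OF _ gS, of ?Q] by simp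
  have [measurable]: "G \<in> borel_measurable borel" using G by auto
  have test': "(LINT z|lborel. G z * \<phi> z) = 0" if "slab_test ell \<phi>" for \<phi>
  proof -
    have [measurable]: "\<phi> \<in> borel_measurable borel"
      using that by (auto simp: slab_test_def intro: borel_measurable_continuous_onI smooth_continuous_on)
    have [measurable]: "(\<lambda>z. indicator ?S z *\<^sub>R g z) \<in> borel_measurable borel" using gS by auto
    have "(LINT z|slab ell. g z * \<phi> z) = (LINT z|lborel. (indicator ?S z *\<^sub>R g z) * \<phi> z)"
      using S unfolding slab_def by (subst integral_restrict_space) (auto simp: mult.assoc)
    also have "\<dots> = (LINT z|lborel. G z * \<phi> z)"
    proof (rule integral_cong_AE)
      show "AE z in lborel. (indicator ?S z *\<^sub>R g z) * \<phi> z = G z * \<phi> z"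
        using AE_slab_box[of ell] by eventually_elim (auto simp: G_def indicator_def)
      show "(\<lambda>z. (indicator ?S z *\<^sub>R g z) * \<phi> z) \<in> borel_measurable lborel"
        "(\<lambda>z. G z * \<phi> z) \<in> borel_measurable lborel" by measurable
    qed
    finally show ?thesis using test[OF that] by simp
  qed
  have box: "(LINT z:box p q|lborel. G z) = 0" for p q
  proof (cases "?Q \<inter> box p q = {}")
    case True
    then have "(\<lambda>z. indicator (box p q) z *\<^sub>R G z) = (\<lambda>_. 0)"
      by (auto simp: G_def indicator_def fun_eq_iff)
    then show ?thesis by (simp add: set_lebesgue_integral_def)
  next
    case False
    \<comment> \<open>Clipping the box to the slab changes nothing where \<open>G\<close> lives, and
      brings the corners into the range in which the box tests are admissible.\<close>
    define a b :: "real ^ 'n" where "a = (\<chi> i. max 0 (fst p $ i))" and "b = (\<chi> i. min 1 (fst q $ i))"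
    define c d where "c = max 0 (snd p)" and "d = min ell (snd q)"
    have boxpq: "z \<in> box p q \<longleftrightarrow> (\<forall>i. fst p $ i < fst z $ i \<and> fst z $ i < fst q $ i) \<and>
        snd p < snd z \<and> snd z < snd q" for z
      using box_Pair[of "fst p" "snd p" "fst q" "snd q"]
      by (cases z) (auto simp: mem_box_cart)
    have Q: "z \<in> ?Q \<longleftrightarrow> (\<forall>i. 0 < fst z $ i \<and> fst z $ i < 1) \<and> 0 < snd z \<and> snd z < ell" for z
      unfolding box_slab by (cases z) (auto simp: mem_box_cart)
    from False obtain w where w: "w \<in> ?Q" "w \<in> box p q" by auto
    have ab: "0 \<le> a $ i \<and> a $ i < b $ i \<and> b $ i \<le> 1" for i
    proof -
      have "0 < fst w $ i" "fst w $ i < 1" "fst p $ i < fst w $ i" "fst w $ i < fst q $ i"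
        using w unfolding Q boxpq by auto
      then show ?thesis by (auto simp: a_def b_def)
    qed
    have lim: "(\<lambda>n. G z * box_test a b c d n z) \<longlonglongrightarrow> indicator (box p q) z *\<^sub>R G z" for z
    proof (cases "z \<in> ?Q")
      case True
      then have z: "0 < fst z $ i" "fst z $ i < 1" "0 < snd z" "snd z < ell" for i
        unfolding Q by auto
      have "(\<lambda>n. G z * box_test a b c d n z) \<longlonglongrightarrow>
          G z * of_bool ((\<forall>i. a $ i < fst z $ i \<and> fst z $ i < b $ i) \<and> c < snd z \<and> snd z < d)"
        by (intro tendsto_mult tendsto_const box_test_tendsto ab) (use z less_imp_le in blast)
      moreover have "((\<forall>i. a $ i < fst z $ i \<and> fst z $ i < b $ i) \<and> c < snd z \<and> snd z < d) \<longleftrightarrow>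
          z \<in> box p q"
        unfolding boxpq a_def b_def c_def d_def using z by auto
      ultimately show ?thesis by (cases "z \<in> box p q") auto
    qed (simp add: G_def)
    have "(\<lambda>n. LINT z|lborel. G z * box_test a b c d n z) \<longlonglongrightarrow> (LINT z|lborel. indicator (box p q) z *\<^sub>R G z)"
    proof (rule integral_dominated_convergence[where w = "\<lambda>z. norm (G z)"])
      fix n
      have "box_test a b c d n \<in> borel_measurable borel"
        using slab_test_box_test[of c d ell a b n]
        by (auto simp: slab_test_def c_def d_def intro: borel_measurable_continuous_onI smooth_continuous_on)
      then show "(\<lambda>z. G z * box_test a b c d n z) \<in> borel_measurable lborel" by simp
      show "AE z in lborel. norm (G z * box_test a b c d n z) \<le> norm (G z)"
        using box_test_bound[of a b c d n]
        by (auto intro!: AE_I2 mult_left_le simp: abs_mult)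
    qed (use G lim in auto)
    moreover have "(LINT z|lborel. G z * box_test a b c d n z) = 0" for n
      by (intro test' slab_test_box_test) (auto simp: c_def d_def)
    ultimately have "(\<lambda>_::nat. 0) \<longlonglongrightarrow> (LINT z|lborel. indicator (box p q) z *\<^sub>R G z)" by simp
    then show ?thesis
      by (simp add: set_lebesgue_integral_def LIMSEQ_const_iff)
  qed
  have "(LINT z|lborel. G z) = (LINT z:?Q|lborel. G z)"
    unfolding set_lebesgue_integral_def
    by (intro Bochner_Integration.integral_cong) (auto simp: G_def indicator_def)
  then have "AE z in lborel. G z = 0"
    by (intro integral_boxes_zero_imp_AE_zero[OF G]) (simp_all add: box)
  then have "AE z in lborel. z \<in> ?S \<longrightarrow> g z = 0"
    using AE_slab_box[of ell] by eventually_elim (auto simp: G_def)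
  then show ?thesis
    unfolding slab_def using S by (subst AE_restrict_space_iff) auto
qed

text \<open>The difference of two weak derivatives annihilates every test function. As
  \<open>wpartial\<close> is an arbitrary choice among them, this is what gives its values a
  meaning.\<close>

lemma has_weak_partial_unique:
  fixes f g g' :: "('n::finite) pt \<Rightarrow> real"
  assumes ell: "ell > 0" and g: "has_weak_partial ell b f g" and g': "has_weak_partial ell b f g'"
  shows "AE z in slab ell. g z = g' z"
proof -
  have sq: "sq_integrable (slab ell) g" "sq_integrable (slab ell) g'"
    using g g' by (auto simp: has_weak_partial_def L2_slab_def)
  have "AE z in slab ell. g z - g' z = 0"
  proof (rule slab_test_fundamental_lemma[OF ell])
    show "integrable (slab ell) (\<lambda>z. g z - g' z)"
      by (intro sq_integrable_integrable finite_measure_slab sq_integrable_diff sq)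
    fix \<phi> :: "'n pt \<Rightarrow> real" assume \<phi>: "slab_test ell \<phi>"
    then have "sq_integrable (slab ell) \<phi>"
      by (intro continuous_sq_integrable_slab smooth_continuous_on) (simp add: slab_test_def)
    note int = sq_integrable_inner_integrable[OF sq(1) this] sq_integrable_inner_integrable[OF sq(2) this]
    have "L2_inner (slab ell) g \<phi> = L2_inner (slab ell) g' \<phi>"
      using g g' \<phi> by (auto simp: has_weak_partial_def)
    then show "(LINT z|slab ell. (g z - g' z) * \<phi> z) = 0"
      using int by (simp add: L2_inner_def left_diff_distrib)
  qed
  then show ?thesis by simp
qed

lemma wpartial_AE_eq:
  assumes "ell > 0" "has_weak_partial ell b f g"
  shows "AE z in slab ell. wpartial ell b f z = g z"
  using assms has_weak_partial_unique someI[of "has_weak_partial ell b f", OF assms(2)]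
  unfolding wpartial_def by blast

lemma has_weak_partial_wpartial:
  assumes "f \<in> H1 ell" "b \<in> Basis"
  shows "has_weak_partial ell b f (wpartial ell b f)"
  using assms unfolding H1_def wpartial_def by (auto intro!: someI_ex[where P = "has_weak_partial ell b f"])

section \<open>Functions of the height\<close>

lemma smooth_height: "smooth s \<Longrightarrow> smooth (\<lambda>z::('n::finite) pt. s (snd z))"
  by (rule smooth_compose[OF _ smooth_snd])

lemma hperiodic_height: "hperiodic (\<lambda>z::('n::finite) pt. s (snd z))"
  by (simp add: hperiodic_def periodic_def)

lemma L2_slab_height:
  assumes "continuous_on UNIV (s :: real \<Rightarrow> real)"
  shows "(\<lambda>z::('n::finite) pt. s (snd z)) \<in> L2_slab ell"
    "sq_integrable (slab ell) (\<lambda>z::'n pt. s (snd z))"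
  using continuous_sq_integrable_slab[of "\<lambda>z::'n pt. s (snd z)" ell]
    continuous_on_compose2[OF assms continuous_on_snd[OF continuous_on_id], of UNIV]
  by (auto simp: L2_slab_def hperiodic_height)

lemma Basis_pt_cases:
  assumes "b \<in> (Basis :: ('n::finite) pt set)"
  obtains (horizontal) e where "e \<in> Basis" "b = (e, 0)" | (vertical) "b = (0, 1)"
  using assms by (auto simp: Basis_prod_def)

lemma pderivative_height:
  assumes "\<And>y. (s has_real_derivative s' y) (at y)"
  shows "pderivative b (\<lambda>z::('n::finite) pt. s (snd z)) z = s' (snd z) * snd b"
proof (rule pderivative_eq)
  show "((\<lambda>z::'n pt. s (snd z)) has_derivative (\<lambda>h. s' (snd z) * snd h)) (at z)"
    by (rule has_derivative_compose[OF has_derivative_snd[OF has_derivative_ident]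
          assms[unfolded has_field_derivative_def]])
qed

lemma pderivative_slab_test_height:
  fixes \<phi> :: "('n::finite) pt \<Rightarrow> real"
  assumes "ell > 0" "slab_test ell \<phi>" "\<And>y. (s has_real_derivative s' y) (at y)" "continuous_on UNIV s'"
    "b \<in> Basis"
  shows "(LINT z|slab ell. pderivative b \<phi> z * s (snd z)) = - (LINT z|slab ell. \<phi> z * (s' (snd z) * snd b))"
  using assms(5)
proof (cases rule: Basis_pt_cases)
  case (horizontal e)
  have "continuous_on UNIV s"
    using assms(3) by (auto intro!: continuous_at_imp_continuous_on intro: DERIV_isCont)
  then show ?thesis
    using slab_integral_horizontal_derivative[of \<phi> e s ell] assms(2) horizontal
    by (simp add: slab_test_def)
next
  case vertical
  obtain a c where "0 < a" "c < ell" "\<And>x y. y \<notin> {a..c} \<Longrightarrow> \<phi> (x, y) = 0"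
    using assms(2) by (auto simp: slab_test_def)
  then have "\<phi> (x, 0) = 0" "\<phi> (x, ell) = 0" for x by auto
  then show ?thesis
    using slab_integration_by_parts[of ell \<phi> s s'] assms vertical by (simp add: slab_test_def)
qed

text \<open>The factor \<open>snd b\<close> is 1 in the vertical direction and 0 in the horizontal
  ones, so one formula covers the whole of \<open>Basis\<close>.\<close>

lemma has_weak_partial_height:
  assumes "ell > 0" "\<And>y. (s has_real_derivative s' y) (at y)" "continuous_on UNIV s'"
    "b \<in> (Basis :: ('n::finite) pt set)"
  shows "has_weak_partial ell b (\<lambda>z. s (snd z)) (\<lambda>z. s' (snd z) * snd b)"
  unfolding has_weak_partial_def
proof (intro conjI allI impI)
  show "(\<lambda>z::'n pt. s' (snd z) * snd b) \<in> L2_slab ell"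
    by (rule L2_slab_height[of "\<lambda>y. s' y * snd b"]) (intro continuous_intros assms)
  fix \<phi> :: "'n pt \<Rightarrow> real" assume "slab_test ell \<phi>"
  from pderivative_slab_test_height[OF assms(1) this assms(2-4)]
  show "L2_inner (slab ell) (\<lambda>z. s (snd z)) (pderivative b \<phi>) =
      - L2_inner (slab ell) (\<lambda>z. s' (snd z) * snd b) \<phi>"
    by (simp add: L2_inner_def mult.commute)
qed

lemma wpartial_height_AE:
  assumes "ell > 0" "\<And>y. (s has_real_derivative s' y) (at y)" "continuous_on UNIV s'"
    "b \<in> (Basis :: ('n::finite) pt set)"
  shows "AE z in slab ell. wpartial ell b (\<lambda>z. s (snd z)) z = s' (snd z) * snd b"
  by (rule wpartial_AE_eq[OF assms(1) has_weak_partial_height[OF assms]])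

lemma H1_height:
  assumes "ell > 0" "\<And>y. (s has_real_derivative s' y) (at y)" "continuous_on UNIV s'"
  shows "(\<lambda>z::('n::finite) pt. s (snd z)) \<in> H1 ell"
proof -
  have "continuous_on UNIV s"
    using assms(2) by (auto intro!: continuous_at_imp_continuous_on intro: DERIV_isCont)
  then show ?thesis
    unfolding H1_def using L2_slab_height has_weak_partial_height[OF assms] by blast
qed

lemma L2_norm_AE_zero: "AE x in M. f x = 0 \<Longrightarrow> L2_norm M f = 0"
  unfolding L2_norm_def by (subst integral_eq_zero_AE) auto

text \<open>The function is already smooth, so a constant sequence serves as the approximation. Its
  error in the gradient is 0 because the chosen \<open>wpartial\<close> agrees almost everywhere
  with the classical derivative.\<close>

lemma has_trace_height:
  assumes "ell > 0" "smooth s" "\<And>y. (s has_real_derivative s' y) (at y)" "continuous_on UNIV s'"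
  shows "has_trace ell y0 (\<lambda>z::('n::finite) pt. s (snd z)) (\<lambda>_. s y0)"
  unfolding has_trace_def
proof (intro conjI exI[of _ "\<lambda>_ z. s (snd z)"] allI ballI)
  show "(\<lambda>z::'n pt. s (snd z)) \<in> H1 ell" by (rule H1_height[OF assms(1,3,4)])
  show "(\<lambda>_. s y0) \<in> L2_torus"
    by (auto simp: L2_torus_def periodic_def continuous_sq_integrable_torus)
  fix b :: "'n pt" assume "b \<in> Basis"
  have "AE z in slab ell. pderivative b (\<lambda>z. s (snd z)) z - wpartial ell b (\<lambda>z. s (snd z)) z = 0"
    using wpartial_height_AE[OF assms(1,3,4) \<open>b \<in> Basis\<close>]
    by eventually_elim (simp add: pderivative_height[OF assms(3)])
  then show "(\<lambda>k. L2_norm (slab ell) (\<lambda>z. pderivative b (\<lambda>z. s (snd z)) z - wpartial ell b (\<lambda>z. s (snd z)) z)) \<longlonglongrightarrow> 0"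
    by (simp add: L2_norm_AE_zero)
qed (simp_all add: smooth_height hperiodic_height assms L2_norm_def)

lemma smooth_continuous_slice:
  fixes F :: "('n::finite) pt \<Rightarrow> real"
  assumes "smooth F"
  shows "continuous_on UNIV (\<lambda>x. F (x, y))"
  using continuous_on_compose2[OF smooth_continuous_on[OF assms, of UNIV], of UNIV "\<lambda>x. (x, y)"]
    continuous_on_Pair[OF continuous_on_id continuous_on_const, of UNIV y] by auto

section \<open>Traces\<close>

text \<open>The weight \<open>snd z\<close> kills the boundary term at the bottom and equals
  \<open>ell\<close> at the top, so integrating the vertical derivative of F^2 against it isolates
  the trace; the mixed term is absorbed by 2 a b \<le> a^2 + b^2.\<close>

lemma trace_inequality:
  fixes F :: "('n::finite) pt \<Rightarrow> real"
  assumes "ell > 0" "smooth F"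
  shows "ell * (L2_norm torus (\<lambda>x. F (x, ell)))\<^sup>2 \<le>
    (1 + ell) * (L2_norm (slab ell) F)\<^sup>2 + ell * (L2_norm (slab ell) (pderivative (0, 1) F))\<^sup>2"
proof -
  let ?D = "pderivative (0, 1) F"
  have b: "(0, 1) \<in> (Basis :: 'n pt set)" by (simp add: Basis_prod_def)
  have cont: "continuous_on UNIV F" "continuous_on UNIV ?D"
    using assms b by (auto intro: smooth_continuous_on continuous_on_pderivative)
  have int: "integrable (slab ell) (\<lambda>z. (F z)\<^sup>2)" "integrable (slab ell) (\<lambda>z. (?D z)\<^sup>2)"
    "integrable (slab ell) (\<lambda>z. 2 * F z * ?D z * snd z)"
    by (intro continuous_integrable_slab continuous_intros cont)+
  have pd: "pderivative (0, 1) (\<lambda>z. F z * F z) z = 2 * F z * ?D z" for z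
    using pderivative_eq[OF has_derivative_mult[OF smooth_has_derivative[OF assms(2)]
          smooth_has_derivative[OF assms(2)]], of "(0, 1)" z]
    by (simp add: pderivative_def)
  have "(LINT z|slab ell. 2 * F z * ?D z * snd z) =
      (LINT x|torus. F (x, ell) * F (x, ell) * ell) - (LINT z|slab ell. (F z)\<^sup>2)"
    using slab_integration_by_parts[OF assms(1) smooth_mult[OF assms(2) assms(2)], of "\<lambda>y. y" "\<lambda>_. 1"]
    by (simp add: pd power2_eq_square)
  then have "ell * (L2_norm torus (\<lambda>x. F (x, ell)))\<^sup>2 =
      (LINT z|slab ell. (F z)\<^sup>2 + 2 * F z * ?D z * snd z)"
    unfolding L2_norm_sq using int by (simp add: power2_eq_square mult.commute)
  also have "\<dots> \<le> (LINT z|slab ell. (1 + ell) * (F z)\<^sup>2 + ell * (?D z)\<^sup>2)"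
  proof (rule integral_mono)
    fix z :: "'n pt" assume "z \<in> space (slab ell)"
    then have z: "0 < snd z" "snd z < ell" by (auto simp: space_slab)
    have "2 * F z * ?D z * snd z \<le> ((F z)\<^sup>2 + (?D z)\<^sup>2) * snd z"
      using z sum_squares_bound[of "F z" "?D z"] by (intro mult_right_mono) auto
    also have "\<dots> \<le> ((F z)\<^sup>2 + (?D z)\<^sup>2) * ell"
      using z by (intro mult_left_mono) auto
    finally show "(F z)\<^sup>2 + 2 * F z * ?D z * snd z \<le> (1 + ell) * (F z)\<^sup>2 + ell * (?D z)\<^sup>2"
      by (simp add: algebra_simps)
  qed (use int in auto)
  also have "\<dots> = (1 + ell) * (L2_norm (slab ell) F)\<^sup>2 + ell * (L2_norm (slab ell) ?D)\<^sup>2"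
    using int by (simp add: L2_norm_sq)
  finally show ?thesis .
qed

lemma L2_norm_cong_AE:
  assumes "f \<in> borel_measurable M" "g \<in> borel_measurable M" "AE x in M. f x = g x"
  shows "L2_norm M f = L2_norm M g"
proof -
  have "(LINT x|M. (norm (f x))\<^sup>2) = (LINT x|M. (norm (g x))\<^sup>2)"
    using assms by (intro integral_cong_AE) auto
  then show ?thesis by (simp add: L2_norm_def)
qed

lemma wpartial_L2_slab: "f \<in> H1 ell \<Longrightarrow> b \<in> Basis \<Longrightarrow> sq_integrable (slab ell) (wpartial ell b f)"
  using has_weak_partial_wpartial[of f ell b] by (simp add: has_weak_partial_def L2_slab_def)

text \<open>A priori a trace may arise as a limit along any admissible approximating sequence; the
  trace inequality forces each such limit to vanish. The zero function is the case of interest,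
  being the vertical component of every horizontal test field.\<close>

lemma has_trace_zero_unique:
  assumes ell: "ell > 0" and tr: "has_trace ell ell (\<lambda>_::('n::finite) pt. 0) g"
  shows "AE x in torus. g x = 0"
proof -
  let ?b = "(0, 1) :: 'n pt"
  have b: "?b \<in> Basis" by (simp add: Basis_prod_def)
  have g: "sq_integrable torus g" and H1: "(\<lambda>_::'n pt. 0) \<in> H1 ell"
    using tr by (auto simp: has_trace_def L2_torus_def)
  obtain \<phi> where sm: "\<And>k. smooth (\<phi> k)" and
    lim: "(\<lambda>k::nat. L2_norm (slab ell) (\<lambda>z. \<phi> k z - 0)) \<longlonglongrightarrow> 0"
      "(\<lambda>k. L2_norm (slab ell) (\<lambda>z. pderivative ?b (\<phi> k) z - wpartial ell ?b (\<lambda>_. 0) z)) \<longlonglongrightarrow> 0"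
      "(\<lambda>k. L2_norm torus (\<lambda>x. \<phi> k (x, ell) - g x)) \<longlonglongrightarrow> 0"
    using tr b unfolding has_trace_def by blast
  have wp: "AE z in slab ell. wpartial ell ?b (\<lambda>_::'n pt. 0) z = 0"
    using wpartial_height_AE[of ell "\<lambda>_. 0" "\<lambda>_. 0" ?b] ell b by simp
  have lim2: "(\<lambda>k. L2_norm (slab ell) (pderivative ?b (\<phi> k))) \<longlonglongrightarrow> 0"
  proof -
    have "L2_norm (slab ell) (\<lambda>z. pderivative ?b (\<phi> k) z - wpartial ell ?b (\<lambda>_. 0) z) =
        L2_norm (slab ell) (pderivative ?b (\<phi> k))" for k
    proof (rule L2_norm_cong_AE)
      show "pderivative ?b (\<phi> k) \<in> borel_measurable (slab ell)"
        using continuous_sq_integrable_slab[OF continuous_on_pderivative[OF sm b]]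
        by (simp add: sq_integrable_def)
      moreover have "wpartial ell ?b (\<lambda>_. 0) \<in> borel_measurable (slab ell)"
        using wpartial_L2_slab[OF H1 b] by (simp add: sq_integrable_def)
      ultimately show "(\<lambda>z. pderivative ?b (\<phi> k) z - wpartial ell ?b (\<lambda>_. 0) z) \<in> borel_measurable (slab ell)"
        by simp
      show "AE z in slab ell. pderivative ?b (\<phi> k) z - wpartial ell ?b (\<lambda>_. 0) z = pderivative ?b (\<phi> k) z"
        using wp by eventually_elim simp
    qed
    then show ?thesis using lim(2) by simp
  qed
  \<comment> \<open>The bound on the squared surface norm of \<open>\<phi> k\<close> that the trace
    inequality gives after division by \<open>ell\<close>.\<close>
  define A where "A k = ((1 + ell) * (L2_norm (slab ell) (\<phi> k))\<^sup>2 +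
    ell * (L2_norm (slab ell) (pderivative ?b (\<phi> k)))\<^sup>2) / ell" for k
  have "A \<longlonglongrightarrow> ((1 + ell) * 0\<^sup>2 + ell * 0\<^sup>2) / ell"
    unfolding A_def using lim(1) ell by (intro tendsto_intros lim2) auto
  then have "(\<lambda>k. 2 * A k + 2 * (L2_norm torus (\<lambda>x. \<phi> k (x, ell) - g x))\<^sup>2) \<longlonglongrightarrow> 2 * 0 + 2 * 0\<^sup>2"
    by (intro tendsto_intros lim(3)) simp
  moreover have "(L2_norm torus g)\<^sup>2 \<le> 2 * A k + 2 * (L2_norm torus (\<lambda>x. \<phi> k (x, ell) - g x))\<^sup>2" for k
  proof -
    have c: "continuous_on UNIV (\<lambda>x. \<phi> k (x, ell))"
      by (rule smooth_continuous_slice[OF sm])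
    have i1: "integrable torus (\<lambda>x. (\<phi> k (x, ell))\<^sup>2)" and
      i2: "integrable torus (\<lambda>x. (\<phi> k (x, ell) - g x)\<^sup>2)" and i3: "integrable torus (\<lambda>x. (g x)\<^sup>2)"
      using continuous_sq_integrable_torus[OF c] sq_integrable_diff[OF continuous_sq_integrable_torus[OF c] g] g
      by (auto simp: sq_integrable_def)
    have "(L2_norm torus g)\<^sup>2 \<le> (LINT x|torus. 2 * (\<phi> k (x, ell))\<^sup>2 + 2 * (\<phi> k (x, ell) - g x)\<^sup>2)"
      unfolding L2_norm_sq
    proof (rule integral_mono)
      fix x
      \<comment> \<open>This square is exactly the difference of the two sides below.\<close>
      have "0 \<le> (2 * \<phi> k (x, ell) - g x)\<^sup>2" by simp
      then show "(norm (g x))\<^sup>2 \<le> 2 * (\<phi> k (x, ell))\<^sup>2 + 2 * (\<phi> k (x, ell) - g x)\<^sup>2"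
        by (simp add: power2_eq_square algebra_simps)
    qed (use i1 i2 i3 in auto)
    also have "\<dots> = 2 * (L2_norm torus (\<lambda>x. \<phi> k (x, ell)))\<^sup>2 + 2 * (L2_norm torus (\<lambda>x. \<phi> k (x, ell) - g x))\<^sup>2"
      using i1 i2 by (simp add: L2_norm_sq)
    also have "(L2_norm torus (\<lambda>x. \<phi> k (x, ell)))\<^sup>2 \<le> A k"
      using trace_inequality[OF ell sm[of k]] ell unfolding A_def
      by (simp add: pos_le_divide_eq mult.commute)
    finally show ?thesis by simp
  qed
  ultimately have "(L2_norm torus g)\<^sup>2 \<le> 2 * 0 + 2 * 0\<^sup>2"
    by (intro LIMSEQ_le_const) auto
  then have "(LINT x|torus. (g x)\<^sup>2) \<le> 0" by (simp add: L2_norm_sq)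
  moreover have "0 \<le> (LINT x|torus. (g x)\<^sup>2)" by simp
  ultimately have "(LINT x|torus. (g x)\<^sup>2) = 0" by linarith
  then show ?thesis
    using g by (subst (asm) integral_nonneg_eq_0_iff_AE) (auto simp: sq_integrable_def)
qed

lemma trace_zero_AE:
  assumes "ell > 0"
  shows "AE x in torus. trace ell ell (\<lambda>_::('n::finite) pt. 0) x = 0"
proof -
  have "has_trace ell ell (\<lambda>_::'n pt. 0) (\<lambda>_. 0)"
    using has_trace_height[OF assms smooth_const[of 0], of "\<lambda>_. 0" ell, where 'n = 'n] by simp
  then have "has_trace ell ell (\<lambda>_::'n pt. 0) (trace ell ell (\<lambda>_. 0))"
    unfolding trace_def by (rule someI[of "has_trace ell ell (\<lambda>_::'n pt. 0)"])
  then show ?thesis by (rule has_trace_zero_unique[OF assms])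
qed

text \<open>\<open>has_trace\<close> supplies smooth periodic functions whose gradients converge to
  that of \<open>f\<close>; for each of them the pairing is 0, and the limit inherits this.\<close>

lemma wpartial_horizontal_height:
  fixes f :: "('n::finite) pt \<Rightarrow> real"
  assumes tr: "has_trace ell y0 f g" and e: "e \<in> Basis" and s: "continuous_on UNIV s"
  shows "L2_inner (slab ell) (wpartial ell (e, 0) f) (\<lambda>z. s (snd z)) = 0"
proof -
  have b: "(e, 0) \<in> (Basis :: 'n pt set)" using e by (simp add: Basis_prod_def)
  obtain \<phi> where sm: "\<And>k. smooth (\<phi> k)" "\<And>k. hperiodic (\<phi> k)" and
    lim: "(\<lambda>k::nat. L2_norm (slab ell) (\<lambda>z. pderivative (e, 0) (\<phi> k) z - wpartial ell (e, 0) f z)) \<longlonglongrightarrow> 0"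
    using tr b unfolding has_trace_def by blast
  have "(\<lambda>k. L2_inner (slab ell) (pderivative (e, 0) (\<phi> k)) (\<lambda>z. s (snd z))) \<longlonglongrightarrow>
      L2_inner (slab ell) (wpartial ell (e, 0) f) (\<lambda>z. s (snd z))"
    using tr by (intro L2_inner_tendsto[OF lim] always_eventually allI L2_slab_height[OF s] wpartial_L2_slab b
        continuous_sq_integrable_slab continuous_on_pderivative sm) (simp add: has_trace_def)
  moreover have "L2_inner (slab ell) (pderivative (e, 0) (\<phi> k)) (\<lambda>z. s (snd z)) = 0" for k
    using slab_integral_horizontal_derivative[OF sm e s] by (simp add: L2_inner_def)
  ultimately show ?thesis by (simp add: LIMSEQ_const_iff)
qed

text \<open>The boundary terms vanish for different reasons: at the top because
  \<open>s ell = 0\<close>, at the bottom only in the limit, where the approximations tend to the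
  zero trace.\<close>

lemma wpartial_vertical_height:
  fixes f :: "('n::finite) pt \<Rightarrow> real"
  assumes ell: "ell > 0" and tr: "has_trace ell 0 f (\<lambda>_. 0)"
    and s: "\<And>y. (s has_real_derivative s' y) (at y)" "continuous_on UNIV s'" "s ell = 0"
  shows "L2_inner (slab ell) (wpartial ell (0, 1) f) (\<lambda>z. s (snd z)) =
    - L2_inner (slab ell) f (\<lambda>z. s' (snd z))"
proof -
  let ?b = "(0, 1) :: 'n pt"
  have b: "?b \<in> Basis" by (simp add: Basis_prod_def)
  have cs: "continuous_on UNIV s"
    using s(1) by (auto intro!: continuous_at_imp_continuous_on intro: DERIV_isCont)
  have f: "f \<in> H1 ell" "sq_integrable (slab ell) f"
    using tr by (auto simp: has_trace_def H1_def L2_slab_def)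
  obtain \<phi> where sm: "\<And>k. smooth (\<phi> k)" and
    lim: "(\<lambda>k::nat. L2_norm (slab ell) (\<lambda>z. \<phi> k z - f z)) \<longlonglongrightarrow> 0"
      "(\<lambda>k. L2_norm (slab ell) (\<lambda>z. pderivative ?b (\<phi> k) z - wpartial ell ?b f z)) \<longlonglongrightarrow> 0"
      "(\<lambda>k. L2_norm torus (\<lambda>x. \<phi> k (x, 0) - 0)) \<longlonglongrightarrow> 0"
    using tr b unfolding has_trace_def by blast
  have c: "continuous_on UNIV (\<lambda>x. \<phi> k (x, 0))" for k
    by (rule smooth_continuous_slice[OF sm])
  have 1: "(\<lambda>k. L2_inner (slab ell) (pderivative ?b (\<phi> k)) (\<lambda>z. s (snd z))) \<longlonglongrightarrow>
      L2_inner (slab ell) (wpartial ell ?b f) (\<lambda>z. s (snd z))"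
    by (intro L2_inner_tendsto[OF lim(2)] always_eventually allI L2_slab_height[OF cs] wpartial_L2_slab b f
        continuous_sq_integrable_slab continuous_on_pderivative sm)
  have 2: "(\<lambda>k. L2_inner (slab ell) (\<phi> k) (\<lambda>z. s' (snd z))) \<longlonglongrightarrow> L2_inner (slab ell) f (\<lambda>z. s' (snd z))"
    by (intro L2_inner_tendsto[OF lim(1)] always_eventually allI L2_slab_height[OF s(2)] f
        continuous_sq_integrable_slab smooth_continuous_on sm)
  have 3: "(\<lambda>k. L2_inner torus (\<lambda>x. \<phi> k (x, 0)) (\<lambda>_. s 0)) \<longlonglongrightarrow> L2_inner torus (\<lambda>_::real^'n. 0) (\<lambda>_. s 0)"
    by (intro L2_inner_tendsto[OF lim(3)] always_eventually allI continuous_sq_integrable_torus c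
        continuous_on_const)
  have "L2_inner (slab ell) (pderivative ?b (\<phi> k)) (\<lambda>z. s (snd z)) =
      - L2_inner torus (\<lambda>x. \<phi> k (x, 0)) (\<lambda>_. s 0) - L2_inner (slab ell) (\<phi> k) (\<lambda>z. s' (snd z))" for k
    using slab_integration_by_parts[OF ell sm s(1,2), of k] s(3) by (simp add: L2_inner_def)
  then have "(\<lambda>k. L2_inner (slab ell) (pderivative ?b (\<phi> k)) (\<lambda>z. s (snd z))) \<longlonglongrightarrow>
      - L2_inner torus (\<lambda>_::real^'n. 0::real) (\<lambda>_. s 0) - L2_inner (slab ell) f (\<lambda>z. s' (snd z))"
    using tendsto_diff[OF tendsto_minus[OF 3] 2] by simp
  from LIMSEQ_unique[OF 1 this] show ?thesis by (simp add: L2_inner_def)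
qed

section \<open>Horizontal test fields\<close>

lemma inner_height_field: "(\<lambda>z. (s (snd z) *\<^sub>R d) \<bullet> j) = (\<lambda>z. s (snd z) * (d \<bullet> j))"
  by simp

lemma inner_H1_height:
  assumes "ell > 0" "\<And>y. (s has_real_derivative s' y) (at y)" "continuous_on UNIV s'"
    "b \<in> (Basis :: ('n::finite) pt set)"
  shows "AE z in slab ell. wpartial ell b (\<lambda>z. (s (snd z) *\<^sub>R d) \<bullet> j) z = s' (snd z) * (d \<bullet> j) * snd b"
  unfolding inner_height_field
  by (rule wpartial_height_AE[OF assms(1) _ _ assms(4)])
    (auto intro!: derivative_eq_intros continuous_intros assms)

lemma horizontal_field_H1sol:
  fixes e :: "real ^ ('n::finite)"
  assumes "ell > 0" "smooth s" "\<And>y. (s has_real_derivative s' y) (at y)" "continuous_on UNIV s'" "s 0 = 0"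
  shows "(\<lambda>z. s (snd z) *\<^sub>R (e, 0)) \<in> H1sol ell"
proof -
  let ?d = "(e, 0) :: 'n pt"
  have "has_trace ell 0 (\<lambda>z. (s (snd z) *\<^sub>R ?d) \<bullet> j) (\<lambda>_. s 0 * (?d \<bullet> j))" for j
    unfolding inner_height_field
    by (rule has_trace_height[OF assms(1), where s' = "\<lambda>y. s' y * (?d \<bullet> j)"])
      (auto intro!: derivative_eq_intros continuous_intros assms smooth_mult smooth_const)
  then have "has_trace ell 0 (\<lambda>z. (s (snd z) *\<^sub>R ?d) \<bullet> j) (\<lambda>_. 0)" for j
    using assms(5) by (simp only: mult_zero_left)
  moreover from this have "(\<lambda>z. (s (snd z) *\<^sub>R ?d) \<bullet> j) \<in> H1 ell" for j
    unfolding has_trace_def by blast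
  moreover have "AE z in slab ell. divergence ell (\<lambda>z. s (snd z) *\<^sub>R ?d) z = 0"
  proof -
    have "AE z in slab ell. \<forall>b\<in>Basis. wpartial ell b (\<lambda>z. (s (snd z) *\<^sub>R ?d) \<bullet> b) z = s' (snd z) * (?d \<bullet> b) * snd b"
      by (intro AE_finite_allI finite_Basis inner_H1_height assms)
    then show ?thesis
    proof eventually_elim
      case (elim z)
      \<comment> \<open>The divergence differentiates component \<open>b\<close> in direction
        \<open>b\<close>, but this field has only horizontal components and varies only
        vertically.\<close>
      have "(?d \<bullet> b) * snd b = 0" if "b \<in> Basis" for b :: "'n pt"
        using that by (cases rule: Basis_pt_cases) (auto simp: inner_prod_def)
      then show ?case
        unfolding divergence_def using elim by (intro sum.neutral) (simp add: mult.assoc)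
    qed
  qed
  ultimately show ?thesis unfolding H1sol_def by blast
qed

text \<open>Not immediate: \<open>wpartial\<close> of the zero function is a choice, equal to 0 only
  almost everywhere.\<close>

lemma H1sol_norm_zero:
  assumes "ell > 0"
  shows "H1sol_norm ell (\<lambda>_::('n::finite) pt. 0) = 0"
proof -
  have "L2_inner (slab ell) (wpartial ell i (\<lambda>_::'n pt. 0)) (wpartial ell i (\<lambda>_. 0)) = 0" if "i \<in> Basis" for i
    unfolding L2_inner_def
    using wpartial_height_AE[of ell "\<lambda>_. 0" "\<lambda>_. 0" i] that assms
    by (intro integral_eq_zero_AE) auto
  then show ?thesis by (simp add: H1sol_norm_def grad_inner_def)
qed

text \<open>A constant is its own simple approximation. This makes fixed profiles admissible in the
  weak formulation, which quantifies over time-dependent \<open>v\<close>.\<close>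

lemma L2_time_const:
  fixes w :: "('n::finite) field"
  assumes "ell > 0" "w \<in> H1sol ell"
  shows "L2_time {0..T} (H1sol ell) (H1sol_norm ell) (\<lambda>_. w)"
proof -
  have "strongly_measurable_on {0..T} (H1sol ell) (H1sol_norm ell) (\<lambda>_. w)"
    unfolding strongly_measurable_on_def simple_on_def
    by (intro exI[of _ "\<lambda>_ _. w"])
      (use assms H1sol_norm_zero[OF assms(1), where 'n = 'n] in \<open>auto intro: finite_subset[of _ "{w}"]\<close>)
  then show ?thesis using assms by (auto simp: L2_time_def)
qed

text \<open>The only nonzero entry of the gradient of the test field is \<open>s'\<close>, the
  vertical derivative of the component along \<open>e\<close>. Its symmetrisation has two entries,
  and the factor 1/2 undoes the doubling. Of the derivatives of \<open>u\<close> that they meet, the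
  horizontal one of the vertical component pairs to 0, and the vertical one of the component along
  \<open>e\<close> is integrated by parts; \<open>s' ell = 0\<close> removes the term at the
  surface.\<close>

lemma sym_grad_inner_horizontal_field:
  fixes u :: "('n::finite) field"
  assumes ell: "ell > 0" and u: "u \<in> H1sol ell" and e: "e \<in> Basis"
    and s: "\<And>y. (s has_real_derivative s' y) (at y)" "\<And>y. (s' has_real_derivative s'' y) (at y)"
      "continuous_on UNIV s''" "s' ell = 0"
  shows "1 / 2 * sym_grad_inner ell u (\<lambda>z. s (snd z) *\<^sub>R (e, 0)) =
    - L2_inner (slab ell) (\<lambda>z. u z \<bullet> (e, 0)) (\<lambda>z. s'' (snd z))"
proof -
  let ?d = "(e, 0) :: 'n pt" and ?N = "(0, 1) :: 'n pt"
  let ?w = "\<lambda>z::'n pt. s (snd z) *\<^sub>R ?d"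
  have B: "?d \<in> Basis" "?N \<in> Basis" "?d \<noteq> ?N" using e by (auto simp: Basis_prod_def)
  have cs': "continuous_on UNIV s'"
    using s(2) by (auto intro!: continuous_at_imp_continuous_on intro: DERIV_isCont)
  have uj: "(\<lambda>z. u z \<bullet> j) \<in> H1 ell" "has_trace ell 0 (\<lambda>z. u z \<bullet> j) (\<lambda>_. 0)" if "j \<in> Basis" for j
    using u that by (auto simp: H1sol_def)
  have d: "?d \<bullet> j = of_bool (j = ?d)" "snd j = of_bool (j = ?N)" if "j \<in> Basis" for j
  proof -
    show "?d \<bullet> j = of_bool (j = ?d)" using inner_Basis[OF B(1) that] by auto
    show "snd j = of_bool (j = ?N)" using inner_Basis[OF B(2) that] by (auto simp: inner_prod_def)
  qed
  have wp_sq: "sq_integrable (slab ell) (wpartial ell i (\<lambda>z. u z \<bullet> j))" if "i \<in> Basis" "j \<in> Basis" for i j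
    by (intro wpartial_L2_slab uj that)
  have s'_sq: "sq_integrable (slab ell) (\<lambda>z::'n pt. s' (snd z))"
    by (rule L2_slab_height[OF cs'])
  define A where "A i j = L2_inner (slab ell) (sym_grad ell u i j) (\<lambda>z. s' (snd z))" for i j
  have A: "A i j = L2_inner (slab ell) (wpartial ell i (\<lambda>z. u z \<bullet> j)) (\<lambda>z. s' (snd z)) +
      L2_inner (slab ell) (wpartial ell j (\<lambda>z. u z \<bullet> i)) (\<lambda>z. s' (snd z))"
    if "i \<in> Basis" "j \<in> Basis" for i j
    using sq_integrable_inner_integrable[OF wp_sq[OF that] s'_sq]
      sq_integrable_inner_integrable[OF wp_sq[OF that(2,1)] s'_sq]
    by (simp add: A_def L2_inner_def sym_grad_def distrib_right)
  have "L2_inner (slab ell) (sym_grad ell u i j) (sym_grad ell ?w i j) =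
      (of_bool (i = ?N \<and> j = ?d) + of_bool (i = ?d \<and> j = ?N)) * A i j"
    if ij: "i \<in> Basis" "j \<in> Basis" for i j
  proof -
    let ?c = "(of_bool (i = ?N \<and> j = ?d) + of_bool (i = ?d \<and> j = ?N)) :: real"
    have ae: "AE z in slab ell. sym_grad ell ?w i j z = ?c * s' (snd z)"
      using inner_H1_height[OF ell s(1) cs' ij(1), of ?d j] inner_H1_height[OF ell s(1) cs' ij(2), of ?d i]
      by eventually_elim (auto simp: sym_grad_def d ij)
    have wH1: "(\<lambda>z. ?w z \<bullet> k) \<in> H1 ell" for k
      unfolding inner_height_field
      by (rule H1_height[OF ell, where s' = "\<lambda>y. s' y * (?d \<bullet> k)"]) (auto intro!: derivative_eq_intros continuous_intros s(1) cs')
    have wm: "wpartial ell i (\<lambda>z. ?w z \<bullet> k) \<in> borel_measurable (slab ell)" if "i \<in> Basis" for i k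
      using wpartial_L2_slab[OF wH1 that] unfolding sq_integrable_def by blast
    have um: "wpartial ell i (\<lambda>z. u z \<bullet> j) \<in> borel_measurable (slab ell)" if "i \<in> Basis" "j \<in> Basis" for i j
      using wp_sq[OF that] unfolding sq_integrable_def by blast
    have [measurable]: "sym_grad ell u i j \<in> borel_measurable (slab ell)"
      "sym_grad ell ?w i j \<in> borel_measurable (slab ell)"
      unfolding sym_grad_def by (intro borel_measurable_add um wm ij)+
    have [measurable]: "(\<lambda>z::'n pt. s' (snd z)) \<in> borel_measurable (slab ell)"
      using s'_sq by (simp add: sq_integrable_def)
    have "L2_inner (slab ell) (sym_grad ell u i j) (sym_grad ell ?w i j) =
        (LINT z|slab ell. ?c * (sym_grad ell u i j z * s' (snd z)))"
      unfolding L2_inner_def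
    proof (rule integral_cong_AE)
      show "AE z in slab ell. sym_grad ell u i j z \<bullet> sym_grad ell ?w i j z =
          ?c * (sym_grad ell u i j z * s' (snd z))"
        using ae by eventually_elim (simp only: inner_real_def mult_ac)
      show "(\<lambda>z. sym_grad ell u i j z \<bullet> sym_grad ell ?w i j z) \<in> borel_measurable (slab ell)"
        "(\<lambda>z. ?c * (sym_grad ell u i j z * s' (snd z))) \<in> borel_measurable (slab ell)"
        by measurable
    qed
    also have "\<dots> = ?c * A i j"
      unfolding A_def L2_inner_def inner_real_def by (rule integral_mult_right_zero)
    finally show ?thesis .
  qed
  then have "sym_grad_inner ell u ?w =
      (\<Sum>i\<in>Basis. \<Sum>j\<in>Basis. of_bool (i = ?N \<and> j = ?d) * A i j + of_bool (i = ?d \<and> j = ?N) * A i j)"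
    unfolding sym_grad_inner_def by (intro sum.cong refl) (simp add: distrib_right)
  also have "\<dots> = (\<Sum>i\<in>Basis. (if i = ?N then A i ?d else 0) + (if i = ?d then A i ?N else 0))"
  proof (rule sum.cong[OF refl])
    fix i :: "'n pt"
    have "(\<Sum>j\<in>Basis. of_bool (i = ?N \<and> j = ?d) * A i j) = (\<Sum>j\<in>Basis. if j = ?d then (if i = ?N then A i ?d else 0) else 0)"
      "(\<Sum>j\<in>Basis. of_bool (i = ?d \<and> j = ?N) * A i j) = (\<Sum>j\<in>Basis. if j = ?N then (if i = ?d then A i ?N else 0) else 0)"
      by (intro sum.cong; auto)+
    then show "(\<Sum>j\<in>Basis. of_bool (i = ?N \<and> j = ?d) * A i j + of_bool (i = ?d \<and> j = ?N) * A i j) =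
        (if i = ?N then A i ?d else 0) + (if i = ?d then A i ?N else 0)"
      using B by (simp only: sum.distrib sum.delta finite_Basis if_True)
  qed
  also have "\<dots> = A ?N ?d + A ?d ?N"
    using B by (simp only: sum.distrib sum.delta finite_Basis if_True)
  also have "\<dots> = 2 * L2_inner (slab ell) (wpartial ell ?N (\<lambda>z. u z \<bullet> ?d)) (\<lambda>z. s' (snd z))"
    using wpartial_horizontal_height[OF uj(2)[OF B(2)] e cs'] B by (simp add: A)
  also have "\<dots> = - 2 * L2_inner (slab ell) (\<lambda>z. u z \<bullet> ?d) (\<lambda>z. s'' (snd z))"
    using wpartial_vertical_height[OF ell uj(2)[OF B(1)] s(2,3,4)] by simp
  finally show ?thesis by simp
qed

text \<open>Pair the divergence with \<open>s\<close>: the horizontal derivatives drop out and the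
  vertical one is moved onto \<open>s\<close>. Since \<open>s\<close> can be the primitive,
  vanishing at \<open>ell\<close>, of any continuous profile, this expresses in weak form that the
  vertical velocity has horizontal mean 0.\<close>

lemma solenoidal_vertical_mean_zero:
  fixes u :: "('n::finite) field"
  assumes ell: "ell > 0" and u: "u \<in> H1sol ell"
    and s: "\<And>y. (s has_real_derivative s' y) (at y)" "continuous_on UNIV s'" "s ell = 0"
  shows "L2_inner (slab ell) (\<lambda>z. u z \<bullet> (0, 1)) (\<lambda>z. s' (snd z)) = 0"
proof -
  let ?N = "(0, 1) :: 'n pt" and ?D = "\<lambda>b. wpartial ell b (\<lambda>z. u z \<bullet> b)"
  have N: "?N \<in> Basis" by (simp add: Basis_prod_def)
  have cs: "continuous_on UNIV s"
    using s(1) by (auto intro!: continuous_at_imp_continuous_on intro: DERIV_isCont)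
  have uj: "(\<lambda>z. u z \<bullet> j) \<in> H1 ell" "has_trace ell 0 (\<lambda>z. u z \<bullet> j) (\<lambda>_. 0)" if "j \<in> Basis" for j
    using u that by (auto simp: H1sol_def)
  have int: "integrable (slab ell) (\<lambda>z. ?D b z \<bullet> s (snd z))" if "b \<in> Basis" for b
    by (intro sq_integrable_inner_integrable wpartial_L2_slab uj that L2_slab_height cs)
  have "0 = (LINT z|slab ell. divergence ell u z * s (snd z))"
  proof (rule integral_eq_zero_AE[symmetric])
    have "AE z in slab ell. divergence ell u z = 0"
      using u unfolding H1sol_def by blast
    then show "AE z in slab ell. divergence ell u z * s (snd z) = 0"
      by eventually_elim simp
  qed
  also have "\<dots> = (\<Sum>b\<in>Basis. L2_inner (slab ell) (?D b) (\<lambda>z. s (snd z)))"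
    unfolding divergence_def sum_distrib_right L2_inner_def using int by (subst Bochner_Integration.integral_sum) auto
  also have "\<dots> = L2_inner (slab ell) (?D ?N) (\<lambda>z. s (snd z)) +
      (\<Sum>b\<in>Basis - {?N}. L2_inner (slab ell) (?D b) (\<lambda>z. s (snd z)))"
    using N by (intro sum.remove) auto
  also have "(\<Sum>b\<in>Basis - {?N}. L2_inner (slab ell) (?D b) (\<lambda>z. s (snd z))) = 0"
  proof (intro sum.neutral ballI)
    fix b assume "b \<in> Basis - {?N}"
    then obtain e where "e \<in> Basis" "b = (e, 0)" by (auto elim: Basis_pt_cases)
    then show "L2_inner (slab ell) (?D b) (\<lambda>z. s (snd z)) = 0"
      using wpartial_horizontal_height[OF uj(2) _ cs, of b e] by (simp add: Basis_prod_def)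
  qed
  also have "L2_inner (slab ell) (?D ?N) (\<lambda>z. s (snd z)) = - L2_inner (slab ell) (\<lambda>z. u z \<bullet> ?N) (\<lambda>z. s' (snd z))"
    by (rule wpartial_vertical_height[OF ell uj(2)[OF N] s])
  finally show ?thesis by simp
qed

section \<open>A weak ordinary differential equation\<close>

lemma integral_lebesgue_on_compact_support:
  fixes f :: "real \<Rightarrow> real"
  assumes f: "continuous_on {a..b} f" and a: "0 < a" and zero: "\<And>t. t \<notin> {a..b} \<Longrightarrow> f t = 0"
  shows "integrable (lebesgue_on {0<..}) f"
    and "(LINT t|lebesgue_on {0<..}. f t) = integral {a..b} f"
proof -
  have int: "integrable (lebesgue_on {a..b}) f"
    by (rule continuous_imp_integrable_real[OF f])
  have eq: "(\<lambda>t. indicator {0<..} t * f t) = (\<lambda>t. indicator {a..b} t * f t)"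
    using a zero by (force simp: indicator_def)
  show "integrable (lebesgue_on {0<..}) f"
    using int by (simp add: integrable_restrict_space set_integrable_def eq)
  have "(LINT t|lebesgue_on {0<..}. f t) = (LINT t|lebesgue_on {a..b}. f t)"
    by (simp add: integral_restrict_space eq)
  also have "\<dots> = integral {a..b} f"
    using int by (intro lebesgue_integral_eq_integral) auto
  finally show "(LINT t|lebesgue_on {0<..}. f t) = integral {a..b} f" .
qed

text \<open>The hypothesis is c' = - \<kappa> c in the sense of distributions, so c(t) exp(\<kappa>
  t) should be constant. If its values at two positive times differ, a test function equal to
  exp(\<kappa> t) times a plateau between them shows that the averages just after the two times
  coincide, which contradicts continuity.\<close>

lemma weak_decay_ode:
  fixes c :: "real \<Rightarrow> real"
  assumes c: "continuous_on {0..} c"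
    and weak: "\<And>\<phi>. time_test \<phi> \<Longrightarrow>
      (LINT t|lebesgue_on {0<..}. c t * deriv \<phi> t) = \<kappa> * (LINT t|lebesgue_on {0<..}. c t * \<phi> t)"
    and "0 \<le> t"
  shows "c t = c 0 * exp (- \<kappa> * t)"
proof -
  define d where "d t = c t * exp (\<kappa> * t)" for t
  have d: "continuous_on {0..} d"
    unfolding d_def by (intro continuous_intros c)
  have eq: "d t0 = d t1" if t: "0 < t0" "t0 < t1" for t0 t1
  proof (rule ccontr)
    assume "d t0 \<noteq> d t1"
    \<comment> \<open>A third of the gap: each average is off by at most one \<eta>, relative to the
      mass of the bump, so two of them cannot close the gap.\<close>
    define \<eta> where "\<eta> = \<bar>d t0 - d t1\<bar> / 3"
    have "\<eta> > 0" using \<open>d t0 \<noteq> d t1\<close> by (simp add: \<eta>_def)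
    have ex: "\<exists>e>0. \<forall>\<tau>\<in>{0..e}. \<bar>d (r + \<tau>) - d r\<bar> \<le> \<eta>" if r: "r > 0" for r
    proof -
      obtain e where e: "e > 0" "\<And>x. x \<in> {0..} \<Longrightarrow> dist x r < e \<Longrightarrow> dist (d x) (d r) < \<eta>"
        using d[unfolded continuous_on_iff, rule_format, of r \<eta>] r \<open>\<eta> > 0\<close> by auto
      have "\<bar>d (r + \<tau>) - d r\<bar> \<le> \<eta>" if "\<tau> \<in> {0..e / 2}" for \<tau>
        using e(2)[of "r + \<tau>"] e(1) that r by (simp add: dist_real_def)
      then show ?thesis using e(1) by (intro exI[of _ "e / 2"]) auto
    qed
    obtain e0 e1 where e01: "e0 > 0" "e1 > 0" "\<forall>\<tau>\<in>{0..e0}. \<bar>d (t0 + \<tau>) - d t0\<bar> \<le> \<eta>"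
      "\<forall>\<tau>\<in>{0..e1}. \<bar>d (t1 + \<tau>) - d t1\<bar> \<le> \<eta>"
      using ex[of t0] ex[of t1] t by auto
    define e where "e = min e0 e1"
    have e: "e > 0" using e01 by (simp add: e_def)
    obtain S \<beta> C where S: "smooth S" "\<And>x. (S has_real_derivative \<beta> x) (at x)" "smooth \<beta>"
      "\<And>x. \<beta> x \<ge> 0" "\<And>x. x \<notin> {0<..<e} \<Longrightarrow> \<beta> x = 0" "\<And>x. x \<le> 0 \<Longrightarrow> S x = 0"
      "\<And>x. x \<ge> e \<Longrightarrow> S x = C" "C > 0"
      using smooth_step[OF e] by blast
    \<comment> \<open>The exponential makes the derivative equal to \<kappa> \<phi> plus two
      weighted bumps, so the terms with \<kappa> cancel in the weak equation. The support starts at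
      \<open>t0\<close>, which is positive as \<open>time_test\<close> requires.\<close>
    define \<phi> where "\<phi> t = exp (\<kappa> * t) * (S (t - t0) - S (t - t1))" for t
    have zero: "\<phi> t = 0" if "t \<notin> {t0..t1 + e}" for t
    proof (cases "t < t0")
      case True
      then show ?thesis using S(6)[of "t - t0"] S(6)[of "t - t1"] t by (simp add: \<phi>_def)
    next
      case False
      then show ?thesis using S(7)[of "t - t0"] S(7)[of "t - t1"] t that by (simp add: \<phi>_def)
    qed
    have sm: "smooth \<phi>"
      unfolding \<phi>_def
      by (intro smooth_mult smooth_diff smooth_compose[OF smooth_exp] smooth_compose[OF S(1)]
          smooth_const smooth_ident)
    then have test: "time_test \<phi>"
      unfolding time_test_def using zero t by blast
    have Sr: "((\<lambda>t. S (t - r)) has_real_derivative \<beta> (t - r)) (at t)" for t r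
      by (rule DERIV_cong[OF DERIV_chain2[OF S(2)]]) (auto intro!: derivative_eq_intros)
    have "(\<phi> has_real_derivative \<kappa> * \<phi> t + exp (\<kappa> * t) * (\<beta> (t - t0) - \<beta> (t - t1))) (at t)" for t
      unfolding \<phi>_def by (auto intro!: derivative_eq_intros Sr simp: algebra_simps)
    then have dphi: "deriv \<phi> t = \<kappa> * \<phi> t + exp (\<kappa> * t) * (\<beta> (t - t0) - \<beta> (t - t1))" for t
      by (rule DERIV_imp_deriv)
    have contb: "continuous_on A (\<lambda>t. \<beta> (t - r))" for A r
      by (intro continuous_on_compose2[OF smooth_continuous_on[OF S(3), of UNIV]] continuous_intros) auto
    have mean: "integrable (lebesgue_on {0<..}) (\<lambda>t. d t * \<beta> (t - r)) \<and>
        \<bar>(LINT t|lebesgue_on {0<..}. d t * \<beta> (t - r)) - d r * C\<bar> \<le> \<eta> * C"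
      if r: "r > 0" and near: "\<forall>\<tau>\<in>{0..e}. \<bar>d (r + \<tau>) - d r\<bar> \<le> \<eta>" for r
    proof -
      have cd: "continuous_on {r..r + e} d" using d r by (auto intro: continuous_on_subset)
      have z: "d t * \<beta> (t - r) = 0" if "t \<notin> {r..r + e}" for t
        using that S(5)[of "t - r"] by auto
      have cdb: "continuous_on {r..r + e} (\<lambda>t. d t * \<beta> (t - r))"
        by (intro continuous_intros cd contb)
      note int = integral_lebesgue_on_compact_support[OF cdb r z]
      have "((\<lambda>t. \<beta> (t - r)) has_integral S (r + e - r) - S (r - r)) {r..r + e}"
      proof (rule fundamental_theorem_of_calculus)
        show "((\<lambda>t. S (t - r)) has_vector_derivative \<beta> (t - r)) (at t within {r..r + e})" for t
          using has_field_derivative_at_within[OF Sr]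
          by (simp add: has_real_derivative_iff_has_vector_derivative)
      qed (use e in simp)
      then have hb: "((\<lambda>t. \<beta> (t - r)) has_integral C) {r..r + e}"
        using S(6)[of 0] S(7)[of e] by simp
      have i1: "(\<lambda>t. d t * \<beta> (t - r)) integrable_on {r..r + e}"
        by (intro integrable_continuous_real continuous_intros cd contb)
      have "((\<lambda>t. d t * \<beta> (t - r) - d r * \<beta> (t - r)) has_integral
          integral {r..r + e} (\<lambda>t. d t * \<beta> (t - r)) - d r * C) {r..r + e}"
        by (intro has_integral_diff integrable_integral[OF i1] has_integral_mult_right hb)
      moreover have "((\<lambda>t. \<eta> * \<beta> (t - r)) has_integral \<eta> * C) {r..r + e}"
        by (intro has_integral_mult_right hb)
      moreover have "norm (d t * \<beta> (t - r) - d r * \<beta> (t - r)) \<le> \<eta> * \<beta> (t - r)" if "t \<in> {r..r + e}" for t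
      proof -
        have "\<bar>d t - d r\<bar> \<le> \<eta>" using near[rule_format, of "t - r"] that by auto
        then have "\<bar>d t - d r\<bar> * \<beta> (t - r) \<le> \<eta> * \<beta> (t - r)" by (intro mult_right_mono S(4))
        moreover have "norm (d t * \<beta> (t - r) - d r * \<beta> (t - r)) = \<bar>d t - d r\<bar> * \<beta> (t - r)"
          using S(4)[of "t - r"] by (simp flip: left_diff_distrib add: abs_mult)
        ultimately show ?thesis by simp
      qed
      ultimately have "norm (integral {r..r + e} (\<lambda>t. d t * \<beta> (t - r)) - d r * C) \<le> \<eta> * C"
        by (metis (no_types, lifting) integral_norm_bound_integral has_integral_integrable integral_unique)
      then show ?thesis using int by simp
    qed
    have near: "\<forall>\<tau>\<in>{0..e}. \<bar>d (t0 + \<tau>) - d t0\<bar> \<le> \<eta>" "\<forall>\<tau>\<in>{0..e}. \<bar>d (t1 + \<tau>) - d t1\<bar> \<le> \<eta>"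
      using e01 by (auto simp: e_def)
    note m0 = mean[OF t(1) near(1)] and m1 = mean[OF _ near(2)]
    have int: "integrable (lebesgue_on {0<..}) (\<lambda>t. c t * \<phi> t)"
    proof (rule integral_lebesgue_on_compact_support(1))
      show "continuous_on {t0..t1 + e} (\<lambda>t. c t * \<phi> t)"
        using t by (intro continuous_intros smooth_continuous_on sm continuous_on_subset[OF c]) auto
    qed (use t zero in auto)
    have "(LINT t|lebesgue_on {0<..}. c t * deriv \<phi> t) =
        (LINT t|lebesgue_on {0<..}. \<kappa> * (c t * \<phi> t) + (d t * \<beta> (t - t0) - d t * \<beta> (t - t1)))"
      by (rule Bochner_Integration.integral_cong) (auto simp: dphi d_def algebra_simps)
    also have "\<dots> = \<kappa> * (LINT t|lebesgue_on {0<..}. c t * \<phi> t) +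
        ((LINT t|lebesgue_on {0<..}. d t * \<beta> (t - t0)) - (LINT t|lebesgue_on {0<..}. d t * \<beta> (t - t1)))"
      using int m0 m1 t by simp
    finally have "(LINT t|lebesgue_on {0<..}. d t * \<beta> (t - t0)) = (LINT t|lebesgue_on {0<..}. d t * \<beta> (t - t1))"
      using weak[OF test] by simp
    then have "\<bar>d t0 * C - d t1 * C\<bar> \<le> 2 * \<eta> * C"
      using m0 m1 t by linarith
    then have "\<bar>d t0 - d t1\<bar> * C \<le> 2 * \<eta> * C"
      using \<open>C > 0\<close> by (simp flip: left_diff_distrib add: abs_mult)
    then have "\<bar>d t0 - d t1\<bar> \<le> 2 * \<eta>" using \<open>C > 0\<close> by simp
    then show False using \<open>\<eta> > 0\<close> by (simp add: \<eta>_def)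
  qed
  have d1: "d t = d 1" if "t > 0" for t
    using eq that by (metis linorder_neq_iff zero_less_one)
  \<comment> \<open>Time 0 lies outside the support of every test function and is reached by
    continuity from the right.\<close>
  have "(d \<longlongrightarrow> d 0) (at_right 0)"
  proof (rule tendsto_within_subset)
    show "(d \<longlongrightarrow> d 0) (at 0 within {0..})"
      using d unfolding continuous_on_def by simp
  qed auto
  moreover have "(d \<longlongrightarrow> d 1) (at_right 0)"
  proof (rule tendsto_eventually)
    show "\<forall>\<^sub>F t in at_right 0. d t = d 1"
      unfolding eventually_at_filter by (intro always_eventually allI impI d1) simp
  qed
  ultimately have "d 0 = d 1"
    by (intro tendsto_unique) auto
  then have "d t = d 0" using d1 \<open>0 \<le> t\<close> by (metis order_le_less)
  then show ?thesis by (simp add: d_def exp_minus field_simps)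
qed

section \<open>Sine series on the height interval\<close>

lemma L2_norm_triangle:
  assumes "sq_integrable M f" "sq_integrable M g"
  shows "L2_norm M f \<le> L2_norm M (\<lambda>x. f x - g x) + L2_norm M g"
proof -
  let ?h = "\<lambda>x. f x - g x"
  have h: "sq_integrable M ?h" by (rule sq_integrable_diff[OF assms])
  have int: "integrable M (\<lambda>x. ?h x \<bullet> g x)" "integrable M (\<lambda>x. (norm (?h x))\<^sup>2)" "integrable M (\<lambda>x. (norm (g x))\<^sup>2)"
    using sq_integrable_inner_integrable[OF h assms(2)] h assms(2) by (auto simp: sq_integrable_def)
  have "(norm (f x))\<^sup>2 = (norm (?h x))\<^sup>2 + 2 * (?h x \<bullet> g x) + (norm (g x))\<^sup>2" for x
    unfolding power2_norm_eq_inner by (simp add: inner_diff_left inner_diff_right inner_commute[of "g x" "f x"])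
  then have "(L2_norm M f)\<^sup>2 = (LINT x|M. (norm (?h x))\<^sup>2 + 2 * (?h x \<bullet> g x) + (norm (g x))\<^sup>2)"
    by (simp add: L2_norm_sq)
  also have "\<dots> = (L2_norm M ?h)\<^sup>2 + 2 * L2_inner M ?h g + (L2_norm M g)\<^sup>2"
    using int by (simp add: L2_norm_sq L2_inner_def)
  also have "\<dots> \<le> (L2_norm M ?h)\<^sup>2 + 2 * (L2_norm M ?h * L2_norm M g) + (L2_norm M g)\<^sup>2"
    using L2_Cauchy_Schwarz[OF h assms(2)] by simp
  also have "\<dots> = (L2_norm M ?h + L2_norm M g)\<^sup>2"
    by (simp add: power2_sum)
  finally show ?thesis
    by (rule power2_le_imp_le) (simp add: L2_norm_nonneg)
qed

lemma L2_norm_minus_commute: "L2_norm M (\<lambda>x. f x - g x) = L2_norm M (\<lambda>x. g x - f x)"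
  by (simp add: L2_norm_def norm_minus_commute)

text \<open>The sines with these frequencies are the eigenfunctions of the second derivative that
  vanish at 0 and have vanishing derivative at \<open>ell\<close>.\<close>

definition freq :: "real \<Rightarrow> nat \<Rightarrow> real" where
  "freq ell k = (real k + 1 / 2) * pi / ell"

lemma freq_pos: "ell > 0 \<Longrightarrow> freq ell k > 0"
  by (simp add: freq_def add_nonneg_pos)

lemma freq_mono: "ell > 0 \<Longrightarrow> freq ell 0 \<le> freq ell k"
  unfolding freq_def by (intro divide_right_mono mult_right_mono) auto

lemma space_height: "space (height_interval ell) = {0<..<ell}"
  by (simp add: space_restrict_space)

lemma continuous_sq_integrable_height:
  fixes f :: "real \<Rightarrow> real"
  assumes "continuous_on UNIV f"
  shows "sq_integrable (height_interval ell) f"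
proof -
  have "compact (f ` {0..ell})"
    using assms by (intro compact_continuous_image) (auto intro: continuous_on_subset)
  then obtain C where C: "\<And>z. z \<in> {0..ell} \<Longrightarrow> norm (f z) \<le> C"
    using compact_imp_bounded bounded_iff by (metis imageI)
  have m[measurable]: "f \<in> borel_measurable (height_interval ell)"
    using assms by (intro measurable_restrict_space1) (simp add: borel_measurable_continuous_onI)
  have "(norm (f z))\<^sup>2 \<le> C\<^sup>2" if "z \<in> space (height_interval ell)" for z
    using that by (intro power_mono C) (auto simp: space_height)
  then have "integrable (height_interval ell) (\<lambda>z. (norm (f z))\<^sup>2)"
    by (intro height.integrable_const_bound[of _ "C\<^sup>2"]) (auto intro!: AE_I2)
  then show ?thesis by (simp add: sq_integrable_def)
qed

lemma cos_freq_ell: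
  assumes "ell > 0"
  shows "cos (freq ell k * ell) = 0"
  unfolding cos_zero_iff_int2
  by (rule exI[of _ "int k"]) (use assms in \<open>simp add: freq_def field_simps\<close>)

lemma sin_orthogonal:
  assumes "ell > 0"
  shows "(LINT y|height_interval ell. sin (freq ell j * y) * sin (freq ell k * y)) = (if j = k then ell / 2 else 0)"
proof (cases "j = k")
  case True
  let ?w = "freq ell k"
  have w: "?w > 0" by (rule freq_pos[OF assms])
  have "(LINT y|height_interval ell. sin (?w * y) * sin (?w * y)) =
      (ell / 2 - sin (2 * (?w * ell)) / (4 * ?w)) - (0 / 2 - sin (2 * (?w * 0)) / (4 * ?w))"
  proof (rule integral_height_interval[OF assms])
    fix y
    have "((\<lambda>y. y / 2 - sin (2 * (?w * y)) / (4 * ?w)) has_real_derivative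
        1 / 2 - cos (2 * (?w * y)) * (2 * ?w) / (4 * ?w)) (at y)"
      by (auto intro!: derivative_eq_intros)
    moreover have "1 / 2 - cos (2 * (?w * y)) * (2 * ?w) / (4 * ?w) = sin (?w * y) * sin (?w * y)"
      unfolding cos_double_sin using w by (simp add: power2_eq_square field_simps)
    ultimately show "((\<lambda>y. y / 2 - sin (2 * (?w * y)) / (4 * ?w)) has_real_derivative
        sin (?w * y) * sin (?w * y)) (at y)" by simp
  qed (intro continuous_intros)
  moreover have "sin (2 * (?w * ell)) = 0"
    by (simp only: sin_double cos_freq_ell[OF assms] mult_zero_right)
  ultimately show ?thesis using True by simp
next
  case False
  let ?a = "freq ell j" and ?b = "freq ell k"
  let ?F = "\<lambda>y. sin ((?a - ?b) * y) / (2 * (?a - ?b)) - sin ((?a + ?b) * y) / (2 * (?a + ?b))"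
  have ab: "?a - ?b = (real j - real k) * pi / ell" "?a + ?b = (real j + real k + 1) * pi / ell"
    using assms by (auto simp: freq_def field_simps)
  have n0: "?a - ?b \<noteq> 0" "?a + ?b \<noteq> 0"
    using False assms freq_pos[OF assms, of j] freq_pos[OF assms, of k] by (auto simp: ab)
  have "(LINT y|height_interval ell. sin (?a * y) * sin (?b * y)) = ?F ell - ?F 0"
  proof (rule integral_height_interval[OF assms])
    fix y
    have "(?F has_real_derivative cos ((?a - ?b) * y) * (?a - ?b) / (2 * (?a - ?b)) -
        cos ((?a + ?b) * y) * (?a + ?b) / (2 * (?a + ?b))) (at y)"
      using n0 by (auto intro!: derivative_eq_intros)
    moreover have "cos ((?a - ?b) * y) * (?a - ?b) / (2 * (?a - ?b)) -
        cos ((?a + ?b) * y) * (?a + ?b) / (2 * (?a + ?b)) = sin (?a * y) * sin (?b * y)"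
    proof -
      have cancel: "x * d / (2 * d) = x / 2" if "d \<noteq> 0" for x d :: real using that by simp
      show ?thesis
        unfolding sin_times_sin cancel[OF n0(1)] cancel[OF n0(2)]
        by (simp add: left_diff_distrib distrib_right diff_divide_distrib)
    qed
    ultimately show "(?F has_real_derivative sin (?a * y) * sin (?b * y)) (at y)" by simp
  qed (intro continuous_intros)
  also have "sin ((?a - ?b) * ell) = 0"
    using assms unfolding ab sin_zero_iff_int2 by (intro exI[of _ "int j - int k"]) simp
  also have "sin ((?a + ?b) * ell) = 0"
    using assms unfolding ab sin_zero_iff_int2 by (intro exI[of _ "int j + int k + 1"]) simp
  finally show ?thesis using False by simp
qed

section \<open>Finite sine sums\<close>

definition sine_span :: "real \<Rightarrow> (real \<Rightarrow> real) set" where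
  "sine_span ell = {\<phi>. \<exists>n a. \<phi> = (\<lambda>y. \<Sum>k<n. a k * sin (freq ell k * y))}"

lemma sine_spanI: "\<phi> = (\<lambda>y. \<Sum>k<n. a k * sin (freq ell k * y)) \<Longrightarrow> \<phi> \<in> sine_span ell"
  unfolding sine_span_def by blast

lemma sine_span_zero: "(\<lambda>_. 0) \<in> sine_span ell"
  unfolding sine_span_def by (auto intro!: exI[of _ "0::nat"])

lemma sine_span_sin: "(\<lambda>y. sin (freq ell k * y)) \<in> sine_span ell"
  unfolding sine_span_def
  by (auto intro!: exI[of _ "Suc k"] exI[of _ "\<lambda>i. of_bool (i = k)"] simp: fun_eq_iff)

lemma sine_span_scale:
  assumes "\<phi> \<in> sine_span ell"
  shows "(\<lambda>y. c * \<phi> y) \<in> sine_span ell"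
proof -
  obtain n a where "\<phi> = (\<lambda>y. \<Sum>k<n. a k * sin (freq ell k * y))"
    using assms by (auto simp: sine_span_def)
  then have "(\<lambda>y. c * \<phi> y) = (\<lambda>y. \<Sum>k<n. (c * a k) * sin (freq ell k * y))"
    by (simp add: sum_distrib_left mult.assoc)
  then show ?thesis by (rule sine_spanI)
qed

lemma sine_span_add:
  assumes "\<phi> \<in> sine_span ell" "\<psi> \<in> sine_span ell"
  shows "(\<lambda>y. \<phi> y + \<psi> y) \<in> sine_span ell"
proof -
  obtain n a m b where \<phi>: "\<phi> = (\<lambda>y. \<Sum>k<n. a k * sin (freq ell k * y))"
    and \<psi>: "\<psi> = (\<lambda>y. \<Sum>k<m. b k * sin (freq ell k * y))"
    using assms by (auto simp: sine_span_def)
  let ?c = "\<lambda>k. (if k < n then a k else 0) + (if k < m then b k else 0)"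
  have pad: "(\<Sum>k<n. a k * s k) = (\<Sum>k<n + m. (if k < n then a k else 0) * s k)" for n m and a s :: "nat \<Rightarrow> real"
    by (intro sum.mono_neutral_cong_left) auto
  have "\<phi> y + \<psi> y = (\<Sum>k<n + m. ?c k * sin (freq ell k * y))" for y
    using pad[where n = n and m = m and a = a and s = "\<lambda>k. sin (freq ell k * y)"]
      pad[where n = m and m = n and a = b and s = "\<lambda>k. sin (freq ell k * y)"]
    by (simp add: \<phi> \<psi> sum.distrib[symmetric] distrib_right add.commute[of m n])
  then show ?thesis by (intro sine_spanI[where a = ?c and n = "n + m"] ext)
qed

lemma sine_span_sum:
  "(\<And>i. i \<in> A \<Longrightarrow> f i \<in> sine_span ell) \<Longrightarrow> (\<lambda>y. \<Sum>i\<in>A. f i y) \<in> sine_span ell"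
  by (induction A rule: infinite_finite_induct) (auto intro: sine_span_zero sine_span_add)

text \<open>Multiplication by this cosine moves the frequency up and down by pi / ell, to the
  neighbouring members. At the bottom, \<open>freq ell 0\<close> is moved down to its own negative,
  and the sine is odd, so the span is not left.\<close>

lemma sine_span_cos_sin: "(\<lambda>y. cos (pi / ell * y) * sin (freq ell k * y)) \<in> sine_span ell"
proof -
  have eq: "cos (pi / ell * y) * sin (freq ell k * y) =
      1 / 2 * sin (freq ell (Suc k) * y) + 1 / 2 * sin ((freq ell k - pi / ell) * y)" for y
    using cos_times_sin[of "pi / ell * y" "freq ell k * y"] sin_minus[of "pi / ell * y - freq ell k * y"]
    by (simp add: freq_def add_divide_distrib distrib_right left_diff_distrib algebra_simps)
  have "(\<lambda>y. sin ((freq ell k - pi / ell) * y)) \<in> sine_span ell"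
  proof (cases k)
    case 0
    have "sin ((freq ell 0 - pi / ell) * y) = - 1 * sin (freq ell 0 * y)" for y
    proof -
      have "(freq ell 0 - pi / ell) * y = - (freq ell 0 * y)" by (simp add: freq_def field_simps)
      then show ?thesis by simp
    qed
    then show ?thesis using sine_span_scale[OF sine_span_sin, of "- 1" ell 0] 0 by simp
  next
    case (Suc m)
    have "freq ell k - pi / ell = freq ell m"
      by (simp add: Suc freq_def add_divide_distrib distrib_right)
    then show ?thesis by (simp add: sine_span_sin)
  qed
  then show ?thesis
    unfolding eq by (intro sine_span_add sine_span_scale sine_span_sin)
qed

lemma sine_span_cos_mult:
  assumes "\<phi> \<in> sine_span ell"
  shows "(\<lambda>y. cos (pi / ell * y) * \<phi> y) \<in> sine_span ell"
proof -
  obtain n a where \<phi>: "\<phi> = (\<lambda>y. \<Sum>k<n. a k * sin (freq ell k * y))"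
    using assms by (auto simp: sine_span_def)
  have "(\<lambda>y. cos (pi / ell * y) * \<phi> y) = (\<lambda>y. \<Sum>k<n. a k * (cos (pi / ell * y) * sin (freq ell k * y)))"
    by (simp add: \<phi> sum_distrib_left mult.left_commute)
  moreover have "\<dots> \<in> sine_span ell"
    by (intro sine_span_sum sine_span_scale sine_span_cos_sin)
  ultimately show ?thesis by simp
qed

text \<open>Induction on the degree, each factor of the cosine preserving the span. This turns
  approximation by sine sums into approximation by polynomials in one variable.\<close>

lemma sine_span_polynomial:
  "(\<lambda>y. sin (freq ell 0 * y) * (\<Sum>i\<le>n. a i * cos (pi / ell * y) ^ i)) \<in> sine_span ell"
proof -
  have pow: "(\<lambda>y. cos (pi / ell * y) ^ i * sin (freq ell 0 * y)) \<in> sine_span ell" for i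
  proof (induction i)
    case 0
    show ?case using sine_span_sin[of ell 0] by simp
  next
    case (Suc i)
    from sine_span_cos_mult[OF this] show ?case by (simp add: mult.assoc)
  qed
  have "(\<lambda>y. sin (freq ell 0 * y) * (\<Sum>i\<le>n. a i * cos (pi / ell * y) ^ i)) =
      (\<lambda>y. \<Sum>i\<le>n. a i * (cos (pi / ell * y) ^ i * sin (freq ell 0 * y)))"
    by (simp add: sum_distrib_left algebra_simps)
  moreover have "\<dots> \<in> sine_span ell"
    by (intro sine_span_sum sine_span_scale pow)
  ultimately show ?thesis by simp
qed

lemma sine_span_continuous: "\<phi> \<in> sine_span ell \<Longrightarrow> continuous_on UNIV \<phi>"
  by (auto simp: sine_span_def intro!: continuous_intros)

section \<open>Density in the square integrable functions\<close>

text \<open>A measurable function is a limit of continuous ones off a null set. Truncating these at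
  \<open>B\<close> keeps the limit, because \<open>W\<close> is itself bounded by \<open>B\<close>,
  and supplies the constant (2 B)^2 for dominated convergence.\<close>

lemma measurable_bounded_approx_continuous:
  fixes W :: "real \<Rightarrow> real"
  assumes W: "W \<in> borel_measurable (height_interval ell)"
    and bound: "\<And>y. y \<in> {0<..<ell} \<Longrightarrow> \<bar>W y\<bar> \<le> B" and "B \<ge> 0" "\<epsilon> > 0"
  obtains G where "continuous_on UNIV G" "(LINT y|height_interval ell. (W y - G y)\<^sup>2) < \<epsilon>"
proof -
  have "(\<lambda>y. indicator {0<..<ell} y *\<^sub>R W y) \<in> borel_measurable lborel"
    using W by (subst (asm) borel_measurable_restrict_space_iff) auto
  then have "(\<lambda>y. indicator {0<..<ell} y *\<^sub>R W y) \<in> borel_measurable lebesgue"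
    by (rule measurable_completion)
  then have "(\<lambda>y. indicator {0<..<ell} y *\<^sub>R W y) measurable_on UNIV"
    by (rule lebesgue_measurable_imp_measurable_on) simp
  then obtain N g where N: "negligible N" and g: "\<And>n. continuous_on UNIV (g n)"
    "\<And>y. y \<notin> N \<Longrightarrow> (\<lambda>n. g n y) \<longlonglongrightarrow> indicator {0<..<ell} y *\<^sub>R W y"
    unfolding measurable_on_def by auto
  define G where "G n y = max (- B) (min B (g n y))" for n y
  have G: "continuous_on UNIV (G n)" for n
    unfolding G_def by (intro continuous_intros g)
  have "AE y in lebesgue. y \<notin> N"
    using N by (simp add: negligible_iff_null_sets AE_not_in)
  then have aeN: "AE y in lborel. y \<notin> N" by (rule AE_completion_iff[THEN iffD1])
  have lim: "AE y in height_interval ell. (\<lambda>n. (W y - G n y)\<^sup>2) \<longlonglongrightarrow> 0"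
  proof (subst AE_restrict_space_iff)
    show "AE y in lborel. y \<in> {0<..<ell} \<longrightarrow> (\<lambda>n. (W y - G n y)\<^sup>2) \<longlonglongrightarrow> 0"
      using aeN
    proof eventually_elim
      case (elim y)
      show ?case
      proof
        assume y: "y \<in> {0<..<ell}"
        then have "(\<lambda>n. G n y) \<longlonglongrightarrow> max (- B) (min B (W y))"
          unfolding G_def using g(2)[OF elim] by (intro tendsto_intros) simp
        also have "max (- B) (min B (W y)) = W y"
          using bound[OF y] by auto
        finally have "(\<lambda>n. (W y - G n y)\<^sup>2) \<longlonglongrightarrow> (W y - W y)\<^sup>2"
          by (intro tendsto_intros)
        then show "(\<lambda>n. (W y - G n y)\<^sup>2) \<longlonglongrightarrow> 0" by simp
      qed
    qed
  qed simp
  have Gm[measurable]: "G n \<in> borel_measurable (height_interval ell)" for n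
    using continuous_sq_integrable_height[OF G] by (simp add: sq_integrable_def)
  note W[measurable]
  have "(\<lambda>n. LINT y|height_interval ell. (W y - G n y)\<^sup>2) \<longlonglongrightarrow> (LINT y|height_interval ell. 0)"
  proof (rule integral_dominated_convergence[where w = "\<lambda>_. (2 * B)\<^sup>2"])
    fix n
    show "AE y in height_interval ell. norm ((W y - G n y)\<^sup>2) \<le> (2 * B)\<^sup>2"
    proof (rule AE_I2)
      fix y assume "y \<in> space (height_interval ell)"
      then have "\<bar>W y\<bar> \<le> B" using bound by (simp add: space_height)
      moreover have "\<bar>G n y\<bar> \<le> B" using \<open>B \<ge> 0\<close> by (auto simp: G_def)
      ultimately have "\<bar>W y - G n y\<bar> \<le> \<bar>2 * B\<bar>" by linarith
      then show "norm ((W y - G n y)\<^sup>2) \<le> (2 * B)\<^sup>2"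
        unfolding abs_le_square_iff by simp
    qed
  qed (use lim in auto)
  then have "\<forall>\<^sub>F n in sequentially. (LINT y|height_interval ell. (W y - G n y)\<^sup>2) < \<epsilon>"
    using \<open>\<epsilon> > 0\<close> by (intro order_tendstoD) auto
  then obtain n where "(LINT y|height_interval ell. (W y - G n y)\<^sup>2) < \<epsilon>"
    by (auto simp: eventually_sequentially)
  with G that show ?thesis by blast
qed

text \<open>
  After division by \<open>sin (freq ell 0 * y)\<close>, the span consists of the polynomials in
  \<open>cos (pi / ell * y)\<close>, which are uniformly dense in the continuous functions on \<open>[0, ell]\<close>.
\<close>

lemma sine_span_dense:
  assumes ell: "ell > 0" and f: "sq_integrable (height_interval ell) f" and "\<epsilon> > 0"
  obtains \<phi> where "\<phi> \<in> sine_span ell" "L2_norm (height_interval ell) (\<lambda>y. f y - \<phi> y) < \<epsilon>"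
proof -
  let ?I = "height_interval ell" and ?\<sigma> = "\<lambda>y. sin (freq ell 0 * y)"
  have fm[measurable]: "f \<in> borel_measurable ?I" and f2: "integrable ?I (\<lambda>y. (f y)\<^sup>2)"
    using f by (auto simp: sq_integrable_def)
  have c\<sigma>: "continuous_on UNIV ?\<sigma>" by (intro continuous_intros)
  have \<sigma>m[measurable]: "?\<sigma> \<in> borel_measurable ?I"
    using continuous_sq_integrable_height[OF c\<sigma>] by (simp add: sq_integrable_def)
  have \<sigma>pos: "?\<sigma> y > 0" if "y \<in> {0<..<ell}" for y
  proof (rule sin_gt_zero)
    show "0 < freq ell 0 * y" using that freq_pos[OF ell] by simp
    have "freq ell 0 * y < freq ell 0 * ell"
      using that freq_pos[OF ell] by (intro mult_strict_left_mono) auto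
    also have "freq ell 0 * ell < pi" using ell by (simp add: freq_def)
    finally show "freq ell 0 * y < pi" .
  qed
  \<comment> \<open>The sine vanishes at 0, so the quotient may be unbounded; it is set to 0 where
    it exceeds \<open>n\<close>. Multiplied back it gives \<open>f\<close> or 0, so the squared
    error is dominated by f^2.\<close>
  define W where "W n y = (if \<bar>f y\<bar> \<le> real n * ?\<sigma> y then f y / ?\<sigma> y else 0)" for n y
  have Wm[measurable]: "W n \<in> borel_measurable ?I" for n
    unfolding W_def by measurable
  have "(\<lambda>n. LINT y|?I. (f y - ?\<sigma> y * W n y)\<^sup>2) \<longlonglongrightarrow> (LINT y|?I. 0)"
  proof (rule integral_dominated_convergence[where w = "\<lambda>y. (f y)\<^sup>2"])
    show "AE y in ?I. (\<lambda>n. (f y - ?\<sigma> y * W n y)\<^sup>2) \<longlonglongrightarrow> 0"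
    proof (rule AE_I2)
      fix y assume "y \<in> space ?I"
      then have \<sigma>: "?\<sigma> y > 0" using \<sigma>pos by (simp add: space_height)
      obtain n0 where "\<bar>f y\<bar> / ?\<sigma> y \<le> real n0" using real_arch_simple by blast
      then have "\<forall>n\<ge>n0. \<bar>f y\<bar> / ?\<sigma> y \<le> real n" by (meson of_nat_mono order_trans)
      then have "\<forall>\<^sub>F n in sequentially. (f y - ?\<sigma> y * W n y)\<^sup>2 = 0"
        unfolding eventually_sequentially W_def using \<sigma> by (auto simp: field_simps)
      then show "(\<lambda>n. (f y - ?\<sigma> y * W n y)\<^sup>2) \<longlonglongrightarrow> 0" by (rule tendsto_eventually)
    qed
    fix n
    show "AE y in ?I. norm ((f y - ?\<sigma> y * W n y)\<^sup>2) \<le> (f y)\<^sup>2"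
    proof (rule AE_I2)
      fix y assume "y \<in> space ?I"
      then have "?\<sigma> y > 0" using \<sigma>pos by (simp add: space_height)
      then show "norm ((f y - ?\<sigma> y * W n y)\<^sup>2) \<le> (f y)\<^sup>2" by (auto simp: W_def)
    qed
  qed (use f2 in auto)
  then have "\<forall>\<^sub>F n in sequentially. (LINT y|?I. (f y - ?\<sigma> y * W n y)\<^sup>2) < (\<epsilon> / 3)\<^sup>2"
    using \<open>\<epsilon> > 0\<close> by (intro order_tendstoD) auto
  then obtain n where n: "(LINT y|?I. (f y - ?\<sigma> y * W n y)\<^sup>2) < (\<epsilon> / 3)\<^sup>2"
    by (auto simp: eventually_sequentially)
  have Wb: "\<bar>W n y\<bar> \<le> real n" if "y \<in> {0<..<ell}" for y
    using \<sigma>pos[OF that] by (auto simp: W_def abs_if field_simps)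
  obtain G where G: "continuous_on UNIV G" and WG: "(LINT y|?I. (W n y - G y)\<^sup>2) < (\<epsilon> / 3)\<^sup>2"
    using measurable_bounded_approx_continuous[OF Wm Wb, of "(\<epsilon> / 3)\<^sup>2"] \<open>\<epsilon> > 0\<close> by auto
  \<comment> \<open>A uniform error \<eta> costs \<eta> sqrt ell in the norm, which is below
    \<epsilon> / 3 because ell < (ell + 1)^2.\<close>
  define \<eta> where "\<eta> = \<epsilon> / 3 / (ell + 1)"
  have \<eta>: "\<eta> > 0" using \<open>\<epsilon> > 0\<close> ell by (simp add: \<eta>_def)
  \<comment> \<open>The substitution x = cos (pi y / ell), undone by \<open>arccos\<close>, carries
    the height interval to [-1, 1], where polynomials are uniformly dense.\<close>
  have "continuous_on {- 1..1} (\<lambda>x. G (ell / pi * arccos x))"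
    by (intro continuous_on_compose2[OF G] continuous_intros) auto
  then obtain q where q: "real_polynomial_function q"
    "\<And>x. x \<in> {- 1..1} \<Longrightarrow> \<bar>G (ell / pi * arccos x) - q x\<bar> < \<eta>"
    using Stone_Weierstrass_real_polynomial_function[of "{- 1..1::real}"] \<eta> by (metis compact_Icc)
  obtain a m where qa: "q = (\<lambda>x. \<Sum>i\<le>m. a i * x ^ i)"
    using q(1) unfolding real_polynomial_function_iff_sum by blast
  define \<phi> where "\<phi> y = ?\<sigma> y * q (cos (pi / ell * y))" for y
  have \<phi>: "\<phi> \<in> sine_span ell"
    unfolding \<phi>_def qa by (rule sine_span_polynomial)
  have approx: "\<bar>G y - q (cos (pi / ell * y))\<bar> < \<eta>" if "y \<in> {0<..<ell}" for y
  proof -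
    have "0 \<le> pi / ell * y" "pi / ell * y \<le> pi" using that ell by (auto simp: field_simps)
    then have "ell / pi * arccos (cos (pi / ell * y)) = y" using ell by (simp add: arccos_cos)
    then show ?thesis using q(2)[of "cos (pi / ell * y)"] by simp
  qed
  have sq: "sq_integrable ?I (\<lambda>y. ?\<sigma> y * G y)" "sq_integrable ?I \<phi>"
    by (intro continuous_sq_integrable_height continuous_intros G sine_span_continuous[OF \<phi>])+
  have sqW: "sq_integrable ?I (\<lambda>y. ?\<sigma> y * W n y)"
  proof -
    have "integrable ?I (\<lambda>y. (?\<sigma> y * W n y)\<^sup>2)"
    proof (rule Bochner_Integration.integrable_bound[OF f2])
      show "AE y in ?I. norm ((?\<sigma> y * W n y)\<^sup>2) \<le> norm ((f y)\<^sup>2)"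
      proof (rule AE_I2)
        fix y assume "y \<in> space ?I"
        then have "?\<sigma> y > 0" using \<sigma>pos by (simp add: space_height)
        then show "norm ((?\<sigma> y * W n y)\<^sup>2) \<le> norm ((f y)\<^sup>2)" by (auto simp: W_def)
      qed
    qed measurable
    then show ?thesis by (simp add: sq_integrable_def)
  qed
  have n1: "L2_norm ?I (\<lambda>y. f y - ?\<sigma> y * W n y) < \<epsilon> / 3"
    unfolding L2_norm_def using n \<open>\<epsilon> > 0\<close> by (intro real_less_lsqrt) auto
  have n2: "L2_norm ?I (\<lambda>y. ?\<sigma> y * W n y - ?\<sigma> y * G y) < \<epsilon> / 3"
  proof -
    have [measurable]: "G \<in> borel_measurable ?I"
      using continuous_sq_integrable_height[OF G] by (simp add: sq_integrable_def)
    have Wsq: "sq_integrable ?I (W n)"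
    proof -
      have "integrable ?I (\<lambda>y. (W n y)\<^sup>2)"
      proof (rule height.integrable_const_bound[where B = "(real n)\<^sup>2"])
        show "AE y in ?I. norm ((W n y)\<^sup>2) \<le> (real n)\<^sup>2"
        proof (rule AE_I2)
          fix y assume "y \<in> space ?I"
          then have "\<bar>W n y\<bar> \<le> \<bar>real n\<bar>" using Wb by (simp add: space_height)
          then show "norm ((W n y)\<^sup>2) \<le> (real n)\<^sup>2" unfolding abs_le_square_iff by simp
        qed
      qed measurable
      then show ?thesis by (simp add: sq_integrable_def)
    qed
    have i: "integrable ?I (\<lambda>y. (W n y - G y)\<^sup>2)"
      using sq_integrable_diff[OF Wsq continuous_sq_integrable_height[OF G]] by (simp add: sq_integrable_def)
    have le: "(?\<sigma> y * W n y - ?\<sigma> y * G y)\<^sup>2 \<le> (W n y - G y)\<^sup>2" for y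
    proof -
      have "(?\<sigma> y)\<^sup>2 * (W n y - G y)\<^sup>2 \<le> 1 * (W n y - G y)\<^sup>2"
        using sin_cos_squared_add[of "freq ell 0 * y"] by (intro mult_right_mono) (smt (verit) zero_le_power2)+
      then show ?thesis by (simp flip: right_diff_distrib add: power_mult_distrib)
    qed
    have "(LINT y|?I. (?\<sigma> y * W n y - ?\<sigma> y * G y)\<^sup>2) \<le> (LINT y|?I. (W n y - G y)\<^sup>2)"
      using sq_integrable_diff[OF sqW sq(1)] i le by (intro integral_mono) (auto simp: sq_integrable_def)
    then show ?thesis
      unfolding L2_norm_def using WG \<open>\<epsilon> > 0\<close> by (intro real_less_lsqrt) auto
  qed
  have n3: "L2_norm ?I (\<lambda>y. ?\<sigma> y * G y - \<phi> y) < \<epsilon> / 3"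
  proof -
    have "(?\<sigma> y * G y - \<phi> y)\<^sup>2 \<le> \<eta>\<^sup>2" if "y \<in> {0<..<ell}" for y
    proof -
      have "\<bar>?\<sigma> y * G y - \<phi> y\<bar> = \<bar>?\<sigma> y\<bar> * \<bar>G y - q (cos (pi / ell * y))\<bar>"
        unfolding \<phi>_def by (simp flip: right_diff_distrib add: abs_mult)
      also have "\<dots> \<le> 1 * \<eta>"
        using approx[OF that] by (intro mult_mono) auto
      finally show ?thesis using \<eta> by (simp add: abs_le_square_iff[symmetric])
    qed
    then have "(LINT y|?I. (?\<sigma> y * G y - \<phi> y)\<^sup>2) \<le> (LINT y|?I. \<eta>\<^sup>2)"
      using sq_integrable_diff[OF sq] by (intro integral_mono) (auto simp: sq_integrable_def space_height)
    also have "\<dots> = \<eta>\<^sup>2 * ell"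
      using ell by (simp add: measure_restrict_space)
    also have "\<dots> < (\<eta> * (ell + 1))\<^sup>2"
    proof -
      have "ell < (ell + 1)\<^sup>2" using ell by (simp add: power2_eq_square algebra_simps add_pos_pos)
      then show ?thesis using \<eta> by (simp add: power_mult_distrib)
    qed
    also have "\<eta> * (ell + 1) = \<epsilon> / 3"
      unfolding \<eta>_def by (subst nonzero_eq_divide_eq[symmetric]) (use ell in auto)
    finally show ?thesis
      unfolding L2_norm_def using \<open>\<epsilon> > 0\<close> by (intro real_less_lsqrt) auto
  qed
  have "L2_norm ?I (\<lambda>y. f y - \<phi> y) \<le>
      L2_norm ?I (\<lambda>y. (f y - \<phi> y) - (f y - ?\<sigma> y * W n y)) + L2_norm ?I (\<lambda>y. f y - ?\<sigma> y * W n y)"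
    by (intro L2_norm_triangle sq_integrable_diff f sq sqW)
  moreover have "L2_norm ?I (\<lambda>y. (f y - \<phi> y) - (f y - ?\<sigma> y * W n y)) \<le>
      L2_norm ?I (\<lambda>y. ((f y - \<phi> y) - (f y - ?\<sigma> y * W n y)) - (?\<sigma> y * G y - \<phi> y)) + L2_norm ?I (\<lambda>y. ?\<sigma> y * G y - \<phi> y)"
    by (intro L2_norm_triangle sq_integrable_diff f sq sqW)
  moreover have "(\<lambda>y. ((f y - \<phi> y) - (f y - ?\<sigma> y * W n y)) - (?\<sigma> y * G y - \<phi> y)) =
      (\<lambda>y. ?\<sigma> y * W n y - ?\<sigma> y * G y)" by (simp add: fun_eq_iff)
  ultimately have "L2_norm ?I (\<lambda>y. f y - \<phi> y) < \<epsilon>"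
    using n1 n2 n3 by simp
  with \<phi> that show ?thesis by blast
qed

text \<open>
  A diagonal damping of the sine coefficients contracts the norm: its adjoint contracts the norm of
  every finite sine sum, and these are dense.
\<close>

lemma damped_sine_coefficients:
  assumes ell: "ell > 0" and f: "sq_integrable (height_interval ell) f" and g: "sq_integrable (height_interval ell) g"
    and r: "\<And>k. \<bar>r k\<bar> \<le> \<rho>"
    and coeff: "\<And>k. (LINT y|height_interval ell. f y * sin (freq ell k * y)) =
      r k * (LINT y|height_interval ell. g y * sin (freq ell k * y))"
  shows "L2_norm (height_interval ell) f \<le> \<rho> * L2_norm (height_interval ell) g"
proof -
  let ?I = "height_interval ell" and ?s = "\<lambda>k y. sin (freq ell k * y)"
  have \<rho>: "\<rho> \<ge> 0" using r[of 0] by linarith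
  have s: "sq_integrable ?I (?s k)" for k
    by (intro continuous_sq_integrable_height continuous_intros)
  have int_sum: "(LINT y|?I. h y * (\<Sum>k<n. a k * ?s k y)) = (\<Sum>k<n. a k * (LINT y|?I. h y * ?s k y))"
    if "sq_integrable ?I h" for h a n
  proof -
    have "(LINT y|?I. h y * (\<Sum>k<n. a k * ?s k y)) = (LINT y|?I. (\<Sum>k<n. a k * (h y * ?s k y)))"
      by (simp add: sum_distrib_left mult.left_commute)
    also have "\<dots> = (\<Sum>k<n. a k * (LINT y|?I. h y * ?s k y))"
      using sq_integrable_inner_integrable[OF that s] by (subst Bochner_Integration.integral_sum) auto
    finally show ?thesis .
  qed
  have span_sq: "sq_integrable ?I \<phi>" if "\<phi> \<in> sine_span ell" for \<phi>
    by (rule continuous_sq_integrable_height[OF sine_span_continuous[OF that]])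
  have norm_sum: "(L2_norm ?I (\<lambda>y. \<Sum>k<n. a k * ?s k y))\<^sup>2 = (\<Sum>k<n. (a k)\<^sup>2 * (ell / 2))" for a n
  proof -
    have "(\<lambda>y. \<Sum>k<n. a k * ?s k y) \<in> sine_span ell" by (auto simp: sine_span_def)
    note sq = span_sq[OF this]
    have "(L2_norm ?I (\<lambda>y. \<Sum>k<n. a k * ?s k y))\<^sup>2 =
        (LINT y|?I. (\<Sum>k<n. a k * ?s k y) * (\<Sum>k<n. a k * ?s k y))"
      unfolding L2_norm_sq by (simp add: power2_eq_square)
    also have "\<dots> = (\<Sum>k<n. a k * (LINT y|?I. (\<Sum>k<n. a k * ?s k y) * ?s k y))"
      by (rule int_sum[OF sq])
    also have "\<dots> = (\<Sum>k<n. (a k)\<^sup>2 * (ell / 2))"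
    proof (rule sum.cong[OF refl])
      fix k assume k: "k \<in> {..<n}"
      have "(LINT y|?I. (\<Sum>k<n. a k * ?s k y) * ?s k y) = (LINT y|?I. ?s k y * (\<Sum>k<n. a k * ?s k y))"
        by (simp add: mult.commute)
      also have "\<dots> = (\<Sum>j<n. a j * (LINT y|?I. ?s k y * ?s j y))"
        by (rule int_sum[OF s])
      also have "\<dots> = (\<Sum>j<n. if k = j then a j * (ell / 2) else 0)"
        by (intro sum.cong refl) (simp add: sin_orthogonal[OF ell])
      also have "\<dots> = a k * (ell / 2)" using k by simp
      finally show "a k * (LINT y|?I. (\<Sum>k<n. a k * ?s k y) * ?s k y) = (a k)\<^sup>2 * (ell / 2)"
        by (simp add: power2_eq_square)
    qed
    finally show ?thesis .
  qed
  have dual: "\<bar>L2_inner ?I f \<phi>\<bar> \<le> \<rho> * L2_norm ?I g * L2_norm ?I \<phi>" if span: "\<phi> \<in> sine_span ell" for \<phi>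
  proof -
    obtain n a where \<phi>: "\<phi> = (\<lambda>y. \<Sum>k<n. a k * ?s k y)"
      using span by (auto simp: sine_span_def)
    \<comment> \<open>The adjoint damping: moving the factors \<open>r k\<close> onto the
      coefficients of the test sum turns its pairing with \<open>f\<close> into a pairing with
      \<open>g\<close>.\<close>
    define \<psi> where "\<psi> = (\<lambda>y. \<Sum>k<n. (r k * a k) * ?s k y)"
    have \<psi>: "\<psi> \<in> sine_span ell"
      unfolding \<psi>_def sine_span_def by (intro CollectI exI[of _ n] exI[of _ "\<lambda>k. r k * a k"]) simp
    have "L2_inner ?I f \<phi> = L2_inner ?I g \<psi>"
      unfolding L2_inner_def \<phi> \<psi>_def inner_real_def int_sum[OF f] int_sum[OF g] coeff
      by (simp add: mult_ac)
    then have "\<bar>L2_inner ?I f \<phi>\<bar> \<le> L2_norm ?I g * L2_norm ?I \<psi>"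
      using L2_Cauchy_Schwarz[OF g span_sq[OF \<psi>]] by simp
    also have "\<dots> \<le> L2_norm ?I g * (\<rho> * L2_norm ?I \<phi>)"
    proof (rule mult_left_mono[OF power2_le_imp_le L2_norm_nonneg])
      have "(L2_norm ?I \<psi>)\<^sup>2 = (\<Sum>k<n. (r k)\<^sup>2 * ((a k)\<^sup>2 * (ell / 2)))"
        unfolding \<psi>_def norm_sum by (simp add: power_mult_distrib mult.assoc)
      also have "\<dots> \<le> (\<Sum>k<n. \<rho>\<^sup>2 * ((a k)\<^sup>2 * (ell / 2)))"
      proof (intro sum_mono mult_right_mono)
        fix k
        show "(r k)\<^sup>2 \<le> \<rho>\<^sup>2" using r[of k] \<rho> by (simp add: abs_le_square_iff[symmetric])
        show "0 \<le> (a k)\<^sup>2 * (ell / 2)" using ell by simp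
      qed
      also have "\<dots> = (\<rho> * L2_norm ?I \<phi>)\<^sup>2"
        unfolding power_mult_distrib \<phi> norm_sum by (simp add: sum_distrib_left)
      finally show "(L2_norm ?I \<psi>)\<^sup>2 \<le> (\<rho> * L2_norm ?I \<phi>)\<^sup>2" .
    qed (simp add: \<rho> L2_norm_nonneg)
    finally show ?thesis by (simp add: mult_ac)
  qed
  \<comment> \<open>Pairing \<open>f\<close> with a sine sum close to \<open>f\<close> itself gives
    F^2 \<le> H F up to an error proportional to \<epsilon>; division by \<open>F\<close> then ends
    the proof.\<close>
  define F H where "F = L2_norm ?I f" and "H = \<rho> * L2_norm ?I g"
  have FH: "F \<ge> 0" "H \<ge> 0" by (simp_all add: F_def H_def L2_norm_nonneg \<rho>)
  have "F\<^sup>2 \<le> H * F + (F + H) * \<epsilon>" if "\<epsilon> > 0" for \<epsilon>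
  proof -
    obtain \<phi> where \<phi>: "\<phi> \<in> sine_span ell" "L2_norm ?I (\<lambda>y. f y - \<phi> y) < \<epsilon>"
      using sine_span_dense[OF ell f \<open>\<epsilon> > 0\<close>] .
    note sq = span_sq[OF \<phi>(1)]
    have "F\<^sup>2 = L2_inner ?I f f"
      unfolding F_def L2_norm_sq L2_inner_def by (simp add: power2_eq_square)
    also have "\<dots> = L2_inner ?I f (\<lambda>y. f y - \<phi> y) + L2_inner ?I f \<phi>"
      using sq_integrable_inner_integrable[OF f f] sq_integrable_inner_integrable[OF f sq]
      by (simp add: L2_inner_def right_diff_distrib)
    finally have split: "F\<^sup>2 = L2_inner ?I f (\<lambda>y. f y - \<phi> y) + L2_inner ?I f \<phi>" .
    have "L2_inner ?I f (\<lambda>y. f y - \<phi> y) \<le> F * L2_norm ?I (\<lambda>y. f y - \<phi> y)"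
      using L2_Cauchy_Schwarz[OF f sq_integrable_diff[OF f sq]] by (simp add: F_def)
    also have "\<dots> \<le> F * \<epsilon>" using \<phi>(2) FH by (intro mult_left_mono) auto
    finally have 1: "L2_inner ?I f (\<lambda>y. f y - \<phi> y) \<le> F * \<epsilon>" .
    have "L2_inner ?I f \<phi> \<le> H * L2_norm ?I \<phi>"
      using dual[OF \<phi>(1)] by (simp add: H_def)
    also have "\<dots> \<le> H * (\<epsilon> + F)"
      using L2_norm_triangle[OF sq f] \<phi>(2) L2_norm_minus_commute[of ?I f \<phi>] FH
      by (intro mult_left_mono) (auto simp: F_def)
    finally show ?thesis using split 1 by (simp add: algebra_simps)
  qed
  note eps = this
  have le: "F\<^sup>2 \<le> H * F"
  proof (rule field_le_epsilon)
    fix e :: real assume "e > 0"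
    have "(F + H) * (e / (F + H + 1)) \<le> e"
      using FH \<open>e > 0\<close> by (simp add: field_simps)
    then show "F\<^sup>2 \<le> H * F + e"
      using eps[of "e / (F + H + 1)"] FH \<open>e > 0\<close> by simp
  qed
  show ?thesis
  proof (cases "F = 0")
    case True
    then show ?thesis using FH by (simp add: F_def H_def)
  next
    case False
    then have "F \<le> H" using le FH by (simp add: power2_eq_square)
    then show ?thesis by (simp add: F_def H_def)
  qed
qed

section \<open>The horizontal mean of a weak solution\<close>

text \<open>The exceptional null set may depend on \<open>T\<close>; countably many intervals
  exhaust the half-line.\<close>

lemma AE_lebesgue_on_halfline:
  assumes "\<And>T. T > 0 \<Longrightarrow> AE t in lebesgue_on {0..T::real}. P t"
  shows "AE t in lebesgue_on {0<..}. P t"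
proof -
  have "AE t in lebesgue. t \<in> {0..real (Suc n)} \<longrightarrow> P t" for n
  proof -
    have "AE t in lebesgue_on {0..real (Suc n)}. P t" by (rule assms) simp
    then show ?thesis by (subst (asm) AE_restrict_space_iff) auto
  qed
  then have "AE t in lebesgue. \<forall>n. t \<in> {0..real (Suc n)} \<longrightarrow> P t"
    by (subst AE_all_countable) blast
  then have "AE t in lebesgue. t \<in> {0<..} \<longrightarrow> P t"
  proof eventually_elim
    case (elim t)
    obtain n where "t \<le> real n" using real_arch_simple by blast
    then have "t \<le> real (Suc n)" by simp
    then show ?case using elim by auto
  qed
  then show ?thesis by (subst AE_restrict_space_iff) auto
qed

text \<open>Measurability is asked of \<open>g\<close> alone: Lebesgue measure is complete, so
  \<open>f\<close> inherits it. In the application \<open>f\<close> contains the pairing of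
  \<open>du t\<close> with a fixed field, whose measurability in time is thus read off from the
  equation.\<close>

lemma lebesgue_on_integral_cong_AE:
  fixes f g :: "'a::euclidean_space \<Rightarrow> real"
  assumes S: "S \<in> sets lebesgue" and ae: "AE t in lebesgue_on S. f t = g t"
    and g: "g \<in> borel_measurable (lebesgue_on S)"
  shows "(LINT t|lebesgue_on S. f t) = (LINT t|lebesgue_on S. g t)"
proof -
  let ?f = "\<lambda>t. indicator S t *\<^sub>R f t" and ?g = "\<lambda>t. indicator S t *\<^sub>R g t"
  have gm: "?g \<in> borel_measurable lebesgue"
    using g S by (subst (asm) borel_measurable_restrict_space_iff) auto
  have "AE t in lebesgue. t \<in> S \<longrightarrow> f t = g t"
    using ae S by (subst (asm) AE_restrict_space_iff) auto
  then have ae': "AE t in lebesgue. ?f t = ?g t"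
    by eventually_elim (auto simp: indicator_def)
  have fm: "?f \<in> borel_measurable lebesgue"
  proof (rule measurableI)
    fix A :: "real set" assume A: "A \<in> sets borel"
    have "AE t in lebesgue. t \<in> ?g -` A \<inter> space lebesgue \<longleftrightarrow> t \<in> ?f -` A \<inter> space lebesgue"
      using ae' by eventually_elim (simp only: Int_iff vimage_eq)
    then show "?f -` A \<inter> space lebesgue \<in> sets lebesgue"
      by (rule completion.in_sets_AE) (use measurable_sets[OF gm A] in auto)
  qed simp
  have "(LINT t|lebesgue. ?f t) = (LINT t|lebesgue. ?g t)"
    by (rule integral_cong_AE[OF fm gm ae'])
  then show ?thesis
    using S by (simp only: integral_restrict_space sets_lebesgue_on_refl Int_UNIV_right space_completion space_lborel space_borel)
qed

text \<open>The coefficient is continuous in time and solves the scalar weak equation with \<kappa>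
  the squared frequency: trivially for vertical \<open>b\<close>, where it is 0 at almost every
  time, and by the weak formulation for horizontal \<open>b\<close>.\<close>

lemma weak_solution_coefficient_decay:
  fixes u :: "real \<Rightarrow> ('n::finite) field"
  assumes ell: "ell > 0" and sol: "weak_solution ell \<mu> u h u0 h0" and b: "b \<in> Basis" and "0 \<le> t"
  shows "L2_inner (slab ell) (\<lambda>z. u t z \<bullet> b) (\<lambda>z. sin (freq ell k * snd z)) =
    exp (- (freq ell k)\<^sup>2 * t) * L2_inner (slab ell) (\<lambda>z. u 0 z \<bullet> b) (\<lambda>z. sin (freq ell k * snd z))"
proof -
  let ?\<omega> = "freq ell k"
  let ?s = "\<lambda>y. sin (?\<omega> * y)"
  let ?w = "\<lambda>z::'n pt. ?s (snd z) *\<^sub>R b"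
  have \<omega>: "?\<omega> > 0" by (rule freq_pos[OF ell])
  define c where "c t = L2_inner (slab ell) (u t) ?w" for t
  have c_eq: "c t = L2_inner (slab ell) (\<lambda>z. u t z \<bullet> b) (\<lambda>z. ?s (snd z))" for t
    unfolding c_def L2_inner_def by (simp add: mult.commute)
  have sq_w: "sq_integrable (slab ell) ?w"
    by (intro continuous_sq_integrable_slab continuous_intros)
  have ucont: "L2_continuous (slab ell) (L2_slab ell) u"
    using sol unfolding weak_solution_def by blast
  then have sq_u: "sq_integrable (slab ell) (u t)" if "t \<ge> 0" for t
    using that by (auto simp: L2_continuous_def L2_slab_def)
  have cc: "continuous_on {0..} c"
    unfolding continuous_on_def
  proof
    fix t :: real assume t: "t \<in> {0..}"
    have "((\<lambda>s. L2_norm (slab ell) (\<lambda>x. u s x - u t x)) \<longlongrightarrow> 0) (at t within {0..})"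
      using ucont t by (auto simp: L2_continuous_def)
    then show "(c \<longlongrightarrow> c t) (at t within {0..})"
      unfolding c_def
    proof (rule L2_inner_tendsto)
      show "\<forall>\<^sub>F s in at t within {0..}. sq_integrable (slab ell) (u s)"
        unfolding eventually_at_filter by (intro always_eventually) (auto intro: sq_u)
    qed (use sq_u t sq_w in auto)
  qed
  have H1: "AE t in lebesgue_on {0<..}. u t \<in> H1sol ell"
    using sol unfolding weak_solution_def L2loc_time_def L2_time_def
    by (intro AE_lebesgue_on_halfline) blast
  have weak: "(LINT t|lebesgue_on {0<..}. c t * deriv \<phi> t) = ?\<omega>\<^sup>2 * (LINT t|lebesgue_on {0<..}. c t * \<phi> t)"
    if \<phi>: "time_test \<phi>" for \<phi>
    using b
  proof (cases rule: Basis_pt_cases)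
    case vertical
    have zero: "c t = 0" if "u t \<in> H1sol ell" for t
      unfolding c_eq vertical
    proof (rule solenoidal_vertical_mean_zero[OF ell that])
      \<comment> \<open>The primitive of the sine that vanishes at \<open>ell\<close>, as the
        mean-zero lemma demands.\<close>
      show "((\<lambda>y. - cos (?\<omega> * y) / ?\<omega>) has_real_derivative ?s y) (at y)" for y
        using \<omega> by (auto intro!: derivative_eq_intros)
    qed (auto intro!: continuous_intros simp: cos_freq_ell[OF ell])
    from H1 have "AE t in lebesgue_on {0<..}. c t = 0"
      by eventually_elim (rule zero)
    then have "(LINT t|lebesgue_on {0<..}. c t * deriv \<phi> t) = 0" "(LINT t|lebesgue_on {0<..}. c t * \<phi> t) = 0"
      by (auto intro!: integral_eq_zero_AE)
    then show ?thesis by simp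
  next
    case (horizontal e)
    have wH1: "?w \<in> H1sol ell"
      unfolding horizontal(2)
    proof (rule horizontal_field_H1sol[OF ell])
      show "smooth ?s"
        by (intro smooth_compose[OF smooth_sin] smooth_mult smooth_const smooth_ident)
      show "(?s has_real_derivative ?\<omega> * cos (?\<omega> * y)) (at y)" for y
        by (auto intro!: derivative_eq_intros)
    qed (auto intro!: continuous_intros)
    obtain du m where du: "has_time_derivative_on (H1sol ell) (\<lambda>t. L2_inner (slab ell) (u t)) du"
      and eqn: "\<And>T v. T > 0 \<Longrightarrow> L2_time {0..T} (H1sol ell) (H1sol_norm ell) v \<Longrightarrow>
        (AE t in lebesgue_on {0..T}.
          complex_of_real (du t (v t) + 1 / 2 * sym_grad_inner ell (u t) (v t)) +
          (LINT x|torus. m t x * complex_of_real (trace ell ell (\<lambda>z. snd (v t z)) x)) = 0)"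
      using sol unfolding weak_solution_def by blast
    have "AE t in lebesgue_on {0<..}. complex_of_real (du t ?w + 1 / 2 * sym_grad_inner ell (u t) ?w) +
          (LINT x|torus. m t x * complex_of_real (trace ell ell (\<lambda>z. snd (?w z)) x)) = 0"
      by (intro AE_lebesgue_on_halfline eqn[OF _ L2_time_const[OF ell wH1]])
    then have "AE t in lebesgue_on {0<..}. du t ?w * \<phi> t = - ?\<omega>\<^sup>2 * (c t * \<phi> t)"
      using H1
    proof eventually_elim
      case (elim t)
      \<comment> \<open>The surface term sees only the vertical component of the test field, which
        is 0, and the chosen trace of 0 vanishes almost everywhere.\<close>
      have "(\<lambda>z. snd (?w z)) = (\<lambda>_. 0)" using horizontal by auto
      then have "(LINT x|torus. m t x * complex_of_real (trace ell ell (\<lambda>z. snd (?w z)) x)) = 0"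
        using trace_zero_AE[OF ell, where 'n = 'n]
        by (intro integral_eq_zero_AE) (auto elim!: eventually_mono)
      then have "complex_of_real (du t ?w + 1 / 2 * sym_grad_inner ell (u t) ?w) = 0"
        using elim(1) by simp
      then have du_eq: "du t ?w = - (1 / 2 * sym_grad_inner ell (u t) ?w)"
        by (simp only: of_real_eq_0_iff add_eq_0_iff2) 
      have "1 / 2 * sym_grad_inner ell (u t) ?w =
          - L2_inner (slab ell) (\<lambda>z. u t z \<bullet> (e, 0)) (\<lambda>z. - ?\<omega>\<^sup>2 * ?s (snd z))"
        unfolding horizontal(2)
      proof (rule sym_grad_inner_horizontal_field[OF ell elim(2) horizontal(1)])
        show "(?s has_real_derivative ?\<omega> * cos (?\<omega> * y)) (at y)" for y
          by (auto intro!: derivative_eq_intros)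
        show "((\<lambda>y. ?\<omega> * cos (?\<omega> * y)) has_real_derivative - ?\<omega>\<^sup>2 * ?s y) (at y)" for y
          by (auto intro!: derivative_eq_intros simp: power2_eq_square)
      qed (auto intro!: continuous_intros simp: cos_freq_ell[OF ell])
      also have "\<dots> = ?\<omega>\<^sup>2 * c t"
      proof -
        have "(\<lambda>z. (u t z \<bullet> (e, 0)) \<bullet> (- ?\<omega>\<^sup>2 * ?s (snd z))) =
            (\<lambda>z. - ?\<omega>\<^sup>2 * ((u t z \<bullet> (e, 0)) \<bullet> ?s (snd z)))"
          by (auto simp: mult_ac)
        then show ?thesis
          unfolding c_eq horizontal(2) L2_inner_def by (simp only: integral_mult_right_zero)
      qed
      finally show ?case using du_eq by simp
    qed
    then have "(LINT t|lebesgue_on {0<..}. du t ?w * \<phi> t) = (LINT t|lebesgue_on {0<..}. - ?\<omega>\<^sup>2 * (c t * \<phi> t))"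
    proof (rule lebesgue_on_integral_cong_AE[rotated])
      have "continuous_on {0<..} (\<lambda>t. - ?\<omega>\<^sup>2 * (c t * \<phi> t))"
        using \<phi> by (intro continuous_intros continuous_on_subset[OF cc] smooth_continuous_on)
          (auto simp: time_test_def)
      then show "(\<lambda>t. - ?\<omega>\<^sup>2 * (c t * \<phi> t)) \<in> borel_measurable (lebesgue_on {0<..})"
        by (intro continuous_imp_measurable_on_sets_lebesgue) auto
    qed simp
    then have "- (LINT t|lebesgue_on {0<..}. du t ?w * \<phi> t) = ?\<omega>\<^sup>2 * (LINT t|lebesgue_on {0<..}. c t * \<phi> t)"
      by simp
    moreover have "(LINT t|lebesgue_on {0<..}. c t * deriv \<phi> t) = - (LINT t|lebesgue_on {0<..}. du t ?w * \<phi> t)"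
      using du wH1 \<phi> unfolding has_time_derivative_on_def c_def by blast
    ultimately show ?thesis by simp
  qed
  show ?thesis
    using weak_decay_ode[OF cc weak \<open>0 \<le> t\<close>] by (simp add: c_eq mult.commute)
qed

section \<open>Horizontal means and the energy at frequency zero\<close>

definition hmean :: "(('n::finite) pt \<Rightarrow> real) \<Rightarrow> real \<Rightarrow> real" where
  "hmean f y = (LINT x|torus. f (x, y))"

lemma rfourier_0: "rfourier f (0 :: int ^ 'n) = complex_of_real (LINT x|torus. f x)"
  by (simp add: fourier_def)

text \<open>Cauchy-Schwarz against the constant 1, on a torus of total mass 1, bounds the squared
  mean on almost every slice by the integral of the square, which is integrable in the height by
  Fubini.\<close>

lemma sq_integrable_hmean:
  fixes f :: "('n::finite) pt \<Rightarrow> real"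
  assumes f: "sq_integrable (slab ell) f"
  shows "sq_integrable (height_interval ell) (hmean f)"
proof -
  have int: "integrable (torus \<Otimes>\<^sub>M height_interval ell) (\<lambda>(x, y). f (x, y))"
    "integrable (torus \<Otimes>\<^sub>M height_interval ell) (\<lambda>(x, y). (f (x, y))\<^sup>2)"
    using sq_integrable_integrable[OF finite_measure_slab f] f
    by (simp_all add: slab_eq_pair sq_integrable_def case_prod_unfold)
  have m: "hmean f \<in> borel_measurable (height_interval ell)"
    using slab.integrable_snd[OF int(1)] by (auto simp: hmean_def[abs_def])
  have "integrable (height_interval ell) (\<lambda>y. (hmean f y)\<^sup>2)"
  proof (rule Bochner_Integration.integrable_bound[OF slab.integrable_snd[OF int(2)]])
    show "AE y in height_interval ell. norm ((hmean f y)\<^sup>2) \<le> norm (LINT x|torus. (f (x, y))\<^sup>2)"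
      using slab.AE_integrable_snd[OF int(1)] slab.AE_integrable_snd[OF int(2)]
    proof eventually_elim
      case (elim y)
      have sq: "sq_integrable torus (\<lambda>x. f (x, y))" "sq_integrable torus (\<lambda>_::real^'n. 1::real)"
        using elim by (auto simp: sq_integrable_def)
      have "\<bar>hmean f y\<bar> \<le> L2_norm torus (\<lambda>x. f (x, y))"
        using L2_Cauchy_Schwarz[OF sq] measure_torus_space[where 'n = 'n]
        by (simp add: L2_inner_def hmean_def L2_norm_def[of _ "\<lambda>_. 1"])
      then have "\<bar>hmean f y\<bar>\<^sup>2 \<le> (L2_norm torus (\<lambda>x. f (x, y)))\<^sup>2"
        by (intro power_mono) auto
      then show ?case by (simp add: L2_norm_sq)
    qed
  qed (use m in measurable)
  then show ?thesis using m by (simp add: sq_integrable_def)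
qed

text \<open>Identifies the sine coefficients of the mean profile with the pairings on the slab whose
  decay is known.\<close>

lemma integral_hmean_mult:
  fixes f :: "('n::finite) pt \<Rightarrow> real"
  assumes f: "sq_integrable (slab ell) f" and s: "continuous_on UNIV s"
  shows "(LINT y|height_interval ell. hmean f y * s y) = L2_inner (slab ell) f (\<lambda>z. s (snd z))"
proof -
  have "L2_inner (slab ell) f (\<lambda>z. s (snd z)) = (LINT y|height_interval ell. LINT x|torus. f (x, y) \<bullet> s (snd (x, y)))"
    unfolding L2_inner_def
    by (rule slab_Fubini(1)[OF sq_integrable_inner_integrable[OF f L2_slab_height(2)[OF s]]])
  then show ?thesis by (simp add: hmean_def)
qed

lemma sq_integrable_inner_const:
  assumes "sq_integrable M f"
  shows "sq_integrable M (\<lambda>z. f z \<bullet> b)"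
proof -
  have [measurable]: "f \<in> borel_measurable M" using assms by (simp add: sq_integrable_def)
  have "integrable M (\<lambda>z. (f z \<bullet> b)\<^sup>2)"
  proof (rule Bochner_Integration.integrable_bound)
    show "integrable M (\<lambda>z. (norm (f z))\<^sup>2 * (norm b)\<^sup>2)"
      using assms by (auto simp: sq_integrable_def)
    have "(f z \<bullet> b)\<^sup>2 \<le> (norm (f z))\<^sup>2 * (norm b)\<^sup>2" for z
      using power_mono[OF Cauchy_Schwarz_ineq2[of "f z" b] abs_ge_zero, of 2]
      by (simp add: power_mult_distrib)
    then show "AE z in M. norm ((f z \<bullet> b)\<^sup>2) \<le> norm ((norm (f z))\<^sup>2 * (norm b)\<^sup>2)"
      by simp
  qed measurable
  then show ?thesis by (simp add: sq_integrable_def)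
qed

lemma weak_solution_sq_integrable:
  assumes "weak_solution ell \<mu> u h u0 h0" "0 \<le> t"
  shows "sq_integrable (slab ell) (\<lambda>z. u t z \<bullet> b)"
  by (rule sq_integrable_inner_const)
    (use assms in \<open>auto simp: weak_solution_def L2_continuous_def L2_slab_def\<close>)

text \<open>The mean-zero condition on \<open>h\<close> is imposed at every time, so the identity
  holds for every nonnegative \<open>t\<close> and not merely for almost every one; what remains
  splits over the components of the velocity.\<close>

lemma energy_0_eq:
  fixes u :: "real \<Rightarrow> ('n::finite) field"
  assumes sol: "weak_solution ell \<mu> u h u0 h0" and t: "0 \<le> t"
  shows "energy ell \<mu> u h 0 t =
    1 / 2 * (\<Sum>b\<in>Basis. (L2_norm (height_interval ell) (hmean (\<lambda>z. u t z \<bullet> b)))\<^sup>2)"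
proof -
  note sq = weak_solution_sq_integrable[OF sol t]
  have h: "(LINT x|torus. h t x) = 0"
    using sol t by (auto simp: weak_solution_def)
  have "(LBINT y:{0<..<ell}. \<Sum>b\<in>Basis. (cmod (rfourier (\<lambda>x. u t (x, y) \<bullet> b) 0))\<^sup>2) =
      (LINT y|height_interval ell. (\<Sum>b\<in>Basis. (hmean (\<lambda>z. u t z \<bullet> b) y)\<^sup>2))"
    unfolding rfourier_0 hmean_def norm_of_real power2_abs set_lebesgue_integral_def
    by (subst integral_restrict_space) auto
  also have "\<dots> = (\<Sum>b\<in>Basis. (L2_norm (height_interval ell) (hmean (\<lambda>z. u t z \<bullet> b)))\<^sup>2)"
    unfolding L2_norm_sq using sq_integrable_hmean[OF sq]
    by (subst Bochner_Integration.integral_sum) (auto simp: sq_integrable_def)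
  finally show ?thesis by (simp add: energy_def rfourier_0 h)
qed

theorem theorem3p3:
  fixes ell \<theta> :: real
    and \<mu> :: "int ^ 'n \<Rightarrow> real"
    and u :: "real \<Rightarrow> ('n::finite) field" and u0 :: "'n field"
    and h :: "real \<Rightarrow> real ^ 'n \<Rightarrow> real" and h0 :: "real ^ 'n \<Rightarrow> real"
  assumes "ell > 0" and "\<theta> > 0"
    and "\<And>\<xi>. \<theta> \<le> \<mu> \<xi> \<and> \<mu> \<xi> \<le> 1 / \<theta> * (1 + norm (lattice_vec \<xi>)) ^ 3"
    and "weak_solution ell \<mu> u h u0 h0"
  shows "\<exists>\<delta>>0. \<forall>t\<ge>0. energy ell \<mu> u h 0 t \<le> energy ell \<mu> u h 0 0 * exp (- \<delta> * t)"
proof (intro exI[of _ "2 * (freq ell 0)\<^sup>2"] conjI allI impI)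
  \<comment> \<open>The amplitudes decay at the rate \<open>(freq ell 0)\<^sup>2\<close>; the energy
    is quadratic in them, whence the factor 2.\<close>
  show "2 * (freq ell 0)\<^sup>2 > 0"
    using freq_pos[OF assms(1), of 0] by simp
  fix t :: real assume t: "0 \<le> t"
  let ?I = "height_interval ell" and ?U = "\<lambda>b t. hmean (\<lambda>z. u t z \<bullet> b)" and ?\<rho> = "exp (- (freq ell 0)\<^sup>2 * t)"
  note sq = weak_solution_sq_integrable[OF assms(4)]
  have "L2_norm ?I (?U b t) \<le> ?\<rho> * L2_norm ?I (?U b 0)" if b: "b \<in> Basis" for b
  proof (rule damped_sine_coefficients[OF assms(1), where r = "\<lambda>k. exp (- (freq ell k)\<^sup>2 * t)"])
    show "sq_integrable ?I (?U b t)" "sq_integrable ?I (?U b 0)"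
      by (intro sq_integrable_hmean sq t order_refl)+
    \<comment> \<open>The lowest frequency is damped least, so its factor bounds all the others
      uniformly.\<close>
    fix k
    have "(freq ell 0)\<^sup>2 * t \<le> (freq ell k)\<^sup>2 * t"
      using freq_mono[OF assms(1), of k] freq_pos[OF assms(1), of 0] t
      by (intro mult_right_mono power_mono) auto
    then show "\<bar>exp (- (freq ell k)\<^sup>2 * t)\<bar> \<le> ?\<rho>" by simp
    have coeff: "(LINT y|?I. ?U b r y * sin (freq ell k * y)) =
        L2_inner (slab ell) (\<lambda>z. u r z \<bullet> b) (\<lambda>z. sin (freq ell k * snd z))" if "r \<ge> 0" for r
      by (rule integral_hmean_mult[OF sq[OF that]]) (intro continuous_intros)
    show "(LINT y|?I. ?U b t y * sin (freq ell k * y)) =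
        exp (- (freq ell k)\<^sup>2 * t) * (LINT y|?I. ?U b 0 y * sin (freq ell k * y))"
      unfolding coeff[OF t] coeff[OF order_refl]
      by (rule weak_solution_coefficient_decay[OF assms(1,4) b t])
  qed
  then have "(\<Sum>b\<in>Basis. (L2_norm ?I (?U b t))\<^sup>2) \<le> (\<Sum>b\<in>Basis. (?\<rho> * L2_norm ?I (?U b 0))\<^sup>2)"
    by (intro sum_mono power_mono L2_norm_nonneg)
  also have "\<dots> = ?\<rho>\<^sup>2 * (\<Sum>b\<in>Basis. (L2_norm ?I (?U b 0))\<^sup>2)"
    by (simp add: power_mult_distrib sum_distrib_left)
  also have "?\<rho>\<^sup>2 = exp (- (2 * (freq ell 0)\<^sup>2) * t)"
    by (simp add: power2_eq_square[of "exp _"] flip: exp_add)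
  finally show "energy ell \<mu> u h 0 t \<le> energy ell \<mu> u h 0 0 * exp (- (2 * (freq ell 0)\<^sup>2) * t)"
    unfolding energy_0_eq[OF assms(4) t] energy_0_eq[OF assms(4) order_refl] by (simp add: mult_ac)
qed

end
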